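(* Let $m\ge2$ be an integer, $r\in(0,1)$, and $\gamma\in(0,1)$ the reciprocal of a positive integer, all fixed. For each prime $p$ such that $\gamma(p-1)$ is an integer, let $G=\mathbb{F}_{p^m}$, let $H\le\mathbb{F}_{p^{m+1}}^\times$ be the unique cyclic subgroup of order $\gamma(p^{m+1}-1)$, let $n=|\langle G,H\rangle|$, and let $\mathcal{C}=\mathcal{C}(G,H;r,n)$ be the associated evaluation code of length $n$ with global degree parameter $D=n$ (all defined in the context). Then, as $p\to\infty$ through such primes, the codes $\mathcal{C}$ form a family of expander codes (in the sense of the context) such that: 1. The left local codes have length $|G|=p^m=\Theta(n^{\frac{m}{(m+1)^2}})$ and the right local codes have length $|H|=\gamma(p^{m+1}-1)=\Theta(n^{\frac{1}{m+1}})$; the local codes have rate at most $r+o(1)$ and relative minimum distance at least $1-r-o(1)$. 2. The relative minimum distance $\delta$ of $\mathcal{C}$ satisfies asymptotically $\delta\ge(1-r)^2$, i.e. $\liminf_{p\to\infty}\delta\ge(1-r)^2$. 3. The rate $R=\dim_{\mathbb{F}}(\mathcal{C})/n$ satisfies asymptotically $$R\ \ge\ \frac{\gamma^{2m}\,r^{2m+2}}{(2m+1)!},$$ i.e. $\liminf_{p\to\infty}R$ is at least the right-hand side. Here $o(1)$ denotes quantities tending to $0$ as $p\to\infty$ with $m,r,\gamma$ fixed.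
   Context: Groups and field. $G=\mathbb{F}_{p^m}$ (additive group) and $H\le\mathbb{F}_{p^{m+1}}^\times$ with $|H|=\gamma(p^{m+1}-1)$. Let $\mathbb{F}$ be a finite extension field of $\mathbb{F}_p$ containing $G$ and $H$. Identify $G$ with the translation group $\{x\mapsto x+a: a\in G\}$ and $H$ with the scaling group $\{x\mapsto hx: h\in H\}$, both subgroups of $\mathrm{AGL}(1,\mathbb{F})=\{x\mapsto ax+b: a\in\mathbb{F}^\times, b\in\mathbb{F}\}$, and let $A=\langle G,H\rangle$ be the subgroup they generate; $\mathbb{F}$ is assumed large enough that $|\mathbb{F}|\ge|A|$ (e.g. $\mathbb{F}=\mathbb{F}_{p^{2m(m+1)}}$). Put $g(X)=\prod_{a\in\mathbb{F}_{p^m}}(X-a)=X^{p^m}-X$ and $h(X)=X^{|H|}$. Evaluation set. Since $|\mathbb{F}|\ge|A|$, there is $\alpha\in\mathbb{F}$ with trivial stabilizer in $A$; fix such an $\alpha$ and let $\Omega=\{\phi(\alpha):\phi\in A\}$, so $n:=|\Omega|=|A|$. Base-$u$ degree. For a nonconstant $u\in\mathbb{F}[X]$, every $f\in\mathbb{F}[X]$ has a unique expansion $f=\sum_i c_i u^i$ with $\deg c_i<\deg u$; $\deg_u(f):=\max_i\deg(c_i)$, with $\deg(0)=-\infty$. Code. For an integer $D\le n$, $\mathcal{W}_{r,D}=\{f\in\mathbb{F}[X]:\deg f<D,\ \deg_g(f)<r|G|,\ \deg_h(f)<r|H|\}$ and $\mathcal{C}(G,H;r,D)=\{(f(\beta))_{\beta\in\Omega}: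 f\in\mathcal{W}_{r,D}\}\subseteq\mathbb{F}^{\Omega}$. Graph and expander codes. The bipartite coset graph $\mathsf{B}(G,H)$ has left vertices the right cosets $G\phi$, right vertices the right cosets $H\phi$ ($\phi\in A$), and one edge for each $\phi\in A$, joining $G\phi$ to $H\phi$. Identifying $\phi\in A$ with $\phi(\alpha)\in\Omega$, edges are the code coordinates, left vertices are the $G$-orbits in $\Omega$ and right vertices are the $H$-orbits in $\Omega$. The left (resp. right) local code at an orbit $O$ is the Reed--Solomon code of evaluations on $O$ of polynomials of degree $<r|G|$ (resp. $<r|H|$). The Tanner code is the set of all $c\in\mathbb{F}^\Omega$ whose restriction to every $G$-orbit and every $H$-orbit in $\Omega$ lies in the corresponding local code. With $D=n$, "family of expander codes" means: $\mathcal{C}$ equals this Tanner code, and the second largest singular value of the normalized bi-adjacency matrix $\frac{1}{\sqrt{|G||H|}}\big(|G\phi\cap H\psi|\big)_{G\phi,H\psi}$ tends to $0$ as $p\to\infty$. The relative minimum distance is the minimum distance divided by the length. *)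

theory Defs
  imports
    "HOL-Library.Landau_Symbols"
    "HOL-Library.Countable_Set"
    "HOL-Library.Extended_Real"
    "HOL-Algebra.Bij"
    "HOL-Algebra.Group_Action"
    "HOL-Algebra.Elementary_Groups"
    "HOL-Algebra.Multiplicative_Group"
    "HOL-Algebra.Subrings"
    "HOL-Algebra.UnivPoly"
    "Jordan_Normal_Form.Missing_VectorSpace"
    "Jordan_Normal_Form.Char_Poly"
begin

section \<open>Affine groups over a field\<close>

text \<open>Affine maps are extensional functions on the carrier, so that they live in
  \<^const>\<open>BijGroup\<close>, whose product of \<open>g\<close> and \<open>f\<close> is the composition \<open>g \<circ> f\<close>.
  Consequently \<^const>\<open>r_coset\<close> yields the cosets \<open>{g \<circ> \<phi> | g \<in> G}\<close>.\<close>

definition affine_map :: "('a, 'b) ring_scheme \<Rightarrow> 'a \<Rightarrow> 'a \<Rightarrow> 'a \<Rightarrow> 'a" where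
  "affine_map F a b = (\<lambda>x \<in> carrier F. a \<otimes>\<^bsub>F\<^esub> x \<oplus>\<^bsub>F\<^esub> b)"

definition AGL1 :: "('a, 'b) ring_scheme \<Rightarrow> ('a \<Rightarrow> 'a) monoid" where
  "AGL1 F = (BijGroup (carrier F))
     \<lparr>carrier := {affine_map F a b | a b. a \<in> carrier F - {\<zero>\<^bsub>F\<^esub>} \<and> b \<in> carrier F}\<rparr>"

definition translation_grp :: "('a, 'b) ring_scheme \<Rightarrow> 'a set \<Rightarrow> ('a \<Rightarrow> 'a) set" where
  "translation_grp F G = {affine_map F \<one>\<^bsub>F\<^esub> a | a. a \<in> G}"

definition scaling_grp :: "('a, 'b) ring_scheme \<Rightarrow> 'a set \<Rightarrow> ('a \<Rightarrow> 'a) set" where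
  "scaling_grp F H = {affine_map F h \<zero>\<^bsub>F\<^esub> | h. h \<in> H}"

definition gen_group :: "('a, 'b) ring_scheme \<Rightarrow> 'a set \<Rightarrow> 'a set \<Rightarrow> ('a \<Rightarrow> 'a) monoid" where
  "gen_group F G H = subgroup_generated (AGL1 F) (translation_grp F G \<union> scaling_grp F H)"

definition eval_set :: "('a, 'b) ring_scheme \<Rightarrow> 'a set \<Rightarrow> 'a set \<Rightarrow> 'a \<Rightarrow> 'a set" where
  "eval_set F G H \<alpha> = orbit (gen_group F G H) (\<lambda>\<phi>. \<phi>) \<alpha>"

definition left_orbits :: "('a, 'b) ring_scheme \<Rightarrow> 'a set \<Rightarrow> 'a set \<Rightarrow> 'a \<Rightarrow> 'a set set" where
  "left_orbits F G H \<alpha> =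
     orbits ((AGL1 F)\<lparr>carrier := translation_grp F G\<rparr>) (eval_set F G H \<alpha>) (\<lambda>\<phi>. \<phi>)"

definition right_orbits :: "('a, 'b) ring_scheme \<Rightarrow> 'a set \<Rightarrow> 'a set \<Rightarrow> 'a \<Rightarrow> 'a set set" where
  "right_orbits F G H \<alpha> =
     orbits ((AGL1 F)\<lparr>carrier := scaling_grp F H\<rparr>) (eval_set F G H \<alpha>) (\<lambda>\<phi>. \<phi>)"


section \<open>Degrees and base-\<open>u\<close> expansions\<close>

text \<open>\<^const>\<open>deg\<close> assigns degree \<open>0\<close> to the zero polynomial; here it has degree \<open>-\<infinity>\<close>.\<close>

definition up_deg :: "('a, 'b) ring_scheme \<Rightarrow> (nat \<Rightarrow> 'a) \<Rightarrow> ereal" where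
  "up_deg F f = (if f = \<zero>\<^bsub>UP F\<^esub> then -\<infinity> else ereal (real (deg F f)))"

definition is_base_expansion ::
  "('a, 'b) ring_scheme \<Rightarrow> (nat \<Rightarrow> 'a) \<Rightarrow> (nat \<Rightarrow> 'a) \<Rightarrow> (nat \<Rightarrow> nat \<Rightarrow> 'a) \<Rightarrow> bool" where
  "is_base_expansion F u f c \<longleftrightarrow>
     (\<forall>i. c i \<in> carrier (UP F) \<and> up_deg F (c i) < up_deg F u) \<and>
     finite {i. c i \<noteq> \<zero>\<^bsub>UP F\<^esub>} \<and>
     f = (\<Oplus>\<^bsub>UP F\<^esub>i \<in> {i. c i \<noteq> \<zero>\<^bsub>UP F\<^esub>}. c i \<otimes>\<^bsub>UP F\<^esub> (u [^]\<^bsub>UP F\<^esub> i))"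

definition base_deg :: "('a, 'b) ring_scheme \<Rightarrow> (nat \<Rightarrow> 'a) \<Rightarrow> (nat \<Rightarrow> 'a) \<Rightarrow> ereal" where
  "base_deg F u f = (SUP i. up_deg F ((THE c. is_base_expansion F u f c) i))"

definition poly_g :: "('a, 'b) ring_scheme \<Rightarrow> 'a set \<Rightarrow> nat \<Rightarrow> 'a" where
  "poly_g F G = (\<Otimes>\<^bsub>UP F\<^esub>a \<in> G.
     up_ring.monom (UP F) \<one>\<^bsub>F\<^esub> 1 \<ominus>\<^bsub>UP F\<^esub> up_ring.monom (UP F) a 0)"

definition poly_h :: "('a, 'b) ring_scheme \<Rightarrow> 'a set \<Rightarrow> nat \<Rightarrow> 'a" where
  "poly_h F H = up_ring.monom (UP F) \<one>\<^bsub>F\<^esub> (card H)"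


section \<open>Codes\<close>

text \<open>A word of length \<open>card S\<close> is an element of \<open>S \<rightarrow>\<^sub>E carrier F\<close>.\<close>

definition eval_word :: "('a, 'b) ring_scheme \<Rightarrow> 'a set \<Rightarrow> (nat \<Rightarrow> 'a) \<Rightarrow> 'a \<Rightarrow> 'a" where
  "eval_word F S f = (\<lambda>\<beta> \<in> S. UnivPoly.eval F F id \<beta> f)"

definition msg_space ::
  "('a, 'b) ring_scheme \<Rightarrow> 'a set \<Rightarrow> 'a set \<Rightarrow> real \<Rightarrow> int \<Rightarrow> (nat \<Rightarrow> 'a) set" where
  "msg_space F G H r D =
     {f \<in> carrier (UP F). up_deg F f < ereal (real_of_int D)
        \<and> base_deg F (poly_g F G) f < ereal (r * real (card G))
        \<and> base_deg F (poly_h F H) f < ereal (r * real (card H))}"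

definition eval_code ::
  "('a, 'b) ring_scheme \<Rightarrow> 'a set \<Rightarrow> 'a set \<Rightarrow> 'a \<Rightarrow> real \<Rightarrow> int \<Rightarrow> ('a \<Rightarrow> 'a) set" where
  "eval_code F G H \<alpha> r D = eval_word F (eval_set F G H \<alpha>) ` msg_space F G H r D"

definition RS_code :: "('a, 'b) ring_scheme \<Rightarrow> 'a set \<Rightarrow> real \<Rightarrow> ('a \<Rightarrow> 'a) set" where
  "RS_code F S d = eval_word F S ` {f \<in> carrier (UP F). up_deg F f < ereal d}"

definition tanner_code ::
  "('a, 'b) ring_scheme \<Rightarrow> 'a set \<Rightarrow> 'a set \<Rightarrow> 'a \<Rightarrow> real \<Rightarrow> ('a \<Rightarrow> 'a) set" where
  "tanner_code F G H \<alpha> r =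
     {c \<in> eval_set F G H \<alpha> \<rightarrow>\<^sub>E carrier F.
        (\<forall>S \<in> left_orbits F G H \<alpha>. restrict c S \<in> RS_code F S (r * real (card G))) \<and>
        (\<forall>S \<in> right_orbits F G H \<alpha>. restrict c S \<in> RS_code F S (r * real (card H)))}"

definition code_rate :: "('a, 'b) ring_scheme \<Rightarrow> 'a set \<Rightarrow> ('a \<Rightarrow> 'a) set \<Rightarrow> real" where
  "code_rate F S C =
     real (vectorspace.dim F ((ring.func_space F S)\<lparr>carrier := C\<rparr>)) / real (card S)"

definition min_dist :: "'a set \<Rightarrow> ('a \<Rightarrow> 'a) set \<Rightarrow> nat" where
  "min_dist S C = Inf {card {\<beta> \<in> S. x \<beta> \<noteq> y \<beta>} | x y. x \<in> C \<and> y \<in> C \<and> x \<noteq> y}"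

definition rel_min_dist :: "'a set \<Rightarrow> ('a \<Rightarrow> 'a) set \<Rightarrow> real" where
  "rel_min_dist S C = real (min_dist S C) / real (card S)"


section \<open>Singular values and the coset graph\<close>

text \<open>The singular values of \<open>A\<close>, with multiplicity and in decreasing order.\<close>

definition singular_values :: "real mat \<Rightarrow> real list" where
  "singular_values A = take (min (dim_row A) (dim_col A))
     (rev (sorted_list_of_multiset
       (image_mset sqrt (proots (char_poly (transpose_mat A * A))))))"

definition second_singular_value :: "real mat \<Rightarrow> real" where
  "second_singular_value A = singular_values A ! 1"

text \<open>Rows and columns are numbered by arbitrary enumerations of the two sets of cosets;
  the singular values do not depend on them.\<close>

definition norm_biadjacency :: "('a, 'b) ring_scheme \<Rightarrow> 'a set \<Rightarrow> 'a set \<Rightarrow> real mat" where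
  "norm_biadjacency F G H =
     (let L = rcosets\<^bsub>gen_group F G H\<^esub> (translation_grp F G);
          R = rcosets\<^bsub>gen_group F G H\<^esub> (scaling_grp F H)
      in mat (card L) (card R) (\<lambda>(i, j).
           real (card (from_nat_into L i \<inter> from_nat_into R j))
             / sqrt (real (card G) * real (card H))))"


section \<open>The family of codes\<close>

definition admissible_primes :: "real \<Rightarrow> nat set" where
  "admissible_primes \<gamma> = {p. prime p \<and> \<gamma> * (real p - 1) \<in> \<int>}"

definition at_top_admissible :: "real \<Rightarrow> nat filter" where
  "at_top_admissible \<gamma> = inf at_top (principal (admissible_primes \<gamma>))"

text \<open>\<open>G\<close> and \<open>K\<close> are the subfields of \<open>F\<close> with \<open>p ^ m\<close> and \<open>p ^ (m + 1)\<close> elements.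
  The unit group of \<open>K\<close> is cyclic, so its subgroup \<open>H\<close> is determined by its order.\<close>

definition code_setting ::
  "nat \<Rightarrow> nat \<Rightarrow> real \<Rightarrow> ('a, 'b) ring_scheme \<Rightarrow> 'a set \<Rightarrow> 'a set \<Rightarrow> 'a \<Rightarrow> bool" where
  "code_setting p m \<gamma> F G H \<alpha> \<longleftrightarrow>
     field F \<and> finite (carrier F) \<and>
     subfield G F \<and> card G = p ^ m \<and>
     (\<exists>K. subfield K F \<and> card K = p ^ (m + 1) \<and> subgroup H (mult_of (F\<lparr>carrier := K\<rparr>))) \<and>
     real (card H) = \<gamma> * (real p ^ (m + 1) - 1) \<and>
     Coset.order (gen_group F G H) \<le> card (carrier F) \<and>
     \<alpha> \<in> carrier F \<and>
     stabilizer (gen_group F G H) (\<lambda>\<phi>. \<phi>) \<alpha> = {\<one>\<^bsub>gen_group F G H\<^esub>}"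

end

theory Submission
  imports Defs "HOL-Analysis.Convex"
begin

text \<open>
  The group \<open>\<langle>G, H\<rangle>\<close> consists of the maps \<open>x \<mapsto> h x + v\<close> with \<open>h \<in> H\<close> and \<open>v\<close> in the additive span \<open>V\<close> of \<open>H G\<close>.
  As \<open>H\<close> spans the field \<open>K\<close> with \<open>p ^ (m + 1)\<close> elements, \<open>V\<close> is a vector space over both \<open>K\<close> and \<open>G\<close>; its order
  is thus a power of \<open>p ^ (m * (m + 1))\<close>, and it is fixed pointwise by \<open>x \<mapsto> x ^ (p ^ (m * (m + 1)))\<close>.

  The \<open>G\<close>- and \<open>H\<close>-orbits in \<open>\<Omega>\<close> are full-size fibres of \<open>g\<close> and \<open>h\<close>. Interpolating the coefficients of a base
  expansion over the values of \<open>g\<close> (of \<open>h\<close>) shows that a bound on the base degree is the same as a bound on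
  the degree on each fibre, so the code is the Tanner code.

  For the expansion, average functions on \<open>V\<close> over the subgroups \<open>inv h G\<close>. More than \<open>p ^ m\<close> of these
  subgroups generate \<open>V\<close>, so no nonzero function of mean zero is fixed by more than \<open>p ^ m\<close> of the averages; as the averages
  are commuting orthogonal projections, their squared norms at a function of mean zero sum up to at most
  \<open>p ^ m\<close> times its squared norm. This bounds the second singular value by \<open>sqrt (p ^ m / card H)\<close>, and via an
  expander mixing estimate the support of a nonzero codeword from below.

  For the rate, consider messages \<open>\<Sum>i. c i * g ^ i\<close> with \<open>deg (c i) < r p ^ m\<close>. On an \<open>H\<close>-orbit the
  monomial \<open>x ^ (p ^ e)\<close> is a multiple of \<open>x ^ (p ^ (e mod (m + 1)))\<close>. Hence \<open>g ^ (p ^ j) = x ^ (p ^ (m + j)) - x ^ (p ^ j)\<close>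
  has degree \<open>p ^ m\<close> there if \<open>j\<close> is \<open>0\<close> or \<open>m\<close> modulo \<open>m + 1\<close>, and at most \<open>p ^ (m - 1)\<close> otherwise. Among the
  \<open>m * (m + 1) + 1\<close> base \<open>p\<close> digits of \<open>i\<close> only the \<open>2 * m + 1\<close> special ones matter asymptotically: it suffices that
  their sum is at most about \<open>r \<gamma> p\<close>, and the lattice points of this simplex give the factor
  \<open>(r \<gamma>) ^ (2 * m + 1) / fact (2 * m + 1)\<close>.
\<close>

text \<open>The coset graph is handled in the coordinates \<open>(h, v)\<close> of its edges: right
  vertices become the points \<open>inv h v\<close> of \<open>V\<close>, left vertices the cosets
  \<open>(h, v + G)\<close>, and adjacency averages a function on \<open>V\<close> over
  \<open>inv h G\<close>, up to a dilation. One estimate on these averages therefore serves both the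
  singular value and the distance. It stands in for the characters of \<open>V\<close>: a nontrivial
  one is trivial on at most \<open>p ^ m\<close> of the subgroups, because more than
  \<open>p ^ m\<close> scalars lie in no proper additive subgroup of \<open>K\<close>. Counting
  parity checks yields a positive rate only for \<open>r > 1 / 2\<close>, so for small
  \<open>r\<close> messages have to be exhibited. Their degrees on \<open>G\<close>-orbits are read
  off from the expansion in \<open>g\<close>; the obstacle is the degree on \<open>H\<close>-orbits.
  In the final constant one factor \<open>r\<close> comes from the coefficients \<open>c i\<close>,
  the power \<open>(r \<gamma>) ^ (2 * m + 1) / fact (2 * m + 1)\<close> from the exponents
  \<open>i\<close>, and one \<open>\<gamma>\<close> is lost because the length \<open>n\<close>
  contains the factor \<open>card H\<close>, about \<open>\<gamma> p ^ (m + 1)\<close>. Dimensions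
  are obtained by counting elements, as \<open>F\<close> is finite.\<close>

section \<open>Commuting averages\<close>

text \<open>Induction on the set of projections not yet known to act as the identity or as zero on \<open>f\<close>: such a
  projection \<open>P\<close> splits \<open>f\<close> into the orthogonal parts \<open>P f\<close> and \<open>f - P f\<close>.\<close>

lemma commuting_projections_bound:
  fixes P :: "'k \<Rightarrow> ('a \<Rightarrow> real) \<Rightarrow> 'a \<Rightarrow> real" and b :: real
  assumes fin: "finite I"
    and X_P: "\<And>k f. k \<in> I \<Longrightarrow> X f \<Longrightarrow> X (P k f)"
    and X_diff: "\<And>k f. k \<in> I \<Longrightarrow> X f \<Longrightarrow> X (\<lambda>w. f w - P k f w)"
    and idem: "\<And>k f. k \<in> I \<Longrightarrow> X f \<Longrightarrow> P k (P k f) = P k f"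
    and comm: "\<And>k l f. k \<in> I \<Longrightarrow> l \<in> I \<Longrightarrow> X f \<Longrightarrow> P k (P l f) = P l (P k f)"
    and diff: "\<And>k f g. k \<in> I \<Longrightarrow> X f \<Longrightarrow> X g \<Longrightarrow> P k (\<lambda>w. f w - g w) = (\<lambda>w. P k f w - P k g w)"
    and zero: "\<And>k. k \<in> I \<Longrightarrow> P k (\<lambda>_. 0) = (\<lambda>_. 0)"
    and pyth: "\<And>k f. k \<in> I \<Longrightarrow> X f \<Longrightarrow>
      (\<Sum>w\<in>V. (f w)\<^sup>2) = (\<Sum>w\<in>V. (P k f w)\<^sup>2) + (\<Sum>w\<in>V. (f w - P k f w)\<^sup>2)"
    and bound: "\<And>f. X f \<Longrightarrow> f \<noteq> (\<lambda>_. 0) \<Longrightarrow> real (card {k \<in> I. P k f = f}) \<le> b"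
    and f: "X f"
  shows "(\<Sum>k\<in>I. \<Sum>w\<in>V. (P k f w)\<^sup>2) \<le> b * (\<Sum>w\<in>V. (f w)\<^sup>2)"
proof -
  have main: "\<forall>f. X f \<longrightarrow> (\<forall>k\<in>I - U. P k f = f \<or> P k f = (\<lambda>_. 0)) \<longrightarrow>
      (\<Sum>k\<in>I. \<Sum>w\<in>V. (P k f w)\<^sup>2) \<le> b * (\<Sum>w\<in>V. (f w)\<^sup>2)" if "finite U" "U \<subseteq> I" for U
    using that
  proof (induction U)
    case empty
    show ?case
    proof (intro allI impI)
      fix f assume f: "X f" and all: "\<forall>k\<in>I - {}. P k f = f \<or> P k f = (\<lambda>_. 0)"
      show "(\<Sum>k\<in>I. \<Sum>w\<in>V. (P k f w)\<^sup>2) \<le> b * (\<Sum>w\<in>V. (f w)\<^sup>2)"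
      proof (cases "f = (\<lambda>_. 0)")
        case True
        then show ?thesis using zero by simp
      next
        case False
        have "(\<Sum>k\<in>I. \<Sum>w\<in>V. (P k f w)\<^sup>2) = (\<Sum>k\<in>I. if P k f = f then \<Sum>w\<in>V. (f w)\<^sup>2 else 0)"
          using all by (intro sum.cong refl) (auto split: if_splits)
        also have "\<dots> = card {k \<in> I. P k f = f} * (\<Sum>w\<in>V. (f w)\<^sup>2)"
          using fin by (simp add: sum.If_cases Int_def)
        also have "\<dots> \<le> b * (\<Sum>w\<in>V. (f w)\<^sup>2)"
          by (intro mult_right_mono bound f False sum_nonneg) auto
        finally show ?thesis .
      qed
    qed
  next
    case (insert u U)
    then have u: "u \<in> I" by simp
    show ?case
    proof (intro allI impI)
      fix f assume f: "X f"
        and all: "\<forall>k\<in>I - insert u U. P k f = f \<or> P k f = (\<lambda>_. 0)"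
      define g where "g = P u f"
      define h where "h = (\<lambda>w. f w - P u f w)"
      have Xg: "X g" and Xh: "X h" using u f X_P X_diff by (auto simp: g_def h_def)
      have Pg: "P k g = P u (P k f)" if "k \<in> I" for k
        using comm[OF that u f] by (simp add: g_def)
      have Ph: "P k h = (\<lambda>w. P k f w - P u (P k f) w)" if "k \<in> I" for k
        using diff[OF that f Xg] Pg[OF that] by (simp add: g_def h_def)
      \<comment> \<open>Since \<open>P k\<close> commutes with \<open>P u\<close>, a projection that
        fixes or kills \<open>f\<close> does the same to both parts \<open>g\<close> and
        \<open>h\<close>. Passing to the parts thus only removes \<open>u\<close> from the undecided
        set.\<close>
      have "P k g = g \<or> P k g = (\<lambda>_. 0)" if k: "k \<in> I - U" for k
      proof (cases "k = u")
        case True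
        then show ?thesis using idem[OF u f] by (simp add: g_def)
      next
        case False
        then have "P k f = f \<or> P k f = (\<lambda>_. 0)" using all k by auto
        then show ?thesis using Pg[of k] k zero[OF u] by (auto simp: g_def)
      qed
      then have Ig: "(\<Sum>k\<in>I. \<Sum>w\<in>V. (P k g w)\<^sup>2) \<le> b * (\<Sum>w\<in>V. (g w)\<^sup>2)"
        using insert Xg by auto
      have "P k h = h \<or> P k h = (\<lambda>_. 0)" if k: "k \<in> I - U" for k
      proof (cases "k = u")
        case True
        then show ?thesis using Ph[OF u] idem[OF u f] by simp
      next
        case False
        then have "P k f = f \<or> P k f = (\<lambda>_. 0)" using all k by auto
        then show ?thesis using Ph[of k] k zero[OF u] by (auto simp: h_def)
      qed
      then have Ih: "(\<Sum>k\<in>I. \<Sum>w\<in>V. (P k h w)\<^sup>2) \<le> b * (\<Sum>w\<in>V. (h w)\<^sup>2)"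
        using insert Xh by auto
      have "(\<Sum>k\<in>I. \<Sum>w\<in>V. (P k f w)\<^sup>2)
          = (\<Sum>k\<in>I. (\<Sum>w\<in>V. (P k g w)\<^sup>2) + (\<Sum>w\<in>V. (P k h w)\<^sup>2))"
        using pyth[OF u X_P[OF _ f]] Pg Ph by (intro sum.cong) auto
      also have "\<dots> = (\<Sum>k\<in>I. \<Sum>w\<in>V. (P k g w)\<^sup>2) + (\<Sum>k\<in>I. \<Sum>w\<in>V. (P k h w)\<^sup>2)"
        by (simp add: sum.distrib)
      also have "\<dots> \<le> b * ((\<Sum>w\<in>V. (g w)\<^sup>2) + (\<Sum>w\<in>V. (h w)\<^sup>2))"
        using Ig Ih by (simp add: algebra_simps)
      also have "\<dots> = b * (\<Sum>w\<in>V. (f w)\<^sup>2)"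
        using pyth[OF u f] by (simp add: g_def h_def)
      finally show "(\<Sum>k\<in>I. \<Sum>w\<in>V. (P k f w)\<^sup>2) \<le> b * (\<Sum>w\<in>V. (f w)\<^sup>2)" .
    qed
  qed
  show ?thesis using main[OF fin] f by blast
qed

text \<open>The value 0 off the carrier lets idempotence and commutation hold as equalities of total
  functions, which is the form that \<open>commuting_projections_bound\<close> asks for.\<close>

definition avg :: "('a, 'b) monoid_scheme \<Rightarrow> 'a set \<Rightarrow> ('a \<Rightarrow> real) \<Rightarrow> 'a \<Rightarrow> real" where
  "avg A U f = (\<lambda>w. if w \<in> carrier A then (\<Sum>u\<in>U. f (w \<otimes>\<^bsub>A\<^esub> u)) / real (card U) else 0)"

section \<open>Averages over the cosets of a subgroup\<close>

context group begin

lemma sum_translate_subgroup: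
  assumes "subgroup U G" "u \<in> U"
  shows "(\<Sum>v\<in>U. f (u \<otimes> v)) = (\<Sum>v\<in>U. (f v :: real))"
proof (rule sum.reindex_bij_witness[where i = "\<lambda>v. inv u \<otimes> v" and j = "\<lambda>v. u \<otimes> v"])
  fix v assume v: "v \<in> U"
  have [simp]: "u \<in> carrier G" "v \<in> carrier G" using assms v by (auto simp: subgroup.mem_carrier)
  show "inv u \<otimes> (u \<otimes> v) = v" "u \<otimes> (inv u \<otimes> v) = v"
    by (simp_all flip: m_assoc)
  show "inv u \<otimes> v \<in> U" "u \<otimes> v \<in> U"
    using assms v by (auto simp: subgroup.m_closed subgroup.m_inv_closed)
qed simp

lemma sum_translate:
  assumes "u \<in> carrier G"
  shows "(\<Sum>v\<in>carrier G. f (v \<otimes> u)) = (\<Sum>v\<in>carrier G. (f v :: real))"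
  by (rule sum.reindex_bij_witness[where i = "\<lambda>v. v \<otimes> inv u" and j = "\<lambda>v. v \<otimes> u"])
    (use assms in \<open>auto simp: m_assoc\<close>)

lemma avg_translate:
  assumes U: "subgroup U G" "u \<in> U" and w: "w \<in> carrier G"
  shows "avg G U f (w \<otimes> u) = avg G U f w"
proof -
  have "u \<in> carrier G" using U by (auto simp: subgroup.mem_carrier)
  moreover have "(\<Sum>v\<in>U. f (w \<otimes> u \<otimes> v)) = (\<Sum>v\<in>U. f (w \<otimes> (u \<otimes> v)))"
    using U w by (intro sum.cong) (auto simp: m_assoc subgroup.mem_carrier)
  moreover note sum_translate_subgroup[OF U, of "\<lambda>v. f (w \<otimes> v)"]
  ultimately show ?thesis using w by (simp add: avg_def)
qed

lemma avg_eq_self: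
  assumes "subgroup U G" "finite U" and "\<And>w. w \<notin> carrier G \<Longrightarrow> f w = 0"
    and "\<And>w u. w \<in> carrier G \<Longrightarrow> u \<in> U \<Longrightarrow> f (w \<otimes> u) = f w"
  shows "avg G U f = f"
proof -
  have "card U \<noteq> 0" using assms(1,2) subgroup.one_closed[of U G] by auto
  then show ?thesis using assms by (auto simp: avg_def fun_eq_iff)
qed

lemma sum_avg:
  assumes U: "subgroup U G" "finite U"
  shows "(\<Sum>w\<in>carrier G. avg G U f w) = (\<Sum>w\<in>carrier G. f w)"
proof -
  have c: "card U \<noteq> 0" using U subgroup.one_closed[of U G] by auto
  have "(\<Sum>w\<in>carrier G. avg G U f w) = (\<Sum>w\<in>carrier G. \<Sum>u\<in>U. f (w \<otimes> u)) / card U"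
    by (simp add: avg_def sum_divide_distrib)
  also have "\<dots> = (\<Sum>u\<in>U. \<Sum>w\<in>carrier G. f (w \<otimes> u)) / card U"
    by (subst sum.swap) simp
  also have "\<dots> = (\<Sum>u\<in>U. \<Sum>w\<in>carrier G. f w) / card U"
    using U by (simp add: sum_translate subgroup.mem_carrier)
  finally show ?thesis using c by simp
qed

lemma avg_avg:
  assumes U: "subgroup U G" "finite U"
  shows "avg G U (avg G U f) = avg G U f"
  by (rule avg_eq_self) (use U avg_translate in \<open>auto simp: avg_def\<close>)

text \<open>Averaging is an orthogonal projection: \<open>avg G U f\<close> is constant on the
  cosets \<open>w U\<close>, so averaging the product \<open>f * avg G U f\<close> leaves its second
  factor alone, and \<open>f\<close> and its average have the same inner product with the
  average.\<close>

lemma avg_pythagoras: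
  assumes U: "subgroup U G" "finite U"
  shows "(\<Sum>w\<in>carrier G. (f w)\<^sup>2)
    = (\<Sum>w\<in>carrier G. (avg G U f w)\<^sup>2) + (\<Sum>w\<in>carrier G. (f w - avg G U f w)\<^sup>2)"
proof -
  let ?P = "avg G U f"
  have "(\<Sum>w\<in>carrier G. f w * ?P w) = (\<Sum>w\<in>carrier G. avg G U (\<lambda>w. f w * ?P w) w)"
    using sum_avg[OF U] by simp
  also have "\<dots> = (\<Sum>w\<in>carrier G. ?P w * ?P w)"
  proof (rule sum.cong)
    fix w assume w: "w \<in> carrier G"
    have "(\<Sum>u\<in>U. f (w \<otimes> u) * ?P (w \<otimes> u)) = (\<Sum>u\<in>U. f (w \<otimes> u)) * ?P w"
      using avg_translate[OF U(1) _ w] by (simp add: sum_distrib_right)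
    then show "avg G U (\<lambda>w. f w * ?P w) w = ?P w * ?P w"
      using w by (simp add: avg_def)
  qed simp
  finally have "(\<Sum>w\<in>carrier G. f w * ?P w) = (\<Sum>w\<in>carrier G. (?P w)\<^sup>2)"
    by (simp add: power2_eq_square)
  moreover have "(\<Sum>w\<in>carrier G. (f w - ?P w)\<^sup>2)
      = (\<Sum>w\<in>carrier G. (f w)\<^sup>2) - 2 * (\<Sum>w\<in>carrier G. f w * ?P w) + (\<Sum>w\<in>carrier G. (?P w)\<^sup>2)"
    by (simp add: power2_diff sum.distrib sum_subtractf sum_distrib_left algebra_simps)
  ultimately show ?thesis by simp
qed

end

lemma (in comm_group) avg_commute:
  assumes "subgroup U G" "subgroup W G"
  shows "avg G U (avg G W f) = avg G W (avg G U f)"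
proof (rule ext)
  fix w
  show "avg G U (avg G W f) w = avg G W (avg G U f) w"
  proof (cases "w \<in> carrier G")
    case True
    have sub: "\<And>u. u \<in> U \<Longrightarrow> u \<in> carrier G" "\<And>u. u \<in> W \<Longrightarrow> u \<in> carrier G"
      using assms by (auto simp: subgroup.mem_carrier)
    have "avg G U (avg G W f) w = (\<Sum>u\<in>U. \<Sum>v\<in>W. f (w \<otimes> u \<otimes> v)) / card W / card U"
      using True sub by (simp add: avg_def flip: sum_divide_distrib)
    also have "(\<Sum>u\<in>U. \<Sum>v\<in>W. f (w \<otimes> u \<otimes> v)) = (\<Sum>v\<in>W. \<Sum>u\<in>U. f (w \<otimes> v \<otimes> u))"
      by (subst sum.swap, intro sum.cong refl arg_cong[of _ _ f]) (use True sub in \<open>simp add: m_ac\<close>)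
    also have "\<dots> / card W / card U = avg G W (avg G U f) w"
      using True sub by (simp add: avg_def flip: sum_divide_distrib)
    finally show ?thesis .
  qed (simp add: avg_def)
qed

text \<open>In terms of characters, \<open>gen\<close> says that a nontrivial one is trivial on at
  most \<open>b\<close> of the subgroups \<open>U k\<close>. Here the same is seen on real
  functions: one fixed by more than \<open>b\<close> averages is invariant under a generating set,
  hence constant, hence zero by its mean.\<close>

lemma (in comm_group) sum_avg_squares_le:
  fixes b :: nat
  assumes fin: "finite (carrier G)" "finite I"
    and U: "\<And>k. k \<in> I \<Longrightarrow> subgroup (U k) G"
    and gen: "\<And>J. J \<subseteq> I \<Longrightarrow> b < card J \<Longrightarrow> carrier G \<subseteq> generate G (\<Union>k\<in>J. U k)"
    and supp: "\<And>w. w \<notin> carrier G \<Longrightarrow> f w = 0" and mean: "(\<Sum>w\<in>carrier G. f w) = 0"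
  shows "(\<Sum>k\<in>I. \<Sum>w\<in>carrier G. (avg G (U k) f w)\<^sup>2) \<le> real b * (\<Sum>w\<in>carrier G. (f w)\<^sup>2)"
proof -
  have finU: "finite (U k)" if "k \<in> I" for k
    using U[OF that] fin(1) finite_subset subgroup.subset by blast
  have avg_diff: "avg G W (\<lambda>w. f w - g w) = (\<lambda>w. avg G W f w - avg G W g w)" for W f g
    by (auto simp: avg_def sum_subtractf diff_divide_distrib)
  let ?X = "\<lambda>f :: 'a \<Rightarrow> real. (\<forall>w. w \<notin> carrier G \<longrightarrow> f w = 0) \<and> (\<Sum>w\<in>carrier G. f w) = 0"
  show ?thesis
  proof (rule commuting_projections_bound[where P = "\<lambda>k. avg G (U k)" and X = ?X])
    fix f assume f: "?X f" and nz: "f \<noteq> (\<lambda>_. 0)"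
    define J where "J = {k \<in> I. avg G (U k) f = f}"
    show "real (card {k \<in> I. avg G (U k) f = f}) \<le> real b"
    proof (rule ccontr)
      assume "\<not> ?thesis"
      then have "b < card J" by (simp add: J_def)
      then have sub: "carrier G \<subseteq> generate G (\<Union>k\<in>J. U k)" by (intro gen) (auto simp: J_def)
      have Uc: "(\<Union>k\<in>J. U k) \<subseteq> carrier G" using subgroup.subset[OF U] by (auto simp: J_def)
      have inv1: "f (w \<otimes> u) = f w" if w: "w \<in> carrier G" and u: "u \<in> (\<Union>k\<in>J. U k)" for w u
      proof -
        obtain k where k: "k \<in> I" "avg G (U k) f = f" "u \<in> U k" using u by (auto simp: J_def)
        show ?thesis using avg_translate[OF U[OF k(1)] k(3) w, of f] k(2) by simp
      qed
      have inv: "f (w \<otimes> u) = f w" if "w \<in> carrier G" "u \<in> generate G (\<Union>k\<in>J. U k)" for w u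
        using that(2,1)
      proof (induction arbitrary: w)
        case (inv h)
        then have h: "h \<in> carrier G" using Uc by auto
        then show ?case using inv1[of "w \<otimes> inv h" h] inv by (simp add: m_assoc)
      next
        case (eng h1 h2)
        then have "h1 \<in> carrier G" "h2 \<in> carrier G" using generate_in_carrier[OF Uc] by auto
        then show ?case using eng by (simp flip: m_assoc)
      qed (use inv1 in auto)
      have const: "f w = f \<one>" if "w \<in> carrier G" for w
        using inv[of \<one> w] that sub by auto
      have "(\<Sum>w\<in>carrier G. f w) = (\<Sum>w\<in>carrier G. f \<one>)"
        by (rule sum.cong[OF refl const])
      then have "f \<one> = 0" using f fin by auto
      then have "f w = 0" for w using const[of w] f by (cases "w \<in> carrier G") simp_all
      then show False using nz by blast
    qed
  next
    fix k f assume k: "k \<in> I" and f: "?X f"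
    show "?X (avg G (U k) f)"
      using sum_avg[OF U[OF k] finU[OF k], of f] f by (simp add: avg_def)
    then show "?X (\<lambda>w. f w - avg G (U k) f w)"
      using f by (simp add: sum_subtractf)
    show "avg G (U k) (avg G (U k) f) = avg G (U k) f"
      using avg_avg U[OF k] finU[OF k] by blast
    show "(\<Sum>w\<in>carrier G. (f w)\<^sup>2) = (\<Sum>w\<in>carrier G. (avg G (U k) f w)\<^sup>2)
        + (\<Sum>w\<in>carrier G. (f w - avg G (U k) f w)\<^sup>2)"
      using avg_pythagoras U[OF k] finU[OF k] by blast
  next
    fix k l f assume "k \<in> I" "l \<in> I"
    then show "avg G (U k) (avg G (U l) f) = avg G (U l) (avg G (U k) f)"
      by (intro avg_commute U)
  next
    fix k show "avg G (U k) (\<lambda>_. 0) = (\<lambda>_. 0)" by (auto simp: avg_def)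
  next
    show "finite I" by (rule fin)
    show "?X f" using supp mean by blast
  qed (rule avg_diff)
qed

section \<open>The second singular value\<close>

text \<open>A change of basis to the constant vector and \<open>e\<^sub>1, \<dots>, e\<^sub>k\<close> splits off the eigenvalue \<open>1\<close>.\<close>

lemma char_poly_deflate:
  fixes T :: "real mat"
  assumes T: "T \<in> carrier_mat (Suc k) (Suc k)"
    and rows: "\<And>i. i < Suc k \<Longrightarrow> (\<Sum>j<Suc k. T $$ (i, j)) = 1"
  shows "char_poly T = [:-1, 1:] * char_poly (mat k k (\<lambda>(i, j). T $$ (Suc i, Suc j) - T $$ (0, Suc j)))"
proof -
  \<comment> \<open>\<open>D\<close> is the matrix that \<open>T\<close> induces on the quotient by
    the constant vectors, in the basis of the classes of the unit vectors other than the
    first.\<close>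
  define D where "D = mat k k (\<lambda>(i, j). T $$ (Suc i, Suc j) - T $$ (0, Suc j))"
  define U where "U = mat 1 k (\<lambda>(i, j). T $$ (0, Suc j))"
  define B where "B = four_block_mat (1\<^sub>m 1) U (0\<^sub>m k 1) D"
  define P :: "real mat" where "P = mat (Suc k) (Suc k) (\<lambda>(i, j). if i = j \<or> j = 0 then 1 else 0)"
  define Q :: "real mat" where "Q = mat (Suc k) (Suc k) (\<lambda>(i, j). if i = j then 1 else if j = 0 then - 1 else 0)"
  have D: "D \<in> carrier_mat k k" and U: "U \<in> carrier_mat 1 k" and P: "P \<in> carrier_mat (Suc k) (Suc k)"
    and Q: "Q \<in> carrier_mat (Suc k) (Suc k)"
    by (simp_all add: D_def U_def P_def Q_def)
  have B: "B \<in> carrier_mat (Suc k) (Suc k)"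
    unfolding B_def using D U by auto
  have Pmul: "(P * C) $$ (i, j) = C $$ (i, j) + (if i = 0 then 0 else C $$ (0, j))"
    if C: "C \<in> carrier_mat (Suc k) (Suc k)" and i: "i < Suc k" and j: "j < Suc k" for C i j
  proof -
    have "(P * C) $$ (i, j) = (\<Sum>l<Suc k. (if i = l \<or> l = 0 then C $$ (l, j) else 0))"
      using C i j P by (auto simp: scalar_prod_def P_def atLeast0LessThan simp del: sum.lessThan_Suc intro!: sum.cong)
    also have "\<dots> = C $$ (0, j) + (\<Sum>l<k. (if i = Suc l then C $$ (Suc l, j) else 0))"
      by (simp add: sum.lessThan_Suc_shift del: sum.lessThan_Suc)
    also have "\<dots> = C $$ (i, j) + (if i = 0 then 0 else C $$ (0, j))"
      using i by (cases i) (auto simp: sum.delta)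
    finally show ?thesis .
  qed
  have PQ: "P * Q = 1\<^sub>m (Suc k)"
    by (rule eq_matI) (use P Q Pmul[OF Q] in \<open>auto simp: Q_def simp del: index_mult_mat(1)\<close>)
  have QP: "Q * P = 1\<^sub>m (Suc k)"
    using mat_mult_left_right_inverse[OF P Q PQ] .
  have "T * P = P * B"
  proof (rule eq_matI)
    fix i j assume "i < dim_row (P * B)" "j < dim_col (P * B)"
    then have i: "i < Suc k" and j: "j < Suc k" using P B by auto
    have "(T * P) $$ (i, j) = (\<Sum>l<Suc k. if l = j \<or> j = 0 then T $$ (i, l) else 0)"
      using T i j P by (auto simp: scalar_prod_def P_def atLeast0LessThan simp del: sum.lessThan_Suc intro!: sum.cong)
    also have "\<dots> = (if j = 0 then 1 else T $$ (i, j))"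
      using rows[OF i] j by (auto simp: sum.delta')
    also have "\<dots> = (P * B) $$ (i, j)"
      unfolding Pmul[OF B i j] using i j D U by (auto simp: B_def D_def U_def)
    finally show "(T * P) $$ (i, j) = (P * B) $$ (i, j)" .
  qed (use T P B in auto)
  then have "P * B * Q = T"
    using assoc_mult_mat[OF T P Q] PQ T by simp
  then have "similar_mat T B"
    unfolding similar_mat_def using similar_mat_witI[OF PQ QP _ T B P Q] by metis
  then have "char_poly T = char_poly B" by (rule char_poly_similar)
  also have "\<dots> = char_poly (1\<^sub>m 1) * char_poly D"
    unfolding B_def by (rule char_poly_four_block_zeros_col) (use D U in auto)
  also have "char_poly (1\<^sub>m 1 :: real mat) = [:-1, 1:]"
    by (subst char_poly_upper_triangular[where n = 1]) (auto simp: diag_mat_def)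
  finally show ?thesis by (simp add: D_def)
qed

text \<open>The Hermitian form \<open>s\<close> of an eigenvector is its own conjugate and equals
  \<open>z\<close> times the squared norm. This is used to find a real root of the deflated
  polynomial, since \<open>proots\<close> collects real roots only.\<close>

lemma symmetric_real_eigenvalue:
  fixes T :: "real mat"
  assumes T: "T \<in> carrier_mat n n" and sym: "\<And>i j. i < n \<Longrightarrow> j < n \<Longrightarrow> T $$ (i, j) = T $$ (j, i)"
    and root: "poly (map_poly complex_of_real (char_poly T)) z = 0"
  shows "z \<in> \<real>"
proof -
  let ?A = "map_mat complex_of_real T"
  have A: "?A \<in> carrier_mat n n" using T by simp
  have "eigenvalue ?A z"
    using root T A by (simp add: eigenvalue_root_char_poly of_real_hom.char_poly_hom)
  then obtain v where v: "v \<in> carrier_vec n" "v \<noteq> 0\<^sub>v n" and ev: "?A *\<^sub>v v = z \<cdot>\<^sub>v v"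
    using T by (auto simp: eigenvalue_def eigenvector_def)
  define s where "s = (\<Sum>i<n. \<Sum>j<n. cnj (v $ i) * of_real (T $$ (i, j)) * v $ j)"
  have row: "(\<Sum>j<n. of_real (T $$ (i, j)) * v $ j) = z * v $ i" if "i < n" for i
  proof -
    have "(\<Sum>j<n. of_real (T $$ (i, j)) * v $ j) = (?A *\<^sub>v v) $ i"
      using that T v by (simp add: scalar_prod_def atLeast0LessThan)
    then show ?thesis using that v by (simp add: ev)
  qed
  have "s = (\<Sum>i<n. cnj (v $ i) * (z * v $ i))"
    unfolding s_def by (intro sum.cong refl) (simp add: mult.assoc row flip: sum_distrib_left)
  also have "\<dots> = z * of_real (\<Sum>i<n. (cmod (v $ i))\<^sup>2)"
    by (simp only: of_real_sum sum_distrib_left)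
      (intro sum.cong refl, simp add: complex_norm_square mult_ac del: of_real_power)
  finally have s: "s = z * of_real (\<Sum>i<n. (cmod (v $ i))\<^sup>2)" .
  have "cnj s = (\<Sum>i<n. \<Sum>j<n. v $ i * of_real (T $$ (i, j)) * cnj (v $ j))"
    by (simp add: s_def)
  also have "\<dots> = (\<Sum>i<n. \<Sum>j<n. v $ j * of_real (T $$ (j, i)) * cnj (v $ i))"
    by (rule sum.swap)
  also have "\<dots> = s"
    unfolding s_def by (intro sum.cong refl) (use sym in \<open>simp add: mult_ac\<close>)
  finally have "s \<in> \<real>" by (simp add: Reals_cnj_iff)
  moreover have "(\<Sum>i<n. (cmod (v $ i))\<^sup>2) \<noteq> 0"
  proof
    assume "(\<Sum>i<n. (cmod (v $ i))\<^sup>2) = 0"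
    then have "\<forall>i<n. v $ i = 0" by (simp add: sum_nonneg_eq_0_iff)
    then show False using v by (auto simp: vec_eq_iff)
  qed
  ultimately show ?thesis unfolding s
    by (metis Reals_divide Reals_of_real nonzero_mult_div_cancel_right of_real_eq_0_iff)
qed

text \<open>Besides one copy of 1, the eigenvalues of \<open>T\<close> are those of the matrix
  \<open>D\<close> on the quotient by constants. An eigenvector of \<open>D\<close> lifts to a
  vector \<open>x\<close> of mean zero with \<open>T x\<close> equal to \<open>\<mu> x\<close> plus
  a constant. Pairing with \<open>x\<close> removes the constant, so \<open>\<mu>\<close> is a
  Rayleigh quotient, which \<open>le\<close> bounds by \<open>e\<close>.\<close>

lemma second_singular_value_le:
  fixes M :: "real mat" and e :: real
  assumes M: "M \<in> carrier_mat l (Suc k)" and k: "1 \<le> k" and l: "2 \<le> l" and e: "0 \<le> e" "e < 1"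
    and rows: "\<And>i. i < Suc k \<Longrightarrow> (\<Sum>j<Suc k. (transpose_mat M * M) $$ (i, j)) = 1"
    and le: "\<And>x :: nat \<Rightarrow> real. (\<Sum>j<Suc k. x j) = 0 \<Longrightarrow>
      (\<Sum>i<l. (\<Sum>j<Suc k. M $$ (i, j) * x j)\<^sup>2) \<le> e * (\<Sum>j<Suc k. (x j)\<^sup>2)"
  shows "0 \<le> second_singular_value M \<and> second_singular_value M \<le> sqrt e"
proof -
  define T where "T = transpose_mat M * M"
  define D where "D = mat k k (\<lambda>(i, j). T $$ (Suc i, Suc j) - T $$ (0, Suc j))"
  have T: "T \<in> carrier_mat (Suc k) (Suc k)" using M by (simp add: T_def)
  have D: "D \<in> carrier_mat k k" by (simp add: D_def)
  have Tij: "T $$ (i, j) = (\<Sum>a<l. M $$ (a, i) * M $$ (a, j))" if "i < Suc k" "j < Suc k" for i j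
    using M that by (simp add: T_def scalar_prod_def atLeast0LessThan)
  have sym: "T $$ (i, j) = T $$ (j, i)" if "i < Suc k" "j < Suc k" for i j
    using that by (simp add: Tij mult.commute)
  have cp: "char_poly T = [:-1, 1:] * char_poly D"
    unfolding D_def by (rule char_poly_deflate[OF T]) (use rows in \<open>simp add: T_def\<close>)
  have quad: "(\<Sum>i<Suc k. x i * (\<Sum>j<Suc k. T $$ (i, j) * x j)) = (\<Sum>a<l. (\<Sum>j<Suc k. M $$ (a, j) * x j)\<^sup>2)"
    for x :: "nat \<Rightarrow> real"
  proof -
    have "(\<Sum>i<Suc k. x i * (\<Sum>j<Suc k. T $$ (i, j) * x j))
        = (\<Sum>i<Suc k. \<Sum>j<Suc k. \<Sum>a<l. (M $$ (a, i) * x i) * (M $$ (a, j) * x j))"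
      unfolding sum_distrib_left sum_distrib_right
      by (intro sum.cong refl) (simp add: Tij sum_distrib_left sum_distrib_right mult_ac del: sum.lessThan_Suc)
    also have "\<dots> = (\<Sum>i<Suc k. \<Sum>a<l. \<Sum>j<Suc k. (M $$ (a, i) * x i) * (M $$ (a, j) * x j))"
      by (intro sum.cong refl sum.swap)
    also have "\<dots> = (\<Sum>a<l. \<Sum>i<Suc k. \<Sum>j<Suc k. (M $$ (a, i) * x i) * (M $$ (a, j) * x j))"
      by (rule sum.swap)
    also have "\<dots> = (\<Sum>a<l. (\<Sum>j<Suc k. M $$ (a, j) * x j)\<^sup>2)"
      by (simp only: power2_eq_square sum_product)
    finally show ?thesis .
  qed
  have root: "0 \<le> \<mu> \<and> \<mu> \<le> e" if "poly (char_poly D) \<mu> = 0" for \<mu>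
  proof -
    have "eigenvalue D \<mu>" using that D by (simp add: eigenvalue_root_char_poly)
    then obtain y where y: "y \<in> carrier_vec k" "y \<noteq> 0\<^sub>v k" and ev: "D *\<^sub>v y = \<mu> \<cdot>\<^sub>v y"
      using D by (auto simp: eigenvalue_def eigenvector_def)
    \<comment> \<open>\<open>v\<close> is the representative of the class \<open>y\<close> with
      first entry 0, and \<open>x\<close> the representative of mean zero.\<close>
    define v where "v = (\<lambda>j. case j of 0 \<Rightarrow> 0 | Suc i \<Rightarrow> y $ i)"
    define s where "s = (\<Sum>j<Suc k. v j) / Suc k"
    define x where "x = (\<lambda>j. v j - s)"
    define c where "c = (\<Sum>j<Suc k. T $$ (0, j) * v j)"
    have Tv: "(\<Sum>j<Suc k. T $$ (i, j) * v j) = \<mu> * v i + c" if i: "i < Suc k" for i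
    proof (cases i)
      case 0
      then show ?thesis by (simp add: v_def c_def)
    next
      case (Suc i')
      then have i': "i' < k" using i by simp
      have "(\<Sum>j<Suc k. T $$ (i, j) * v j) - c = (\<Sum>j<k. (T $$ (i, Suc j) - T $$ (0, Suc j)) * y $ j)"
        by (simp add: c_def sum.lessThan_Suc_shift v_def sum_subtractf left_diff_distrib del: sum.lessThan_Suc)
      also have "\<dots> = (D *\<^sub>v y) $ i'"
        using i' y D by (simp add: scalar_prod_def atLeast0LessThan D_def Suc)
      also have "\<dots> = \<mu> * v i" using i' y by (simp add: ev v_def Suc)
      finally show ?thesis by simp
    qed
    have mean: "(\<Sum>j<Suc k. x j) = 0"
      by (simp add: x_def s_def sum_subtractf del: sum.lessThan_Suc)
    have Tx: "(\<Sum>j<Suc k. T $$ (i, j) * x j) = \<mu> * x i + (c + \<mu> * s - s)" if i: "i < Suc k" for i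
    proof -
      have "(\<Sum>j<Suc k. T $$ (i, j) * x j) = (\<Sum>j<Suc k. T $$ (i, j) * v j) - (\<Sum>j<Suc k. T $$ (i, j)) * s"
        by (simp add: x_def right_diff_distrib sum_subtractf sum_distrib_right del: sum.lessThan_Suc)
      also have "(\<Sum>j<Suc k. T $$ (i, j)) = 1" using rows[OF i] by (simp add: T_def)
      finally show ?thesis using Tv[OF i] by (simp add: x_def algebra_simps)
    qed
    have "(\<Sum>i<Suc k. x i * (\<Sum>j<Suc k. T $$ (i, j) * x j))
        = (\<Sum>i<Suc k. \<mu> * (x i)\<^sup>2 + x i * (c + \<mu> * s - s))"
      by (intro sum.cong refl) (simp add: Tx power2_eq_square distrib_left del: sum.lessThan_Suc)
    also have "\<dots> = \<mu> * (\<Sum>i<Suc k. (x i)\<^sup>2) + (\<Sum>i<Suc k. x i) * (c + \<mu> * s - s)"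
      by (simp only: sum.distrib sum_distrib_left sum_distrib_right)
    finally have mu: "\<mu> * (\<Sum>i<Suc k. (x i)\<^sup>2) = (\<Sum>a<l. (\<Sum>j<Suc k. M $$ (a, j) * x j)\<^sup>2)"
      using quad[of x] mean by simp
    have pos: "0 < (\<Sum>i<Suc k. (x i)\<^sup>2)"
    proof -
      have "\<exists>i<Suc k. x i \<noteq> 0"
      proof (rule ccontr)
        assume "\<not> ?thesis"
        then have all: "\<And>i. i < Suc k \<Longrightarrow> v i = s" by (auto simp: x_def)
        have "s = 0" using all[of 0] by (simp add: v_def)
        then have "y $ i = 0" if "i < k" for i using all[of "Suc i"] that by (simp add: v_def)
        then show False using y by (auto simp: vec_eq_iff)
      qed
      then show ?thesis by (meson finite_lessThan lessThan_iff sum_pos2 zero_le_power2 zero_less_power2)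
    qed
    have "0 \<le> \<mu> * (\<Sum>i<Suc k. (x i)\<^sup>2)" unfolding mu by (intro sum_nonneg) auto
    moreover have "\<mu> * (\<Sum>i<Suc k. (x i)\<^sup>2) \<le> e * (\<Sum>i<Suc k. (x i)\<^sup>2)"
      unfolding mu by (rule le[OF mean])
    ultimately show ?thesis using pos by (simp add: zero_le_mult_iff del: sum.lessThan_Suc)
  qed
  have nz: "char_poly D \<noteq> 0" and deg: "degree (char_poly D) = k"
    using degree_monic_char_poly[OF D] by auto
  \<comment> \<open>This supplies the entry at position 1 of the list of singular values. A complex
    root of \<open>char_poly D\<close> exists as \<open>k\<close> is positive; it is also a root of
    \<open>char_poly T\<close>, hence real.\<close>
  have "\<exists>\<mu>. poly (char_poly D) \<mu> = 0"
  proof -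
    interpret h: map_poly_comm_ring_hom complex_of_real ..
    let ?q = "map_poly complex_of_real (char_poly D)"
    have "degree ?q = k" using deg by simp
    then have "\<not> constant (poly ?q)" using k by (simp add: constant_degree)
    then obtain z where z: "poly ?q z = 0" using fundamental_theorem_of_algebra by blast
    have "poly (map_poly complex_of_real (char_poly T)) z = 0"
      unfolding cp by (simp only: h.hom_mult poly_mult z mult_zero_right)
    then have "z \<in> \<real>" using symmetric_real_eigenvalue[OF T sym] by blast
    then obtain \<mu> where "z = of_real \<mu>" by (auto elim: Reals_cases)
    then show ?thesis using z by (auto simp: of_real_hom.poly_map_poly)
  qed
  then obtain \<mu>0 where mu0: "poly (char_poly D) \<mu>0 = 0" by blast
  define N where "N = image_mset sqrt (proots (char_poly D))"
  have Nmem: "0 \<le> s \<and> s \<le> sqrt e" if "s \<in># N" for s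
    using that root nz by (auto simp: N_def)
  have "\<mu>0 \<in># proots (char_poly D)" using mu0 nz by simp
  then have N0: "N \<noteq> {#}" by (auto simp: N_def)
  have "proots (char_poly T) = add_mset 1 (proots (char_poly D))"
    unfolding cp using nz by (subst proots_mult) auto
  then have eq: "image_mset sqrt (proots (char_poly (transpose_mat M * M))) = add_mset 1 N"
    by (simp add: N_def T_def)
  \<comment> \<open>As \<open>sqrt e < 1\<close>, the value 1 is strictly the largest and takes
    position 0 after reversal; position 1 is then held by the largest element of
    \<open>N\<close>.\<close>
  have "sorted_list_of_multiset (add_mset 1 N) = sorted_list_of_multiset N @ [1]"
  proof -
    have "sqrt e < 1" using e by simp
    then have "\<forall>s\<in>set (sorted_list_of_multiset N). s < 1"
      using Nmem by (auto intro: le_less_trans[of _ "sqrt e"])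
    then have "insort 1 (sorted_list_of_multiset N) = sorted_list_of_multiset N @ [1]"
      by (intro sorted_insort_is_snoc) (auto intro: less_imp_le)
    then show ?thesis by simp
  qed
  then have "singular_values M = take (min l (Suc k)) (1 # rev (sorted_list_of_multiset N))"
    using M by (simp add: singular_values_def eq)
  moreover have "1 < min l (Suc k)" using k l by simp
  moreover have ne: "rev (sorted_list_of_multiset N) \<noteq> []" using N0
    by (metis mset.simps(1) mset_sorted_list_of_multiset rev_is_Nil_conv)
  ultimately have "second_singular_value M = rev (sorted_list_of_multiset N) ! 0"
    by (simp add: second_singular_value_def)
  also have "\<dots> \<in> set (rev (sorted_list_of_multiset N))" using ne by (meson length_greater_0_conv nth_mem)
  finally show ?thesis using Nmem by simp
qed

section \<open>Polynomials over a finite field\<close>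

locale finite_field = field F for F :: "('a, 'b) ring_scheme" (structure) +
  assumes finite_carrier: "finite (carrier F)"
begin

sublocale U: UP_domain F "UP F" by unfold_locales

abbreviation cf :: "(nat \<Rightarrow> 'a) \<Rightarrow> nat \<Rightarrow> 'a" where
  "cf \<equiv> up_ring.coeff (UP F)"

abbreviation ev :: "(nat \<Rightarrow> 'a) \<Rightarrow> 'a \<Rightarrow> 'a" where
  "ev f x \<equiv> UnivPoly.eval F F id x f"

text \<open>Degree below \<open>k\<close>, stated by coefficients so that the zero polynomial
  belongs to every \<open>polys k\<close> although \<open>deg\<close> gives it degree 0. In
  particular \<open>polys 0\<close> contains zero alone, which starts the inductions on
  expansions.\<close>

definition polys :: "nat \<Rightarrow> (nat \<Rightarrow> 'a) set" where
  "polys k = {f \<in> carrier (UP F). \<forall>i\<ge>k. cf f i = \<zero>}"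

lemma polysD: "f \<in> polys k \<Longrightarrow> f \<in> carrier (UP F)"
  by (simp add: polys_def)

lemma polys_coeff: "f \<in> polys k \<Longrightarrow> k \<le> i \<Longrightarrow> cf f i = \<zero>"
  by (simp add: polys_def)

lemma polys_mono: "k \<le> l \<Longrightarrow> polys k \<subseteq> polys l"
  by (auto simp: polys_def)

lemma polys_iff_deg:
  assumes f: "f \<in> carrier (UP F)"
  shows "f \<in> polys k \<longleftrightarrow> f = \<zero>\<^bsub>UP F\<^esub> \<or> deg F f < k"
proof
  assume fk: "f \<in> polys k"
  show "f = \<zero>\<^bsub>UP F\<^esub> \<or> deg F f < k"
    using U.lcoeff_nonzero2[OF f] polys_coeff[OF fk, of "deg F f"] by force
qed (use f in \<open>auto simp: polys_def intro: U.deg_aboveD\<close>)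

lemma up_deg_less_iff:
  assumes "f \<in> carrier (UP F)"
  shows "up_deg F f < ereal t \<longleftrightarrow> f \<in> polys (nat \<lceil>t\<rceil>)"
proof -
  have "real d < t \<longleftrightarrow> d < nat \<lceil>t\<rceil>" for d by linarith
  then show ?thesis using assms by (auto simp: up_deg_def polys_iff_deg)
qed

lemma polys_zero [simp]: "\<zero>\<^bsub>UP F\<^esub> \<in> polys k"
  by (simp add: polys_def)

lemma polys_add [intro]: "f \<in> polys k \<Longrightarrow> g \<in> polys k \<Longrightarrow> f \<oplus>\<^bsub>UP F\<^esub> g \<in> polys k"
  by (simp add: polys_def)

lemma polys_diff [intro]: "f \<in> polys k \<Longrightarrow> g \<in> polys k \<Longrightarrow> f \<ominus>\<^bsub>UP F\<^esub> g \<in> polys k"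
  by (simp add: polys_def)

lemma polys_smult [intro]: "a \<in> carrier F \<Longrightarrow> f \<in> polys k \<Longrightarrow> a \<odot>\<^bsub>UP F\<^esub> f \<in> polys k"
  by (simp add: polys_def)

lemma polys_finsum: "finite I \<Longrightarrow> (\<And>i. i \<in> I \<Longrightarrow> f i \<in> polys k) \<Longrightarrow> (\<Oplus>\<^bsub>UP F\<^esub>i\<in>I. f i) \<in> polys k"
proof (induction I rule: finite_induct)
  case (insert x I)
  then have "f \<in> I \<rightarrow> carrier (UP F)" "f x \<in> carrier (UP F)" by (auto intro: polysD)
  then show ?case using insert by (simp add: polys_add)
qed simp

lemma polys_mult:
  assumes "f \<in> polys (Suc a)" "g \<in> polys (Suc b)"
  shows "f \<otimes>\<^bsub>UP F\<^esub> g \<in> polys (Suc (a + b))"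
proof (cases "f = \<zero>\<^bsub>UP F\<^esub> \<or> g = \<zero>\<^bsub>UP F\<^esub>")
  case True
  then show ?thesis using assms by (auto simp: polysD)
next
  case False
  have c: "f \<in> carrier (UP F)" "g \<in> carrier (UP F)" using assms by (auto simp: polysD)
  have "deg F f < Suc a" "deg F g < Suc b" using assms False c by (auto simp: polys_iff_deg)
  then show ?thesis using False c by (simp add: polys_iff_deg)
qed

lemma polys_monom: "a \<in> carrier F \<Longrightarrow> d < k \<Longrightarrow> up_ring.monom (UP F) a d \<in> polys k"
  by (simp add: polys_def)

lemma polys_eqI: "f \<in> polys k \<Longrightarrow> g \<in> polys k \<Longrightarrow> (\<And>i. i < k \<Longrightarrow> cf f i = cf g i) \<Longrightarrow> f = g"
  by (rule U.up_eqI) (metis polys_coeff not_le, auto dest: polysD)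

lemma ex_poly:
  assumes "\<And>i. i < k \<Longrightarrow> a i \<in> carrier F"
  shows "\<exists>f\<in>polys k. \<forall>i<k. cf f i = a i"
proof -
  let ?f = "\<lambda>i. if i < k then a i else \<zero>"
  have up: "?f \<in> up F"
    by (rule mem_upI) (use assms in \<open>auto intro!: exI[of _ k] simp: bound_def\<close>)
  then have "cf ?f i = ?f i" for i by (simp add: UP_def)
  then have "?f \<in> polys k" "\<forall>i<k. cf ?f i = a i" using up by (auto simp: polys_def UP_def)
  then show ?thesis by blast
qed

lemma ev_closed [simp]: "f \<in> carrier (UP F) \<Longrightarrow> x \<in> carrier F \<Longrightarrow> ev f x \<in> carrier F"
  by (rule U.carrier_evalRR)

lemma ev_hom: "x \<in> carrier F \<Longrightarrow> (\<lambda>f. ev f x) \<in> Ring.ring_hom (UP F) F"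
  by (rule ring_hom_memI) (simp_all add: U.evalRR_simps)

lemma ev_finsum:
  assumes "finite I" "\<And>i. i \<in> I \<Longrightarrow> f i \<in> carrier (UP F)" "x \<in> carrier F"
  shows "ev (\<Oplus>\<^bsub>UP F\<^esub>i\<in>I. f i) x = (\<Oplus>i\<in>I. ev (f i) x)"
proof -
  interpret h: ring_hom_cring "UP F" F "\<lambda>f. ev f x"
    by unfold_locales (rule ev_hom[OF assms(3)])
  show ?thesis using assms h.hom_finsum[of f I] by (auto simp: comp_def)
qed

lemma ev_pow:
  assumes "f \<in> carrier (UP F)" "x \<in> carrier F"
  shows "ev (f [^]\<^bsub>UP F\<^esub> (n :: nat)) x = ev f x [^] n"
proof -
  interpret h: ring_hom_cring "UP F" F "\<lambda>f. ev f x"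
    by unfold_locales (rule ev_hom[OF assms(2)])
  show ?thesis using assms by (auto intro: h.hom_pow)
qed

lemma ev_zero: "x \<in> carrier F \<Longrightarrow> ev \<zero>\<^bsub>UP F\<^esub> x = \<zero>"
  using ev_finsum[of "{}" _ x] by simp

lemma ev_smult:
  assumes "a \<in> carrier F" "f \<in> carrier (UP F)" "x \<in> carrier F"
  shows "ev (a \<odot>\<^bsub>UP F\<^esub> f) x = a \<otimes> ev f x"
proof -
  have "ev (up_ring.monom (UP F) a 0 \<otimes>\<^bsub>UP F\<^esub> f) x = a \<otimes> ev f x"
    using assms by (simp add: U.evalRR_simps del: U.monom_mult_is_smult)
  then show ?thesis using assms by (simp add: U.monom_mult_is_smult)
qed

lemma ev_eq_sum:
  assumes f: "f \<in> polys k" and x: "x \<in> carrier F"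
  shows "ev f x = (\<Oplus>i\<in>{..<k}. cf f i \<otimes> x [^] i)"
proof -
  have c: "f \<in> carrier (UP F)" using f by (rule polysD)
  have "ev f x = (\<Oplus>i\<in>{..deg F f}. cf f i \<otimes> x [^] i)"
    using c by (simp add: UnivPoly.eval_def)
  also have "\<dots> = (\<Oplus>i\<in>{..<k}. cf f i \<otimes> x [^] i)"
    by (rule add.finprod_mono_neutral_cong)
      (use c x f in \<open>auto simp: U.deg_aboveD polys_coeff not_less not_le\<close>)
  finally show ?thesis .
qed

lemma polys_eq_zero:
  assumes f: "f \<in> polys k" and S: "S \<subseteq> carrier F" "k \<le> card S" and "\<And>x. x \<in> S \<Longrightarrow> ev f x = \<zero>"
  shows "f = \<zero>\<^bsub>UP F\<^esub>"
proof (rule ccontr)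
  assume nz: "f \<noteq> \<zero>\<^bsub>UP F\<^esub>"
  have c: "f \<in> carrier (UP F)" using f by (rule polysD)
  have "card S \<le> card {a \<in> carrier F. ev f a = \<zero>}"
    using assms finite_carrier by (intro card_mono) auto
  also have "\<dots> \<le> deg F f" using U.roots_bound[OF c nz finite_carrier] by simp
  also have "\<dots> < k" using nz f c by (simp add: polys_iff_deg)
  finally show False using S by simp
qed

lemma polys_eq:
  assumes f: "f \<in> polys k" "g \<in> polys k" and S: "S \<subseteq> carrier F" "k \<le> card S"
    and eq: "\<And>x. x \<in> S \<Longrightarrow> ev f x = ev g x"
  shows "f = g"
proof -
  have c: "f \<in> carrier (UP F)" "g \<in> carrier (UP F)" using f by (auto simp: polysD)
  have "f \<ominus>\<^bsub>UP F\<^esub> g = \<zero>\<^bsub>UP F\<^esub>"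
    by (rule polys_eq_zero[OF _ S]) (use f c S eq in \<open>auto simp: U.evalRR_sub\<close>)
  then show ?thesis using c by simp
qed

lemma bij_polys_coeffs: "bij_betw (\<lambda>f. restrict (cf f) {..<k}) (polys k) ({..<k} \<rightarrow>\<^sub>E carrier F)"
proof (rule bij_betw_imageI)
  show "inj_on (\<lambda>f. restrict (cf f) {..<k}) (polys k)"
  proof (rule inj_onI)
    fix f g assume fg: "f \<in> polys k" "g \<in> polys k" and e: "restrict (cf f) {..<k} = restrict (cf g) {..<k}"
    show "f = g" by (rule polys_eqI[OF fg]) (use fun_cong[OF e] in \<open>metis lessThan_iff restrict_apply'\<close>)
  qed
  show "(\<lambda>f. restrict (cf f) {..<k}) ` polys k = {..<k} \<rightarrow>\<^sub>E carrier F"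
  proof (intro equalityI subsetI)
    fix a assume a: "a \<in> {..<k} \<rightarrow>\<^sub>E carrier F"
    then obtain f where "f \<in> polys k" "\<forall>i<k. cf f i = a i" using ex_poly[of k a] by (auto simp: PiE_iff)
    then show "a \<in> (\<lambda>f. restrict (cf f) {..<k}) ` polys k"
      using a by (intro image_eqI[of _ _ f]) (auto simp: fun_eq_iff PiE_iff extensional_def)
  qed (auto dest: polysD split: if_splits)
qed

lemma card_polys: "card (polys k) = card (carrier F) ^ k"
  using bij_betw_same_card[OF bij_polys_coeffs] by (simp add: card_PiE)

lemma finite_polys: "finite (polys k)"
  using bij_betw_finite[OF bij_polys_coeffs] finite_carrier by (simp add: finite_PiE)

lemma eval_word_inj:
  assumes "S \<subseteq> carrier F" "k \<le> card S"
  shows "inj_on (eval_word F S) (polys k)"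
proof (rule inj_onI)
  fix f g assume fg: "f \<in> polys k" "g \<in> polys k" and e: "eval_word F S f = eval_word F S g"
  show "f = g"
    by (rule polys_eq[OF fg assms]) (use fun_cong[OF e] in \<open>metis eval_word_def restrict_apply'\<close>)
qed

lemma eval_word_in: "S \<subseteq> carrier F \<Longrightarrow> f \<in> carrier (UP F) \<Longrightarrow> eval_word F S f \<in> S \<rightarrow>\<^sub>E carrier F"
  by (auto simp: eval_word_def)

text \<open>Counting replaces Lagrange's formula: evaluation is injective on degrees below
  \<open>card S\<close>, and both sides have \<open>card (carrier F) ^ card S\<close>
  elements.\<close>

lemma interpolation:
  assumes S: "S \<subseteq> carrier F"
  shows "eval_word F S ` polys (card S) = S \<rightarrow>\<^sub>E carrier F"
proof (rule card_subset_eq)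
  have fS: "finite S" using S finite_carrier finite_subset by blast
  then show "finite (S \<rightarrow>\<^sub>E carrier F)" using finite_carrier by (simp add: finite_PiE)
  show "eval_word F S ` polys (card S) \<subseteq> S \<rightarrow>\<^sub>E carrier F"
    using eval_word_in[OF S] polysD by blast
  show "card (eval_word F S ` polys (card S)) = card (S \<rightarrow>\<^sub>E carrier F)"
    using eval_word_inj[OF S] fS by (simp add: card_image card_polys card_PiE)
qed

lemma RS_code_eq: "RS_code F S t = eval_word F S ` polys (nat \<lceil>t\<rceil>)"
  unfolding RS_code_def using up_deg_less_iff polysD by (intro arg_cong[of _ _ "image _"]) blast

text \<open>A fixed number \<open>N\<close> of terms, in contrast to the sum over the support in
  \<open>is_base_expansion\<close>. It allows the recursion of \<open>expand_Suc\<close>, which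
  splits off the term of index 0 as in Horner's rule.\<close>

definition expand :: "(nat \<Rightarrow> 'a) \<Rightarrow> (nat \<Rightarrow> nat \<Rightarrow> 'a) \<Rightarrow> nat \<Rightarrow> nat \<Rightarrow> 'a" where
  "expand u c N = (\<Oplus>\<^bsub>UP F\<^esub>i\<in>{..<N}. c i \<otimes>\<^bsub>UP F\<^esub> u [^]\<^bsub>UP F\<^esub> i)"

lemma expand_Suc:
  assumes u: "u \<in> carrier (UP F)" and c: "\<And>i. c i \<in> carrier (UP F)"
  shows "expand u c (Suc N) = u \<otimes>\<^bsub>UP F\<^esub> expand u (\<lambda>i. c (Suc i)) N \<oplus>\<^bsub>UP F\<^esub> c 0"
proof -
  let ?t = "\<lambda>i. c i \<otimes>\<^bsub>UP F\<^esub> u [^]\<^bsub>UP F\<^esub> i"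
  have t: "?t i \<in> carrier (UP F)" for i using u c by simp
  show ?thesis
  proof (cases N)
    case 0
    then show ?thesis using u c by (simp add: expand_def lessThan_Suc)
  next
    case (Suc M)
    have "expand u c (Suc N) = (\<Oplus>\<^bsub>UP F\<^esub>i\<in>{..Suc M}. ?t i)"
      by (simp add: expand_def Suc lessThan_Suc_atMost)
    also have "\<dots> = (\<Oplus>\<^bsub>UP F\<^esub>i\<in>{..M}. ?t (Suc i)) \<oplus>\<^bsub>UP F\<^esub> ?t 0"
      by (rule U.P.add.finprod_Suc2) (use t in auto)
    also have "(\<Oplus>\<^bsub>UP F\<^esub>i\<in>{..M}. ?t (Suc i))
        = (\<Oplus>\<^bsub>UP F\<^esub>i\<in>{..M}. u \<otimes>\<^bsub>UP F\<^esub> (c (Suc i) \<otimes>\<^bsub>UP F\<^esub> u [^]\<^bsub>UP F\<^esub> i))"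
      by (intro U.P.add.finprod_cong') (use u c in \<open>auto simp: U.P.m_ac\<close>)
    also have "\<dots> = u \<otimes>\<^bsub>UP F\<^esub> (\<Oplus>\<^bsub>UP F\<^esub>i\<in>{..M}. c (Suc i) \<otimes>\<^bsub>UP F\<^esub> u [^]\<^bsub>UP F\<^esub> i)"
      by (rule U.P.finsum_rdistr[symmetric]) (use u c in auto)
    finally show ?thesis using c by (simp add: expand_def Suc lessThan_Suc_atMost)
  qed
qed

lemma expand_closed [simp]:
  "u \<in> carrier (UP F) \<Longrightarrow> (\<And>i. c i \<in> carrier (UP F)) \<Longrightarrow> expand u c N \<in> carrier (UP F)"
  unfolding expand_def by (intro U.P.finsum_closed) auto

section \<open>Existence and uniqueness of expansions in powers of \<open>u\<close>\<close>

context
  fixes u d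
  assumes u: "u \<in> carrier (UP F)" and d: "deg F u = d" "1 \<le> d"
begin

lemma u_nonzero: "u \<noteq> \<zero>\<^bsub>UP F\<^esub>"
  using d by auto

lemma polys_mult_u:
  assumes "q \<in> carrier (UP F)" "u \<otimes>\<^bsub>UP F\<^esub> q \<in> polys (d * Suc N)"
  shows "q \<in> polys (d * N)"
proof (cases "q = \<zero>\<^bsub>UP F\<^esub>")
  case False
  then have "u \<otimes>\<^bsub>UP F\<^esub> q \<noteq> \<zero>\<^bsub>UP F\<^esub>"
    using assms u u_nonzero by (simp add: U.integral_iff)
  then have "deg F (u \<otimes>\<^bsub>UP F\<^esub> q) < d * Suc N" using assms u by (simp add: polys_iff_deg)
  then show ?thesis using False assms u u_nonzero d by (simp add: polys_iff_deg)
qed simp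

lemma polys_cancel:
  assumes "x \<in> carrier (UP F)" "y \<in> carrier (UP F)" "c \<in> carrier (UP F)" "c' \<in> carrier (UP F)"
    and "u \<otimes>\<^bsub>UP F\<^esub> x \<oplus>\<^bsub>UP F\<^esub> c = u \<otimes>\<^bsub>UP F\<^esub> y \<oplus>\<^bsub>UP F\<^esub> c'"
  shows "u \<otimes>\<^bsub>UP F\<^esub> (x \<ominus>\<^bsub>UP F\<^esub> y) = c' \<ominus>\<^bsub>UP F\<^esub> c"
proof -
  have "u \<otimes>\<^bsub>UP F\<^esub> (x \<ominus>\<^bsub>UP F\<^esub> y) = (u \<otimes>\<^bsub>UP F\<^esub> x \<oplus>\<^bsub>UP F\<^esub> c) \<ominus>\<^bsub>UP F\<^esub> u \<otimes>\<^bsub>UP F\<^esub> y \<ominus>\<^bsub>UP F\<^esub> c"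
    using assms(1-4) u by algebra
  also have "\<dots> = c' \<ominus>\<^bsub>UP F\<^esub> c"
    unfolding assms(5) using assms(1-4) u by algebra
  finally show ?thesis .
qed

lemma division:
  assumes f: "f \<in> polys (d * Suc N)"
  shows "\<exists>q\<in>polys (d * N). \<exists>r\<in>polys d. f = u \<otimes>\<^bsub>UP F\<^esub> q \<oplus>\<^bsub>UP F\<^esub> r"
proof -
  have fc: "f \<in> carrier (UP F)" using f by (rule polysD)
  obtain q r and k :: nat where q: "q \<in> carrier (UP F)" and r: "r \<in> carrier (UP F)"
    and eq: "U.lcoeff u [^] k \<odot>\<^bsub>UP F\<^esub> f = u \<otimes>\<^bsub>UP F\<^esub> q \<oplus>\<^bsub>UP F\<^esub> r"
    and rd: "r = \<zero>\<^bsub>UP F\<^esub> \<or> deg F r < deg F u"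
    using U.long_div_theorem[OF u fc u_nonzero] by blast
  \<comment> \<open>Long division first multiplies \<open>f\<close> by a power of the leading
    coefficient of \<open>u\<close>; over a field this factor \<open>a\<close> can be divided out
    again.\<close>
  define a where "a = U.lcoeff u [^] k"
  have "U.lcoeff u \<in> carrier F - {\<zero>}" using u U.lcoeff_nonzero2[OF u u_nonzero] by simp
  then have a: "a \<in> carrier F" "a \<noteq> \<zero>"
    using field_mult_group[THEN group.is_monoid, THEN monoid.nat_pow_closed, of "U.lcoeff u" k]
    by (auto simp: a_def nat_pow_mult_of)
  then have inva: "inv a \<in> carrier F" "inv a \<otimes> a = \<one>" by (auto simp: field_Units)
  have "f = inv a \<odot>\<^bsub>UP F\<^esub> (a \<odot>\<^bsub>UP F\<^esub> f)"
    using a inva fc by (simp flip: U.smult_assoc1)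
  also have "a \<odot>\<^bsub>UP F\<^esub> f = u \<otimes>\<^bsub>UP F\<^esub> q \<oplus>\<^bsub>UP F\<^esub> r" using eq by (simp add: a_def)
  also have "inv a \<odot>\<^bsub>UP F\<^esub> \<dots> = inv a \<odot>\<^bsub>UP F\<^esub> (q \<otimes>\<^bsub>UP F\<^esub> u) \<oplus>\<^bsub>UP F\<^esub> inv a \<odot>\<^bsub>UP F\<^esub> r"
    using inva u q r by (simp add: U.smult_r_distr U.P.m_comm[OF q u])
  also have "inv a \<odot>\<^bsub>UP F\<^esub> (q \<otimes>\<^bsub>UP F\<^esub> u) = u \<otimes>\<^bsub>UP F\<^esub> (inv a \<odot>\<^bsub>UP F\<^esub> q)"
    using inva u q by (simp add: U.P.m_comm[OF u] flip: U.smult_assoc2)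
  finally have fe: "f = u \<otimes>\<^bsub>UP F\<^esub> (inv a \<odot>\<^bsub>UP F\<^esub> q) \<oplus>\<^bsub>UP F\<^esub> inv a \<odot>\<^bsub>UP F\<^esub> r" .
  have r': "inv a \<odot>\<^bsub>UP F\<^esub> r \<in> polys d"
    using rd r inva d by (intro polys_smult) (auto simp: polys_iff_deg)
  have "u \<otimes>\<^bsub>UP F\<^esub> (inv a \<odot>\<^bsub>UP F\<^esub> q) = f \<ominus>\<^bsub>UP F\<^esub> inv a \<odot>\<^bsub>UP F\<^esub> r"
    unfolding fe using u q r inva by (simp add: U.P.minus_eq U.P.a_assoc U.P.r_neg)
  also have "\<dots> \<in> polys (d * Suc N)"
    using polys_mono[of d "d * Suc N"] r' f by (intro polys_diff) auto
  finally have "inv a \<odot>\<^bsub>UP F\<^esub> q \<in> polys (d * N)"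
    by (rule polys_mult_u[rotated]) (use q inva in auto)
  then show ?thesis using r' fe by blast
qed

lemma expansion_exists:
  "f \<in> polys (d * N) \<Longrightarrow> \<exists>c. (\<forall>i. c i \<in> polys d) \<and> (\<forall>i\<ge>N. c i = \<zero>\<^bsub>UP F\<^esub>) \<and> f = expand u c N"
proof (induction N arbitrary: f)
  case 0
  then have "f = \<zero>\<^bsub>UP F\<^esub>" by (auto simp: polys_def intro!: U.up_eqI)
  then show ?case by (intro exI[of _ "\<lambda>_. \<zero>\<^bsub>UP F\<^esub>"]) (simp add: expand_def)
next
  case (Suc N)
  obtain q r where q: "q \<in> polys (d * N)" and r: "r \<in> polys d"
    and f: "f = u \<otimes>\<^bsub>UP F\<^esub> q \<oplus>\<^bsub>UP F\<^esub> r" using division[OF Suc.prems] by blast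
  obtain c where c: "\<And>i. c i \<in> polys d" "\<And>i. i \<ge> N \<Longrightarrow> c i = \<zero>\<^bsub>UP F\<^esub>" and qe: "q = expand u c N"
    using Suc.IH[OF q] by blast
  let ?c = "case_nat r c"
  have cc: "?c i \<in> polys d" for i using c r by (simp split: nat.split)
  have "f = expand u ?c (Suc N)"
    by (subst expand_Suc[OF u polysD[OF cc]]) (simp add: f qe)
  then show ?case using cc c by (intro exI[of _ ?c]) (auto split: nat.split)
qed

text \<open>The difference of the two terms of index 0 is a multiple of \<open>u\<close> but has
  degree below \<open>d\<close>, so the cofactor lies in \<open>polys 0\<close> and vanishes. What
  remains is the same statement for shorter expansions.\<close>

lemma expansion_unique:
  assumes "\<And>i. c i \<in> polys d" "\<And>i. c' i \<in> polys d" "expand u c N = expand u c' N"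
  shows "\<forall>i<N. c i = c' i"
  using assms
proof (induction N arbitrary: c c')
  case (Suc N)
  let ?e = "expand u (\<lambda>i. c (Suc i)) N" and ?e' = "expand u (\<lambda>i. c' (Suc i)) N"
  have cc: "\<And>i. c i \<in> carrier (UP F)" "\<And>i. c' i \<in> carrier (UP F)" using Suc.prems(1,2) polysD by blast+
  have e: "?e \<in> carrier (UP F)" "?e' \<in> carrier (UP F)" using u cc by auto
  have eq: "u \<otimes>\<^bsub>UP F\<^esub> ?e \<oplus>\<^bsub>UP F\<^esub> c 0 = u \<otimes>\<^bsub>UP F\<^esub> ?e' \<oplus>\<^bsub>UP F\<^esub> c' 0"
    using Suc.prems(3) by (simp add: expand_Suc u cc)
  have "u \<otimes>\<^bsub>UP F\<^esub> (?e \<ominus>\<^bsub>UP F\<^esub> ?e') = c' 0 \<ominus>\<^bsub>UP F\<^esub> c 0"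
    by (rule polys_cancel) (use u e cc eq in auto)
  also have "\<dots> \<in> polys (d * Suc 0)" using Suc.prems by auto
  finally have "?e \<ominus>\<^bsub>UP F\<^esub> ?e' \<in> polys (d * 0)" by (rule polys_mult_u[rotated]) (use e in auto)
  then have "?e \<ominus>\<^bsub>UP F\<^esub> ?e' = \<zero>\<^bsub>UP F\<^esub>" by (auto simp: polys_def intro!: U.up_eqI)
  then have ee: "?e = ?e'" using e by simp
  then have "\<forall>i<N. c (Suc i) = c' (Suc i)" using Suc.prems by (intro Suc.IH) auto
  moreover have "c 0 = c' 0" using eq u e cc by (simp add: ee)
  ultimately show ?case by (auto simp: less_Suc_eq_0_disj)
qed simp

lemma expand_mono:
  assumes "\<And>i. c i \<in> carrier (UP F)" "\<And>i. i \<ge> N \<Longrightarrow> c i = \<zero>\<^bsub>UP F\<^esub>" "N \<le> M"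
  shows "expand u c N = expand u c M"
  unfolding expand_def
  by (rule U.P.add.finprod_mono_neutral_cong_left) (use assms u in auto)

lemma up_deg_less_u: "c \<in> carrier (UP F) \<Longrightarrow> up_deg F c < up_deg F u \<longleftrightarrow> c \<in> polys d"
  using up_deg_less_iff[of c "real d"] u_nonzero d by (simp add: up_deg_def[of F u])

lemma is_base_expansion_iff:
  assumes N: "\<And>i. i \<ge> N \<Longrightarrow> c i = \<zero>\<^bsub>UP F\<^esub>"
  shows "is_base_expansion F u f c \<longleftrightarrow> (\<forall>i. c i \<in> polys d) \<and> f = expand u c N"
proof -
  have *: "(\<forall>i. c i \<in> carrier (UP F) \<and> up_deg F (c i) < up_deg F u) \<longleftrightarrow> (\<forall>i. c i \<in> polys d)"
    using up_deg_less_u polysD by blast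
  have "{i. c i \<noteq> \<zero>\<^bsub>UP F\<^esub>} \<subseteq> {..<N}" using N
    by (metis (mono_tags, lifting) lessThan_iff mem_Collect_eq not_le subsetI)
  moreover from this have "finite {i. c i \<noteq> \<zero>\<^bsub>UP F\<^esub>}" by (rule finite_subset) simp
  moreover have "(\<Oplus>\<^bsub>UP F\<^esub>i \<in> {i. c i \<noteq> \<zero>\<^bsub>UP F\<^esub>}. c i \<otimes>\<^bsub>UP F\<^esub> (u [^]\<^bsub>UP F\<^esub> i)) = expand u c N"
    if "\<forall>i. c i \<in> polys d"
    unfolding expand_def
    by (rule U.P.add.finprod_mono_neutral_cong_left) (use that calculation u in \<open>auto intro!: U.P.m_closed intro: polysD\<close>)
  ultimately show ?thesis unfolding is_base_expansion_def * by auto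
qed

lemma the_base_expansion:
  assumes c: "\<And>i. c i \<in> polys d" "\<And>i. i \<ge> N \<Longrightarrow> c i = \<zero>\<^bsub>UP F\<^esub>" and f: "f = expand u c N"
  shows "(THE c. is_base_expansion F u f c) = c"
proof (rule the_equality)
  show "is_base_expansion F u f c"
    using is_base_expansion_iff[where c = c and N = N and f = f] c f by auto
next
  fix c' assume c': "is_base_expansion F u f c'"
  then have "finite {i. c' i \<noteq> \<zero>\<^bsub>UP F\<^esub>}" by (simp add: is_base_expansion_def)
  then obtain M where M: "\<forall>i\<in>{i. c' i \<noteq> \<zero>\<^bsub>UP F\<^esub>}. i < M" using finite_nat_set_iff_bounded by blast
  then have M': "\<And>i. i \<ge> M \<Longrightarrow> c' i = \<zero>\<^bsub>UP F\<^esub>" by (meson mem_Collect_eq not_le)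
  then have c'd: "\<And>i. c' i \<in> polys d" and f': "f = expand u c' M"
    using c' M' is_base_expansion_iff[where c = c' and N = M and f = f] by auto
  let ?M = "max M N"
  have "expand u c' ?M = expand u c ?M"
    using expand_mono[of c' M ?M] expand_mono[of c N ?M] c c'd M' f f' polysD
    by (metis max.cobounded1 max.cobounded2)
  then have "\<forall>i<?M. c' i = c i" using expansion_unique c c'd by blast
  then show "c' = c" using c M' by (metis ext leI max.bounded_iff)
qed

lemma base_deg_less_iff:
  assumes c: "\<And>i. c i \<in> polys d" "\<And>i. i \<ge> N \<Longrightarrow> c i = \<zero>\<^bsub>UP F\<^esub>"
  shows "base_deg F u (expand u c N) < ereal t \<longleftrightarrow> (\<forall>i. c i \<in> polys (nat \<lceil>t\<rceil>))"
proof -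
  \<comment> \<open>Only finitely many coefficients are distinct, so the supremum in
    \<open>base_deg\<close> is attained and a strict bound on it can be tested term by term.\<close>
  have "range c \<subseteq> insert \<zero>\<^bsub>UP F\<^esub> (c ` {..<N})" using c(2) by (metis (no_types, lifting) image_subsetI imageI insertCI lessThan_iff not_le)
  then have "finite (range c)" by (rule finite_subset) simp
  then have fin: "finite (range (\<lambda>i. up_deg F (c i)))"
    by (metis finite_imageI image_image)
  have "base_deg F u (expand u c N) < ereal t \<longleftrightarrow> (\<forall>i. up_deg F (c i) < ereal t)"
    unfolding base_deg_def
    using finite_Sup_less_iff[OF fin] by (simp add: the_base_expansion[OF c refl] del: the_eq_trivial)
  moreover have "c i \<in> carrier (UP F)" for i using c(1) by (rule polysD)
  ultimately show ?thesis by (simp add: up_deg_less_iff)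
qed

text \<open>With the powers of \<open>u\<close> frozen at their value in \<open>x\<close>, the
  polynomial on the right depends on \<open>x\<close> only through \<open>ev u x\<close>. It is
  therefore the same along a whole fibre of \<open>u\<close>, and its degree is below that of
  \<open>u\<close>.\<close>

lemma ev_expand:
  assumes c: "\<And>i. c i \<in> carrier (UP F)" and x: "x \<in> carrier F"
  shows "ev (expand u c N) x = ev (\<Oplus>\<^bsub>UP F\<^esub>i\<in>{..<N}. ev u x [^] i \<odot>\<^bsub>UP F\<^esub> c i) x"
proof -
  have "ev (expand u c N) x = (\<Oplus>i\<in>{..<N}. ev (c i) x \<otimes> ev u x [^] i)"
    unfolding expand_def by (subst ev_finsum) (use u c x in \<open>auto simp: U.evalRR_mult ev_pow intro!: add.finprod_cong'\<close>)
  also have "\<dots> = ev (\<Oplus>\<^bsub>UP F\<^esub>i\<in>{..<N}. ev u x [^] i \<odot>\<^bsub>UP F\<^esub> c i) x"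
    by (subst ev_finsum) (use u c x in \<open>auto simp: ev_smult m_comm intro!: add.finprod_cong'\<close>)
  finally show ?thesis .
qed

text \<open>On the fibre over \<open>y\<close>, \<open>f\<close> agrees with \<open>\<Sum>i. y ^ i * c i\<close>. A coefficient of this polynomial, viewed as a
  polynomial in \<open>y\<close>, has degree less than the number of fibres; so it vanishes identically as soon as
  it vanishes at all values \<open>y\<close>.\<close>

lemma base_deg_less_iff_local:
  assumes \<Omega>: "\<Omega> \<subseteq> carrier F" and fib: "\<And>y. y \<in> ev u ` \<Omega> \<Longrightarrow> card {x \<in> \<Omega>. ev u x = y} = d"
    and f: "f \<in> polys (card \<Omega>)"
  shows "base_deg F u f < ereal t \<longleftrightarrow>
    (\<forall>y\<in>ev u ` \<Omega>. eval_word F {x \<in> \<Omega>. ev u x = y} f \<in> RS_code F {x \<in> \<Omega>. ev u x = y} t)"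
proof -
  define N where "N = card (ev u ` \<Omega>)"
  define Fib where "Fib = (\<lambda>y. {x \<in> \<Omega>. ev u x = y})"
  define k where "k = nat \<lceil>t\<rceil>"
  have fin: "finite \<Omega>" using \<Omega> finite_carrier finite_subset by blast
  have Oc: "Fib y \<subseteq> carrier F" for y using \<Omega> by (auto simp: Fib_def)
  have "card \<Omega> = (\<Sum>y\<in>ev u ` \<Omega>. card (Fib y))"
    using sum.image_gen[OF fin, of "\<lambda>_. 1 :: nat" "ev u"] by (simp add: Fib_def)
  also have "\<dots> = d * N" using fib by (simp add: Fib_def N_def)
  finally have card\<Omega>: "card \<Omega> = d * N" .
  \<comment> \<open>As \<open>card \<Omega> = d * N\<close>, the bound on the degree of
    \<open>f\<close> leaves exactly as many terms as there are fibres.\<close>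
  obtain c where c: "\<And>i. c i \<in> polys d" "\<And>i. i \<ge> N \<Longrightarrow> c i = \<zero>\<^bsub>UP F\<^esub>" and fe: "f = expand u c N"
    using expansion_exists[of f N] f card\<Omega> by auto
  have cc: "\<And>i. c i \<in> carrier (UP F)" using c polysD by blast
  define L where "L = (\<lambda>y. \<Oplus>\<^bsub>UP F\<^esub>i\<in>{..<N}. y [^] i \<odot>\<^bsub>UP F\<^esub> c i)"
  have yc: "y \<in> carrier F" if "y \<in> ev u ` \<Omega>" for y using that u \<Omega> by auto
  have word: "eval_word F (Fib y) f = eval_word F (Fib y) (L y)" for y
    unfolding eval_word_def fe
    by (intro restrict_ext) (use Oc[of y] ev_expand[OF cc, where N = N] in \<open>auto simp: Fib_def L_def\<close>)
  have Ld: "L y \<in> polys d" if "y \<in> carrier F" for y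
    unfolding L_def using that c by (intro polys_finsum) auto
  have cfL: "cf (L y) j = (\<Oplus>i\<in>{..<N}. y [^] i \<otimes> cf (c i) j)" if "y \<in> carrier F" for y j
    unfolding L_def by (subst U.coeff_finsum) (use that cc in \<open>auto intro!: add.finprod_cong'\<close>)
  have "(\<forall>i. c i \<in> polys k) \<longleftrightarrow> (\<forall>y\<in>ev u ` \<Omega>. eval_word F (Fib y) f \<in> RS_code F (Fib y) t)"
  proof
    assume ck: "\<forall>i. c i \<in> polys k"
    show "\<forall>y\<in>ev u ` \<Omega>. eval_word F (Fib y) f \<in> RS_code F (Fib y) t"
    proof
      fix y assume "y \<in> ev u ` \<Omega>"
      then have "L y \<in> polys k" unfolding L_def using ck yc by (intro polys_finsum) auto
      then show "eval_word F (Fib y) f \<in> RS_code F (Fib y) t" by (simp add: word RS_code_eq k_def)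
    qed
  next
    assume loc: "\<forall>y\<in>ev u ` \<Omega>. eval_word F (Fib y) f \<in> RS_code F (Fib y) t"
    show "\<forall>i. c i \<in> polys k"
    proof (cases "d \<le> k")
      case True
      then show ?thesis using c polys_mono by blast
    next
      case False
      \<comment> \<open>\<open>L y\<close> and the polynomial \<open>p\<close> provided by the local
        code both have degree below the size \<open>d\<close> of the fibre, so agreeing on it makes
        them equal.\<close>
      have Lk: "L y \<in> polys k" if y: "y \<in> ev u ` \<Omega>" for y
      proof -
        obtain p where p: "p \<in> polys k" and e: "eval_word F (Fib y) (L y) = eval_word F (Fib y) p"
          using loc y by (auto simp: word RS_code_eq k_def)
        have "inj_on (eval_word F (Fib y)) (polys d)"
          using Oc[of y] fib[OF y] by (intro eval_word_inj) (auto simp: Fib_def)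
        then have "L y = p"
          using e Ld[OF yc[OF y]] p polys_mono[of k d] False by (auto dest: inj_onD)
        then show ?thesis using p by simp
      qed
      have zero: "cf (c i) j = \<zero>" if j: "k \<le> j" for i j
      proof (cases "i < N")
        case False
        then show ?thesis using c(2) by simp
      next
        case i: True
        obtain w where w: "w \<in> polys N" and cfw: "\<forall>i<N. cf w i = cf (c i) j"
          using ex_poly[of N "\<lambda>i. cf (c i) j"] cc by auto
        have "w = \<zero>\<^bsub>UP F\<^esub>"
        proof (rule polys_eq_zero[OF w, of "ev u ` \<Omega>"])
          fix y assume y: "y \<in> ev u ` \<Omega>"
          have "ev w y = (\<Oplus>i\<in>{..<N}. y [^] i \<otimes> cf (c i) j)"
            unfolding ev_eq_sum[OF w yc[OF y]]
            by (intro add.finprod_cong') (use cfw cc yc[OF y] in \<open>auto simp: m_comm\<close>)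
          also have "\<dots> = cf (L y) j" using cfL[OF yc[OF y]] by simp
          also have "\<dots> = \<zero>" using Lk[OF y] j by (rule polys_coeff)
          finally show "ev w y = \<zero>" .
        qed (use yc in \<open>auto simp: N_def\<close>)
        then show ?thesis using cfw i by simp
      qed
      then show ?thesis using cc by (simp add: polys_def)
    qed
  qed
  moreover have "base_deg F u f < ereal t \<longleftrightarrow> (\<forall>i. c i \<in> polys k)"
    unfolding fe k_def by (rule base_deg_less_iff[OF c])
  ultimately show ?thesis by (simp only: Fib_def)
qed

end

end

section \<open>Lattice points and digit expansions\<close>

text \<open>Discrete form of bounding the integral of \<open>x ^ s\<close> by an upper Riemann sum:
  the increment of \<open>x ^ Suc s\<close> from \<open>N\<close> to \<open>Suc N\<close> is at most
  \<open>Suc s\<close> times \<open>Suc N ^ s\<close>.\<close>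

lemma sum_powers_ge: "real N ^ Suc s \<le> real (Suc s) * (\<Sum>k\<le>N. real k ^ s)"
proof (induction N)
  case (Suc N)
  have "real (Suc N) ^ Suc s - real N ^ Suc s
      = (\<Sum>i<Suc s. real (Suc N) ^ (s - i) * real N ^ i)"
    by (subst diff_power_eq_sum, subst sum.nat_diff_reindex[symmetric])
      (auto intro!: sum.cong simp: mult.commute)
  also have "\<dots> \<le> (\<Sum>i<Suc s. real (Suc N) ^ s)"
  proof (rule sum_mono)
    fix i assume i: "i \<in> {..<Suc s}"
    have "real (Suc N) ^ (s - i) * real N ^ i \<le> real (Suc N) ^ (s - i) * real (Suc N) ^ i"
      by (intro mult_left_mono power_mono) auto
    also have "\<dots> = real (Suc N) ^ s" using i by (simp flip: power_add)
    finally show "real (Suc N) ^ (s - i) * real N ^ i \<le> real (Suc N) ^ s" .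
  qed
  also have "\<dots> = real (Suc s) * real (Suc N) ^ s" by simp
  finally show ?case using Suc.IH by (simp only: sum.atMost_Suc distrib_left)
qed simp

definition simplex_points :: "'i set \<Rightarrow> nat \<Rightarrow> ('i \<Rightarrow> nat) set" where
  "simplex_points S M = {f \<in> S \<rightarrow>\<^sub>E UNIV. (\<Sum>j\<in>S. f j) \<le> M}"

lemma finite_simplex_points: "finite S \<Longrightarrow> finite (simplex_points S M)"
proof -
  assume S: "finite S"
  have "simplex_points S M \<subseteq> S \<rightarrow>\<^sub>E {..M}"
  proof
    fix f assume f: "f \<in> simplex_points S M"
    have "f j \<le> M" if "j \<in> S" for j
      using f member_le_sum[of j S f] S that by (simp add: simplex_points_def)
    then show "f \<in> S \<rightarrow>\<^sub>E {..M}" using f by (auto simp: simplex_points_def PiE_iff)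
  qed
  then show ?thesis using finite_PiE[OF S, of "\<lambda>_. {..M}"] by (auto intro: finite_subset)
qed

text \<open>The volume \<open>M ^ s / fact s\<close> of the simplex, with \<open>s = card S\<close>,
  is a lower bound. Giving the new index the value \<open>M - k\<close> leaves a simplex of size
  \<open>k\<close> in one dimension less, and \<open>sum_powers_ge\<close> sums these
  slices.\<close>

lemma card_simplex_points_ge:
  assumes "finite S"
  shows "real M ^ card S \<le> fact (card S) * real (card (simplex_points S M))"
  using assms
proof (induction S arbitrary: M)
  case empty
  show ?case by (simp add: simplex_points_def)
next
  case (insert x S)
  let ?E = "\<lambda>k. (\<lambda>f. f(x := M - k)) ` simplex_points S k"
  have inj: "inj_on (\<lambda>f. f(x := M - k)) (simplex_points S k)" for k
  proof (intro inj_onI ext)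
    fix f g y assume f: "f \<in> simplex_points S k" and g: "g \<in> simplex_points S k"
      and e: "f(x := M - k) = g(x := M - k)"
    show "f y = g y"
    proof (cases "y = x")
      case True
      then show ?thesis using f g insert(2)
        by (auto simp: simplex_points_def PiE_iff extensional_def)
    next
      case False
      then show ?thesis using fun_cong[OF e, of y] by simp
    qed
  qed
  have disj: "?E k \<inter> ?E l = {}" if "k \<le> M" "l \<le> M" "k \<noteq> l" for k l
  proof -
    have "\<And>f g. f(x := M - k) \<noteq> g(x := M - l)" using that by (metis diff_diff_cancel fun_upd_same)
    then show ?thesis by auto
  qed
  have sub: "(\<Union>k\<le>M. ?E k) \<subseteq> simplex_points (insert x S) M"
  proof
    fix e assume "e \<in> (\<Union>k\<le>M. ?E k)"
    then obtain k f where k: "k \<le> M" and f: "f \<in> simplex_points S k" and e: "e = f(x := M - k)" by auto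
    have "(\<Sum>j\<in>S. e j) = (\<Sum>j\<in>S. f j)" using insert(2) by (intro sum.cong) (auto simp: e)
    then have "(\<Sum>j\<in>insert x S. e j) \<le> M" using insert(1,2) f k by (auto simp: e simplex_points_def)
    moreover have "e \<in> insert x S \<rightarrow>\<^sub>E UNIV" using f by (auto simp: e simplex_points_def PiE_iff extensional_def)
    ultimately show "e \<in> simplex_points (insert x S) M" by (simp add: simplex_points_def)
  qed
  have "(\<Sum>k\<le>M. card (simplex_points S k)) = (\<Sum>k\<le>M. card (?E k))"
    by (simp add: card_image inj)
  also have "\<dots> = card (\<Union>k\<le>M. ?E k)"
    using insert(1) disj by (intro card_UN_disjoint[symmetric]) (auto simp: finite_simplex_points)
  also have "\<dots> \<le> card (simplex_points (insert x S) M)"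
    using insert(1) by (intro card_mono sub finite_simplex_points) auto
  finally have le: "(\<Sum>k\<le>M. card (simplex_points S k)) \<le> card (simplex_points (insert x S) M)" .
  have "real M ^ card (insert x S) \<le> real (Suc (card S)) * (\<Sum>k\<le>M. real k ^ card S)"
    using insert(1,2) sum_powers_ge[of M "card S"] by simp
  also have "\<dots> \<le> real (Suc (card S)) * (\<Sum>k\<le>M. fact (card S) * real (card (simplex_points S k)))"
    by (intro mult_left_mono sum_mono insert.IH) auto
  also have "\<dots> = fact (Suc (card S)) * real (\<Sum>k\<le>M. card (simplex_points S k))"
    by (simp add: sum_distrib_left mult.assoc)
  also have "\<dots> \<le> fact (Suc (card S)) * real (card (simplex_points (insert x S) M))"
    using le by (intro mult_left_mono) (simp_all only: of_nat_le_iff fact_ge_zero)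
  finally show ?case using insert(1,2) by simp
qed

lemma digit_sum_less:
  fixes b :: nat
  assumes "\<And>j. j < N \<Longrightarrow> f j < b"
  shows "(\<Sum>j<N. f j * b ^ j) < b ^ N"
  using assms
proof (induction N)
  case (Suc N)
  have "(\<Sum>j<Suc N. f j * b ^ j) < b ^ N + f N * b ^ N" using Suc by simp
  also have "\<dots> = Suc (f N) * b ^ N" by simp
  also have "\<dots> \<le> b * b ^ N" using Suc.prems[of N] by (intro mult_right_mono) auto
  finally show ?case by simp
qed simp

lemma digit_sum_inj:
  fixes b :: nat
  assumes "\<And>j. j < N \<Longrightarrow> f j < b" "\<And>j. j < N \<Longrightarrow> g j < b"
    and "(\<Sum>j<N. f j * b ^ j) = (\<Sum>j<N. g j * b ^ j)" and "j < N"
  shows "f j = g j"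
  using assms
proof (induction N arbitrary: j)
  case (Suc N)
  have lt: "(\<Sum>j<N. f j * b ^ j) < b ^ N" "(\<Sum>j<N. g j * b ^ j) < b ^ N"
    using Suc.prems(1,2) by (auto intro!: digit_sum_less)
  have e: "(\<Sum>j<N. f j * b ^ j) + f N * b ^ N = (\<Sum>j<N. g j * b ^ j) + g N * b ^ N"
    using Suc.prems(3) by simp
  have "f N = ((\<Sum>j<N. f j * b ^ j) + f N * b ^ N) div b ^ N"
    using lt(1) Suc.prems(1)[of N] by (subst div_mult_self1) auto
  also have "\<dots> = g N" unfolding e using lt(2) Suc.prems(2)[of N] by (subst div_mult_self1) auto
  finally have N: "f N = g N" .
  then have "(\<Sum>j<N. f j * b ^ j) = (\<Sum>j<N. g j * b ^ j)" using e by simp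
  then show ?case using Suc N by (metis less_Suc_eq)
qed simp

section \<open>The Frobenius map and additive subgroups\<close>

context cring begin

lemma binomial_ring:
  assumes x: "x \<in> carrier R" and y: "y \<in> carrier R"
  shows "(x \<oplus> y) [^] (n :: nat) = (\<Oplus>k\<in>{..n}. [(n choose k)] \<cdot> (x [^] k \<otimes> y [^] (n - k)))"
proof (induction n)
  case 0
  show ?case by simp
next
  case (Suc n)
  define t where "t = (\<lambda>k. [(n choose k)] \<cdot> (x [^] k \<otimes> y [^] (n - k)))"
  have t: "t k \<in> carrier R" for k using x y by (simp add: t_def)
  have S1: "(\<Oplus>k\<in>{..n}. t k) \<otimes> x = (\<Oplus>k\<in>{..n}. [(n choose k)] \<cdot> (x [^] Suc k \<otimes> y [^] (n - k)))"
    by (subst finsum_ldistr) (use x y t in \<open>auto simp: t_def add_pow_ldistr add_pow_rdistr m_ac intro!: finsum_cong'\<close>)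
  have S2: "(\<Oplus>k\<in>{..n}. t k) \<otimes> y = (\<Oplus>k\<in>{..n}. [(n choose k)] \<cdot> (x [^] k \<otimes> y [^] (Suc n - k)))"
    by (subst finsum_ldistr)
      (use x y t in \<open>auto simp: t_def add_pow_ldistr m_assoc Suc_diff_le intro!: finsum_cong'\<close>)
  \<comment> \<open>The added term at \<open>Suc n\<close> has binomial coefficient 0. On the longer
    range the term at 0 can be split off, as done in \<open>S2''\<close>, and the rest lines up with
    \<open>S1\<close> for Pascal's rule.\<close>
  have S2': "(\<Oplus>k\<in>{..Suc n}. [(n choose k)] \<cdot> (x [^] k \<otimes> y [^] (Suc n - k)))
      = (\<Oplus>k\<in>{..n}. [(n choose k)] \<cdot> (x [^] k \<otimes> y [^] (Suc n - k)))"
    by (subst add.finprod_Suc) (use x y in \<open>auto simp: binomial_eq_0\<close>)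
  have S2'': "(\<Oplus>k\<in>{..Suc n}. [(n choose k)] \<cdot> (x [^] k \<otimes> y [^] (Suc n - k)))
      = (\<Oplus>k\<in>{..n}. [(n choose Suc k)] \<cdot> (x [^] Suc k \<otimes> y [^] (n - k))) \<oplus> y [^] Suc n"
    by (subst add.finprod_Suc2) (use x y in auto)
  have "(\<Oplus>k\<in>{..Suc n}. [(Suc n choose k)] \<cdot> (x [^] k \<otimes> y [^] (Suc n - k)))
      = (\<Oplus>k\<in>{..n}. [(Suc n choose Suc k)] \<cdot> (x [^] Suc k \<otimes> y [^] (n - k))) \<oplus> y [^] Suc n"
    by (subst add.finprod_Suc2) (use x y in auto)
  also have "(\<Oplus>k\<in>{..n}. [(Suc n choose Suc k)] \<cdot> (x [^] Suc k \<otimes> y [^] (n - k)))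
      = (\<Oplus>k\<in>{..n}. [(n choose k)] \<cdot> (x [^] Suc k \<otimes> y [^] (n - k))
          \<oplus> [(n choose Suc k)] \<cdot> (x [^] Suc k \<otimes> y [^] (n - k)))"
    using x y by (intro finsum_cong') (auto simp: add.nat_pow_mult)
  also have "\<dots> = (\<Oplus>k\<in>{..n}. [(n choose k)] \<cdot> (x [^] Suc k \<otimes> y [^] (n - k)))
      \<oplus> (\<Oplus>k\<in>{..n}. [(n choose Suc k)] \<cdot> (x [^] Suc k \<otimes> y [^] (n - k)))"
    by (rule finsum_addf) (use x y in auto)
  also have "\<dots> \<oplus> y [^] Suc n = (\<Oplus>k\<in>{..n}. t k) \<otimes> x \<oplus>
      ((\<Oplus>k\<in>{..n}. [(n choose Suc k)] \<cdot> (x [^] Suc k \<otimes> y [^] (n - k))) \<oplus> y [^] Suc n)"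
    unfolding S1 by (rule a_assoc) (use x y in \<open>auto intro!: finsum_closed\<close>)
  also have "\<dots> = (\<Oplus>k\<in>{..n}. t k) \<otimes> x \<oplus> (\<Oplus>k\<in>{..n}. t k) \<otimes> y"
    by (simp only: S2 S2'[symmetric] S2'')
  also have "\<dots> = (\<Oplus>k\<in>{..n}. t k) \<otimes> (x \<oplus> y)"
    by (rule r_distr[symmetric]) (use x y t in \<open>auto intro!: finsum_closed\<close>)
  also have "\<dots> = (x \<oplus> y) [^] Suc n" using Suc.IH by (simp add: t_def)
  finally show ?case by simp
qed

lemma frobenius_add:
  assumes p: "prime p" and char: "\<And>z. z \<in> carrier R \<Longrightarrow> [p] \<cdot> z = \<zero>"
    and x: "x \<in> carrier R" and y: "y \<in> carrier R"
  shows "(x \<oplus> y) [^] (p ^ e :: nat) = x [^] (p ^ e) \<oplus> y [^] (p ^ e)"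
proof (induction e)
  case 0
  then show ?case using x y by simp
next
  case (Suc e)
  have one: "(u \<oplus> v) [^] p = u [^] p \<oplus> v [^] p" if u: "u \<in> carrier R" and v: "v \<in> carrier R" for u v
  proof -
    let ?t = "\<lambda>k. [(p choose k)] \<cdot> (u [^] k \<otimes> v [^] (p - k))"
    have p0: "0 < p" using p prime_gt_0_nat by blast
    have zero: "?t k = \<zero>" if "k \<in> {..p} - {0, p}" for k
    proof -
      have "p dvd (p choose k)" using that p by (intro dvd_choose_prime) auto
      then obtain c where c: "p choose k = p * c" by blast
      have "[(p * c)] \<cdot> z = \<zero>" if z: "z \<in> carrier R" for z
        using char[of "[c] \<cdot> z"] z by (simp add: add.nat_pow_pow mult.commute)
      then show ?thesis using u v by (simp add: c)
    qed
    have "(u \<oplus> v) [^] p = (\<Oplus>k\<in>{..p}. ?t k)" using u v by (rule binomial_ring)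
    also have "\<dots> = (\<Oplus>k\<in>{0, p}. ?t k)"
      by (rule add.finprod_mono_neutral_cong_right) (use zero u v in auto)
    also have "\<dots> = ?t 0 \<oplus> ?t p"
      using p0 u v by (subst finsum_insert) auto
    finally show ?thesis using u v by (simp add: a_comm)
  qed
  have "(x \<oplus> y) [^] (p ^ Suc e) = ((x \<oplus> y) [^] (p ^ e)) [^] p"
    using x y by (simp add: nat_pow_pow mult.commute)
  also have "\<dots> = (x [^] (p ^ e)) [^] p \<oplus> (y [^] (p ^ e)) [^] p"
    unfolding Suc.IH using x y by (intro one) auto
  finally show ?case using x y by (simp add: nat_pow_pow mult.commute)
qed

end

context finite_field begin

abbreviation asub :: "'a set \<Rightarrow> bool" where
  "asub W \<equiv> subgroup W (add_monoid F)"

lemma asubI: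
  assumes "W \<subseteq> carrier F" "\<zero> \<in> W" "\<And>x y. x \<in> W \<Longrightarrow> y \<in> W \<Longrightarrow> x \<oplus> y \<in> W"
    and "\<And>x. x \<in> W \<Longrightarrow> \<ominus> x \<in> W"
  shows "asub W"
  by (rule add.subgroupI) (use assms in \<open>auto simp: a_inv_def\<close>)

lemma asubD:
  assumes "asub W"
  shows "W \<subseteq> carrier F" "\<zero> \<in> W" "\<And>x y. x \<in> W \<Longrightarrow> y \<in> W \<Longrightarrow> x \<oplus> y \<in> W"
    and "\<And>x. x \<in> W \<Longrightarrow> \<ominus> x \<in> W" "\<And>x y. x \<in> W \<Longrightarrow> y \<in> W \<Longrightarrow> x \<ominus> y \<in> W"
proof -
  show 1: "W \<subseteq> carrier F" "\<zero> \<in> W" "\<And>x y. x \<in> W \<Longrightarrow> y \<in> W \<Longrightarrow> x \<oplus> y \<in> W"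
    using subgroup.subset[OF assms] subgroup.one_closed[OF assms] subgroup.m_closed[OF assms] by auto
  show 2: "\<And>x. x \<in> W \<Longrightarrow> \<ominus> x \<in> W"
    using subgroup.m_inv_closed[OF assms] by (simp add: a_inv_def)
  show "\<And>x y. x \<in> W \<Longrightarrow> y \<in> W \<Longrightarrow> x \<ominus> y \<in> W" using 1 2 by (simp add: minus_eq)
qed

lemma asub_finite: "asub W \<Longrightarrow> finite W"
  using asubD(1) finite_carrier finite_subset by blast

lemma asub_Int: "asub W \<Longrightarrow> asub W' \<Longrightarrow> asub (W \<inter> W')"
  using asubD[of W] asubD[of W'] by (intro asubI) auto

lemma asub_preimage:
  assumes "asub W" "a \<in> carrier F"
  shows "asub {v \<in> carrier F. a \<otimes> v \<in> W}"
  by (rule asubI) (use assms asubD[OF assms(1)] in \<open>auto simp: r_distr r_minus\<close>)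

lemma subfield_asub: "subfield L F \<Longrightarrow> asub L"
  using subringE[OF subfieldE(1)] by (intro asubI) auto

lemma asub_card_dvd:
  assumes "asub W" "asub L" "W \<subseteq> L"
  shows "card W dvd card L"
proof -
  interpret L: Group.group "(add_monoid F)\<lparr>carrier := L\<rparr>"
    by (rule add.subgroup_imp_group[OF assms(2)])
  have "subgroup W ((add_monoid F)\<lparr>carrier := L\<rparr>)"
    by (rule add.subgroup_incl[OF assms])
  from L.lagrange[OF this] show ?thesis
    by (simp add: Coset.order_def) (metis dvd_triv_right)
qed

text \<open>A subspace of \<open>V\<close> that is maximal among those of order a power of
  \<open>card L\<close> must be \<open>V\<close>: adjoining a line \<open>L v\<close> to a proper
  subspace multiplies its order by \<open>card L\<close>.\<close>

lemma card_vector_space: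
  assumes L: "subfield L F" and V: "asub V" and LV: "\<And>l v. l \<in> L \<Longrightarrow> v \<in> V \<Longrightarrow> l \<otimes> v \<in> V"
  shows "\<exists>e. card V = card L ^ e"
proof -
  define S where "S = {W. asub W \<and> W \<subseteq> V \<and> (\<forall>l\<in>L. \<forall>w\<in>W. l \<otimes> w \<in> W) \<and> (\<exists>e. card W = card L ^ e)}"
  have Lc: "L \<subseteq> carrier F" and Lsub: "asub L" using subfieldE(3)[OF L] subfield_asub[OF L] by auto
  have Lm: "\<And>k l. k \<in> L \<Longrightarrow> l \<in> L \<Longrightarrow> k \<otimes> l \<in> L" "\<one> \<in> L"
    using subringE[OF subfieldE(1)[OF L]] by auto
  note Vd = asubD[OF V]
  have "finite S"
    using asub_finite[OF V] by (intro finite_subset[of S "Pow V"]) (auto simp: S_def)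
  moreover have "{\<zero>} \<in> S"
    using Vd(2) Lc by (auto simp: S_def intro!: asubI exI[of _ 0])
  ultimately obtain W where W: "W \<in> S" and max: "\<And>W'. W' \<in> S \<Longrightarrow> W \<subseteq> W' \<Longrightarrow> W = W'"
    using finite_has_maximal[of S] by blast
  have Wsub: "asub W" and WV: "W \<subseteq> V" and LW: "\<And>l w. l \<in> L \<Longrightarrow> w \<in> W \<Longrightarrow> l \<otimes> w \<in> W"
    using W by (auto simp: S_def)
  obtain e where e: "card W = card L ^ e" using W by (auto simp: S_def)
  note Wd = asubD[OF Wsub]
  have "W = V"
  proof (rule ccontr)
    assume "W \<noteq> V"
    then obtain v where v: "v \<in> V" "v \<notin> W" using WV by blast
    have vc: "v \<in> carrier F" using v Vd by blast
    define W' where "W' = (\<lambda>(w, l). w \<oplus> l \<otimes> v) ` (W \<times> L)"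
    have inj: "inj_on (\<lambda>(w, l). w \<oplus> l \<otimes> v) (W \<times> L)"
    proof (rule inj_onI, clarify)
      fix w l w' l' assume w: "w \<in> W" "w' \<in> W" and l: "l \<in> L" "l' \<in> L"
        and eq: "w \<oplus> l \<otimes> v = w' \<oplus> l' \<otimes> v"
      have c: "w \<in> carrier F" "w' \<in> carrier F" "l \<in> carrier F" "l' \<in> carrier F"
        using w l Wd Lc by auto
      have "(l \<ominus> l') \<otimes> v = (w \<oplus> l \<otimes> v) \<ominus> w \<ominus> l' \<otimes> v" using c vc by algebra
      also have "\<dots> = w' \<ominus> w" unfolding eq using c vc by algebra
      finally have d: "(l \<ominus> l') \<otimes> v \<in> W" using w Wd by simp
      have "l = l'"
      proof (rule ccontr)
        assume "l \<noteq> l'"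
        then have nz: "l \<ominus> l' \<in> L - {\<zero>}" using l c asubD(5)[OF Lsub] by auto
        have "inv (l \<ominus> l') \<otimes> ((l \<ominus> l') \<otimes> v) \<in> W"
          using subfield_m_inv(1)[OF L nz] d LW by blast
        moreover have "inv (l \<ominus> l') \<otimes> ((l \<ominus> l') \<otimes> v) = v"
          using subfield_m_inv[OF L nz] c vc Lc by (auto simp: m_assoc[symmetric])
        ultimately show False using v by simp
      qed
      then show "w = w' \<and> l = l'" using eq c vc by simp
    qed
    have "asub W'"
    proof (rule asubI)
      show "W' \<subseteq> carrier F" using Wd(1) Lc vc
        by (auto simp: W'_def intro!: a_closed m_closed)
      show "\<zero> \<in> W'" using Wd asubD(2)[OF Lsub] vc
        by (auto simp: W'_def intro!: image_eqI[of _ _ "(\<zero>, \<zero>)"])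
      fix x assume "x \<in> W'"
      then obtain w l where x: "w \<in> W" "l \<in> L" "x = w \<oplus> l \<otimes> v" by (auto simp: W'_def)
      have c: "w \<in> carrier F" "l \<in> carrier F" using x Wd Lc by auto
      have "\<ominus> x = \<ominus> w \<oplus> (\<ominus> l) \<otimes> v" unfolding x(3) using c vc by algebra
      then show "\<ominus> x \<in> W'" using x Wd asubD(4)[OF Lsub]
        by (auto simp: W'_def intro!: image_eqI[of _ _ "(\<ominus> w, \<ominus> l)"])
      fix y assume "y \<in> W'"
      then obtain w' l' where y: "w' \<in> W" "l' \<in> L" "y = w' \<oplus> l' \<otimes> v" by (auto simp: W'_def)
      have c': "w' \<in> carrier F" "l' \<in> carrier F" using y Wd Lc by auto
      have "x \<oplus> y = (w \<oplus> w') \<oplus> (l \<oplus> l') \<otimes> v" unfolding x(3) y(3) using c c' vc by algebra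
      then show "x \<oplus> y \<in> W'" using x y Wd asubD(3)[OF Lsub]
        by (auto simp: W'_def intro!: image_eqI[of _ _ "(w \<oplus> w', l \<oplus> l')"])
    qed
    moreover have "W' \<subseteq> V" using WV LV v(1) Vd by (auto simp: W'_def)
    moreover have "l \<otimes> x \<in> W'" if l: "l \<in> L" and "x \<in> W'" for l x
    proof -
      obtain w k where x: "w \<in> W" "k \<in> L" "x = w \<oplus> k \<otimes> v" using \<open>x \<in> W'\<close> by (auto simp: W'_def)
      have "l \<otimes> x = l \<otimes> w \<oplus> (l \<otimes> k) \<otimes> v"
        unfolding x(3) using x l Wd Lc vc by (auto simp: r_distr m_assoc subset_iff)
      then show ?thesis using LW[OF l x(1)] Lm(1)[OF l x(2)]
        by (auto simp: W'_def intro!: image_eqI[of _ _ "(l \<otimes> w, l \<otimes> k)"])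
    qed
    moreover have "card W' = card L ^ Suc e"
      unfolding W'_def using card_image[OF inj] by (simp add: card_cartesian_product e)
    then have "\<exists>e. card W' = card L ^ e" by blast
    ultimately have "W' \<in> S" by (auto simp: S_def)
    moreover have "W \<subseteq> W'"
    proof
      fix w assume "w \<in> W"
      then show "w \<in> W'" using Wd asubD(2)[OF Lsub] vc
        by (auto simp: W'_def intro!: image_eqI[of _ _ "(w, \<zero>)"])
    qed
    moreover have "v \<in> W'" using Wd(2) Lm(2) vc
      by (auto simp: W'_def intro!: image_eqI[of _ _ "(\<zero>, \<one>)"])
    ultimately show False using max v by blast
  qed
  then show ?thesis using e by blast
qed

text \<open>By Lagrange in the additive group of \<open>L\<close>, the element
  \<open>[p] \<cdot> \<one>\<close> has \<open>e\<close>-th power zero, and a field contains no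
  nonzero nilpotent element.\<close>

lemma char_of_subfield:
  assumes L: "subfield L F" and card: "card L = p ^ e" and x: "x \<in> carrier F"
  shows "[p] \<cdot> x = \<zero>"
proof -
  interpret L: Group.group "(add_monoid F)\<lparr>carrier := L\<rparr>"
    by (rule add.subgroup_imp_group[OF subfield_asub[OF L]])
  have one: "\<one> \<in> L" using subringE(3)[OF subfieldE(1)[OF L]] .
  have "[card L] \<cdot> \<one> = \<zero>"
    unfolding add.nat_pow_consistent[where H = L]
    using L.pow_order_eq_1[of \<one>] one by (simp add: Coset.order_def)
  moreover have "[(p ^ e)] \<cdot> \<one> = ([p] \<cdot> \<one>) [^] e"
  proof (induction e)
    case (Suc e)
    have "[(p ^ Suc e)] \<cdot> \<one> = [p] \<cdot> ([(p ^ e)] \<cdot> \<one>)"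
      by (simp add: add.nat_pow_pow mult.commute)
    also have "\<dots> = [p] \<cdot> (([(p ^ e)] \<cdot> \<one>) \<otimes> \<one>)" by simp
    also have "\<dots> = ([(p ^ e)] \<cdot> \<one>) \<otimes> [p] \<cdot> \<one>" by (rule add_pow_rdistr[symmetric]) auto
    finally show ?case using Suc.IH by simp
  qed simp
  ultimately have "([p] \<cdot> \<one>) [^] e = \<zero>" by (simp add: card)
  then have "[p] \<cdot> \<one> = \<zero>"
  proof (induction e)
    case (Suc e)
    then show ?case using integral[of "([p] \<cdot> \<one>) [^] e" "[p] \<cdot> \<one>"] by auto
  qed simp
  then have "([p] \<cdot> \<one>) \<otimes> x = \<zero>" using x by simp
  then show ?thesis using x by (subst (asm) add_pow_ldistr) auto
qed

lemma subfield_pow_card: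
  assumes L: "subfield L F" and x: "x \<in> L"
  shows "x [^] card L = x"
proof (cases "x = \<zero>")
  case True
  have "card L \<noteq> 0" using x asub_finite[OF subfield_asub[OF L]] by auto
  then show ?thesis using True by (simp add: nat_pow_zero)
next
  case False
  let ?M = "(mult_of F)\<lparr>carrier := L - {\<zero>}\<rparr>"
  interpret M: Group.group ?M
    using Group.group.subgroup_imp_group[OF field_mult_group subgroup_mult_of[OF L]] .
  have fin: "finite L" using asub_finite[OF subfield_asub[OF L]] .
  have "x [^]\<^bsub>?M\<^esub> (card L - 1) = \<one>\<^bsub>?M\<^esub>"
    using M.pow_order_eq_1[of x] x False fin asubD(2)[OF subfield_asub[OF L]]
    by (simp add: Coset.order_def card_Diff_singleton)
  then have "x [^] (card L - 1) = \<one>"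
    by (simp add: nat_pow_def)
  moreover have "card L = Suc (card L - 1)" using x fin by (metis card_gt_0_iff empty_iff Suc_diff_1)
  ultimately show ?thesis using x subfieldE(3)[OF L] by (metis l_one nat_pow_Suc subsetD)
qed

end

section \<open>The additive span \<open>V\<close> of \<open>H G\<close>, its scalars and its
  order\<close>

locale expander_setting = finite_field F for F :: "('a, 'b) ring_scheme" (structure) +
  fixes p m :: nat and G K H :: "'a set"
  assumes p: "prime p" and m: "2 \<le> m"
    and G: "subfield G F" "card G = p ^ m"
    and K: "subfield K F" "card K = p ^ (m + 1)"
    and H: "subgroup H (mult_of (F\<lparr>carrier := K\<rparr>))" "p ^ m < card H"
begin

definition V :: "'a set" where
  "V = generate (add_monoid F) {h \<otimes> g | h g. h \<in> H \<and> g \<in> G}"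

lemma p_gt_1: "1 < p" using p prime_gt_1_nat by blast

lemma G_subset: "G \<subseteq> carrier F" and K_subset: "K \<subseteq> carrier F"
  using subfieldE(3) G K by auto

lemma H_subset_K: "H \<subseteq> K - {\<zero>}"
  using subgroup.subset[OF H(1)] by simp

lemma H_carrier: "h \<in> H \<Longrightarrow> h \<in> carrier F - {\<zero>}"
  using H_subset_K K_subset by auto

lemma one_H: "\<one> \<in> H"
  using subgroup.one_closed[OF H(1)] by simp

lemma H_mult: "h \<in> H \<Longrightarrow> h' \<in> H \<Longrightarrow> h \<otimes> h' \<in> H"
  using subgroup.m_closed[OF H(1)] by simp

lemma H_subgroup: "subgroup H (mult_of F)"
proof (rule Group.group.subgroupI[OF field_mult_group])
  fix h assume h: "h \<in> H"
  interpret M: Group.group "mult_of (F\<lparr>carrier := K\<rparr>)"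
    using subfield_iff(2)[OF K(1)] by (rule field.field_mult_group)
  let ?i = "inv\<^bsub>mult_of (F\<lparr>carrier := K\<rparr>)\<^esub> h"
  have "?i \<in> H" "?i \<otimes> h = \<one>"
    using subgroup.m_inv_closed[OF H(1) h] M.l_inv[of h] h H_subset_K by auto
  then have "inv\<^bsub>mult_of F\<^esub> h = ?i"
    using Group.group.inv_equality[OF field_mult_group] h H_carrier by simp
  then show "inv\<^bsub>mult_of F\<^esub> h \<in> H" using \<open>?i \<in> H\<close> by simp
qed (use H_carrier one_H H_mult in auto)

lemma H_inv: "h \<in> H \<Longrightarrow> inv h \<in> H" "h \<in> H \<Longrightarrow> inv h \<otimes> h = \<one>" "h \<in> H \<Longrightarrow> h \<otimes> inv h = \<one>"
  using subgroup.m_inv_closed[OF H_subgroup] H_carrier by (auto simp: m_inv_mult_of field_Units)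

text \<open>The order divides \<open>p ^ (m + 1)\<close>, and no such divisor lies strictly between
  \<open>p ^ m\<close> and \<open>p ^ (m + 1)\<close>. The linearity of \<open>V\<close> over
  \<open>K\<close> and the expansion of the graph both rest on this gap.\<close>

lemma additive_subgroup_of_K:
  assumes "asub W" "W \<subseteq> K" "p ^ m < card W"
  shows "W = K"
proof -
  have "card W dvd p ^ (m + 1)"
    using asub_card_dvd[OF assms(1) subfield_asub[OF K(1)] assms(2)] K by simp
  then obtain i where i: "i \<le> m + 1" "card W = p ^ i"
    using p divides_primepow_nat by blast
  then have "i = m + 1"
    using assms(3) p_gt_1 by (metis le_SucE Suc_eq_plus1 linorder_not_less power_increasing_iff)
  then show ?thesis
    using assms i K asub_finite[OF subfield_asub[OF K(1)]] by (intro card_subset_eq) auto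
qed

lemma HG_carrier: "{h \<otimes> g | h g. h \<in> H \<and> g \<in> G} \<subseteq> carrier F"
  using H_carrier G_subset by blast

lemma V_asub: "asub V"
  unfolding V_def using HG_carrier by (intro add.generate_is_subgroup) auto

lemmas V_closed = asubD[OF V_asub]

lemma HG_in_V: "h \<in> H \<Longrightarrow> g \<in> G \<Longrightarrow> h \<otimes> g \<in> V"
  unfolding V_def by (intro generate.incl) blast

lemma G_subset_V: "G \<subseteq> V"
  using HG_in_V[OF one_H] G_subset by force

lemma V_subset:
  assumes "asub W" "\<And>h g. h \<in> H \<Longrightarrow> g \<in> G \<Longrightarrow> h \<otimes> g \<in> W"
  shows "V \<subseteq> W"
  unfolding V_def using assms by (intro add.generate_subgroup_incl) auto

lemma H_V: "h \<in> H \<Longrightarrow> v \<in> V \<Longrightarrow> h \<otimes> v \<in> V"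
proof -
  assume h: "h \<in> H" and v: "v \<in> V"
  have "V \<subseteq> {v \<in> carrier F. h \<otimes> v \<in> V}"
    using h H_carrier H_mult G_subset HG_in_V
    by (intro V_subset asub_preimage V_asub) (auto simp: m_assoc[symmetric])
  then show ?thesis using v by blast
qed

lemma G_V: "g \<in> G \<Longrightarrow> v \<in> V \<Longrightarrow> g \<otimes> v \<in> V"
proof -
  assume g: "g \<in> G" and v: "v \<in> V"
  have gg: "g \<otimes> g' \<in> G" if "g' \<in> G" for g'
    using subringE(6)[OF subfieldE(1)[OF G(1)]] g that by auto
  have "g \<otimes> (h \<otimes> g') \<in> V" if "h \<in> H" "g' \<in> G" for h g'
  proof -
    have "g \<otimes> (h \<otimes> g') = h \<otimes> (g \<otimes> g')"
      using that g H_carrier[of h] G_subset by (intro m_lcomm) auto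
    then show ?thesis using HG_in_V that gg by simp
  qed
  then have "V \<subseteq> {v \<in> carrier F. g \<otimes> v \<in> V}"
    using g H_carrier G_subset by (intro V_subset asub_preimage V_asub) auto
  then show ?thesis using v by blast
qed

text \<open>For fixed \<open>v\<close>, the scalars in \<open>K\<close> that keep \<open>v\<close>
  inside \<open>V\<close> form an additive subgroup. It contains \<open>H\<close>, hence is too
  large to be proper.\<close>

lemma K_V: "k \<in> K \<Longrightarrow> v \<in> V \<Longrightarrow> k \<otimes> v \<in> V"
proof -
  assume k: "k \<in> K" and v: "v \<in> V"
  let ?W = "K \<inter> {k \<in> carrier F. v \<otimes> k \<in> V}"
  have vc: "v \<in> carrier F" using v V_closed by auto
  have "asub ?W" by (intro asub_Int asub_preimage subfield_asub K V_asub vc)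
  moreover have "H \<subseteq> ?W"
    using H_subset_K H_V v H_carrier vc by (auto simp: m_comm subset_iff)
  then have "card H \<le> card ?W"
    using asub_finite[OF calculation] by (intro card_mono)
  ultimately have "?W = K" using H(2) by (intro additive_subgroup_of_K) auto
  then have "v \<otimes> k \<in> V" using k by blast
  then show ?thesis using k K_subset vc by (auto simp: m_comm subset_iff)
qed

lemma char_p: "x \<in> carrier F \<Longrightarrow> [p] \<cdot> x = \<zero>"
  using char_of_subfield[OF G(1)] G(2) by blast

lemma frobenius: "x \<in> carrier F \<Longrightarrow> y \<in> carrier F \<Longrightarrow> (x \<oplus> y) [^] (p ^ e) = x [^] (p ^ e) \<oplus> y [^] (p ^ e)"
  using frobenius_add[OF p char_p] by blast

text \<open>Deduced from additivity and not from the parity of \<open>p ^ e\<close>, so that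
  \<open>p = 2\<close> needs no separate treatment.\<close>

lemma frobenius_minus: "x \<in> carrier F \<Longrightarrow> (\<ominus> x) [^] (p ^ e) = \<ominus> (x [^] (p ^ e))"
proof -
  assume x: "x \<in> carrier F"
  have "p ^ e \<noteq> 0" using p_gt_1 by simp
  then have "\<zero> [^] (p ^ e) = \<zero>" by (simp add: nat_pow_zero)
  then have "x [^] (p ^ e) \<oplus> (\<ominus> x) [^] (p ^ e) = \<zero>"
    using frobenius[of x "\<ominus> x" e] x by (simp add: r_neg)
  then show ?thesis using x by (metis a_inv_closed add.inv_comm minus_equality nat_pow_closed)
qed

lemma frobenius_diff: "x \<in> carrier F \<Longrightarrow> y \<in> carrier F \<Longrightarrow> (x \<ominus> y) [^] (p ^ e) = x [^] (p ^ e) \<ominus> y [^] (p ^ e)"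
  by (simp add: minus_eq frobenius frobenius_minus)

lemma subfield_pow_iterate:
  assumes "subfield L F" "card L = p ^ i" "x \<in> L"
  shows "x [^] (p ^ (i * j)) = x"
proof (induction j)
  case 0
  then show ?case using assms(3) subfieldE(3)[OF assms(1)] by auto
next
  case (Suc j)
  have x: "x \<in> carrier F" using assms subfieldE(3) by auto
  have "x [^] (p ^ (i * Suc j)) = (x [^] (p ^ (i * j))) [^] card L"
    using x by (simp add: nat_pow_pow power_add mult.commute assms(2))
  then show ?case using Suc.IH subfield_pow_card[OF assms(1,3)] by simp
qed

text \<open>The linear structures give divisibility of the exponent, the equation
  \<open>x ^ q = x\<close> the upper bound. Since \<open>V\<close> attains that bound, it consists
  of all solutions of the equation and is the compositum of \<open>G\<close> and
  \<open>K\<close>.\<close>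

lemma card_V: "card V = p ^ (m * (m + 1))"
proof -
  obtain a where a: "card V = p ^ ((m + 1) * a)"
    using card_vector_space[OF K(1) V_asub K_V] unfolding K(2) power_mult by blast
  obtain b where b: "card V = p ^ (m * b)"
    using card_vector_space[OF G(1) V_asub G_V] unfolding G(2) power_mult by blast
  have eq: "(m + 1) * a = m * b" using a b p_gt_1 by (metis power_inject_exp)
  \<comment> \<open>The exponent of \<open>p\<close> in \<open>card V\<close> is a multiple of both
    \<open>m\<close> and \<open>m + 1\<close>, which are coprime, so it is a multiple of their
    product.\<close>
  have "coprime m (m + 1)" by simp
  then have "m dvd a" using eq by (metis coprime_dvd_mult_right_iff dvd_triv_left)
  then obtain c where c: "a = m * c" by blast
  have le: "card V \<le> p ^ (m * (m + 1))"
  proof -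
    define q where "q = p ^ (m * (m + 1))"
    have q: "1 < q" unfolding q_def using p_gt_1 m by (intro one_less_power) auto
    define S where "S = {x \<in> carrier F. x [^] q = x}"
    have "asub S"
      by (rule asubI) (use q p_gt_1 in \<open>auto simp: S_def q_def frobenius frobenius_minus nat_pow_zero\<close>)
    moreover have "h \<otimes> g \<in> S" if "h \<in> H" "g \<in> G" for h g
    proof -
      have "h [^] q = h" "g [^] q = g"
        using subfield_pow_iterate[OF K, of h m] subfield_pow_iterate[OF G, of g "m + 1"] that H_subset_K
        by (auto simp: q_def mult.commute)
      then show ?thesis using that H_carrier[of h] G_subset by (auto simp: S_def nat_pow_distrib)
    qed
    ultimately have "V \<subseteq> S" by (rule V_subset)
    then have "card V \<le> card S" using finite_carrier by (intro card_mono) (auto simp: S_def)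
    \<comment> \<open>Zero is counted apart from the roots of \<open>x ^ (q - 1) = \<one>\<close>,
      which gives \<open>1 + (q - 1) = q\<close> in total.\<close>
    also have "S \<subseteq> insert \<zero> {x \<in> carrier F. x [^] (q - 1) = \<one>}"
    proof
      fix x assume x: "x \<in> S"
      show "x \<in> insert \<zero> {x \<in> carrier F. x [^] (q - 1) = \<one>}"
      proof (cases "x = \<zero>")
        case False
        have "x [^] (q - 1) \<otimes> x = \<one> \<otimes> x"
          using x q nat_pow_Suc[of x "q - 1"] by (simp add: S_def del: nat_pow_Suc)
        then have "x [^] (q - 1) = \<one>" using x False m_rcancel[of x "x [^] (q - 1)" \<one>] by (simp add: S_def)
        then show ?thesis using x by (simp add: S_def)
      qed simp
    qed
    then have "card S \<le> card (insert \<zero> {x \<in> carrier F. x [^] (q - 1) = \<one>})"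
      using finite_carrier by (intro card_mono) auto
    also have "\<dots> \<le> Suc (card {x \<in> carrier F. x [^] (q - 1) = \<one>})"
      using finite_carrier by (simp add: card_insert_if)
    also have "\<dots> \<le> q" using num_roots_le_deg[OF finite_carrier, of "q - 1"] q by simp
    finally show ?thesis by (simp add: q_def)
  qed
  have "1 < card V"
  proof -
    have "card G \<le> card V" using asub_finite[OF V_asub] G_subset_V by (intro card_mono)
    moreover have "1 < card G" using one_less_power[OF p_gt_1, of m] m G(2) by simp
    ultimately show ?thesis by simp
  qed
  then have "c \<noteq> 0" using a c by (cases c) auto
  moreover have "m * (m + 1) * c \<le> m * (m + 1)"
    using le p_gt_1 by (simp add: a c power_increasing_iff mult_ac)
  then have "c \<le> 1" using m by (metis One_nat_def add_gr_0 less_numeral_extra(1) mult_le_cancel1 nat_0_less_mult_iff nat_mult_1_right not_numeral_le_zero zero_less_iff_neq_zero)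
  ultimately have "c = 1" by simp
  then show ?thesis using a c by (simp add: mult.commute)
qed

end

section \<open>The affine group\<close>

context field begin

abbreviation aff :: "'a \<Rightarrow> 'a \<Rightarrow> 'a \<Rightarrow> 'a" where
  "aff \<equiv> affine_map R"

lemma aff_apply [simp]: "x \<in> carrier R \<Longrightarrow> aff a b x = a \<otimes> x \<oplus> b"
  by (simp add: affine_map_def)

lemma aff_in_Bij:
  assumes a: "a \<in> carrier R - {\<zero>}" and b: "b \<in> carrier R"
  shows "aff a b \<in> Bij (carrier R)"
proof -
  have ia: "inv a \<in> carrier R" "inv a \<otimes> a = \<one>" "a \<otimes> inv a = \<one>" using a by (auto simp: field_Units)
  have "bij_betw (aff a b) (carrier R) (carrier R)"
  proof (rule bij_betw_byWitness[where f' = "\<lambda>y. inv a \<otimes> (y \<ominus> b)"])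
    show "\<forall>x\<in>carrier R. inv a \<otimes> (aff a b x \<ominus> b) = x"
    proof
      fix x assume x: "x \<in> carrier R"
      have "a \<otimes> x \<oplus> b \<ominus> b = a \<otimes> x" using a b x by (simp add: minus_eq a_assoc r_neg)
      then show "inv a \<otimes> (aff a b x \<ominus> b) = x" using a b x ia by (simp flip: m_assoc)
    qed
    show "\<forall>y\<in>carrier R. aff a b (inv a \<otimes> (y \<ominus> b)) = y"
    proof
      fix y assume y: "y \<in> carrier R"
      have "a \<otimes> (inv a \<otimes> (y \<ominus> b)) = y \<ominus> b" using a b y ia by (simp flip: m_assoc)
      then show "aff a b (inv a \<otimes> (y \<ominus> b)) = y" using a b y ia by (simp add: minus_eq a_assoc l_neg)
    qed
  qed (use a b ia in auto)
  then show ?thesis by (simp add: Bij_def affine_map_def)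
qed

lemma AGL1_carrier: "carrier (AGL1 R) = {aff a b | a b. a \<in> carrier R - {\<zero>} \<and> b \<in> carrier R}"
  by (simp add: AGL1_def)

lemma AGL1_mult:
  assumes "f \<in> carrier (AGL1 R)" "g \<in> carrier (AGL1 R)"
  shows "f \<otimes>\<^bsub>AGL1 R\<^esub> g = compose (carrier R) f g"
  using assms aff_in_Bij by (auto simp: AGL1_def BijGroup_def)

lemma AGL1_apply:
  assumes "f \<in> carrier (AGL1 R)" "g \<in> carrier (AGL1 R)" "x \<in> carrier R"
  shows "(f \<otimes>\<^bsub>AGL1 R\<^esub> g) x = f (g x)"
  using assms by (simp add: AGL1_mult compose_def)

lemma aff_mult:
  assumes "a \<in> carrier R - {\<zero>}" "b \<in> carrier R" "c \<in> carrier R - {\<zero>}" "d \<in> carrier R"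
  shows "aff a b \<otimes>\<^bsub>AGL1 R\<^esub> aff c d = aff (a \<otimes> c) (a \<otimes> d \<oplus> b)"
proof -
  have "aff a b \<otimes>\<^bsub>AGL1 R\<^esub> aff c d = compose (carrier R) (aff a b) (aff c d)"
    using assms by (intro AGL1_mult) (auto simp: AGL1_carrier)
  also have "\<dots> = aff (a \<otimes> c) (a \<otimes> d \<oplus> b)"
    unfolding compose_def
    by (rule ext) (use assms in \<open>auto simp: affine_map_def r_distr m_assoc a_assoc\<close>)
  finally show ?thesis .
qed

lemma aff_inj:
  assumes "aff a b = aff c d" "a \<in> carrier R" "b \<in> carrier R" "c \<in> carrier R" "d \<in> carrier R"
  shows "a = c \<and> b = d"
proof -
  have "b = d" using fun_cong[OF assms(1), of \<zero>] assms(2-) by simp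
  moreover have "a \<oplus> b = c \<oplus> d" using fun_cong[OF assms(1), of \<one>] assms(2-) by simp
  ultimately show ?thesis using assms by simp
qed

lemma inv_nonzero: "a \<in> carrier R - {\<zero>} \<Longrightarrow> inv a \<in> carrier R - {\<zero>}"
  using Units_inv_Units[of a] unfolding field_Units .

lemma aff_in_AGL1: "a \<in> carrier R - {\<zero>} \<Longrightarrow> b \<in> carrier R \<Longrightarrow> aff a b \<in> carrier (AGL1 R)"
  by (auto simp: AGL1_carrier)

lemma AGL1_one: "\<one>\<^bsub>AGL1 R\<^esub> = aff \<one> \<zero>"
  by (auto simp: AGL1_def BijGroup_def affine_map_def)

lemma AGL1_group: "Group.group (AGL1 R)"
proof (rule groupI)
  fix x assume "x \<in> carrier (AGL1 R)"
  then obtain a b where x: "x = aff a b" and a: "a \<in> carrier R - {\<zero>}" and b: "b \<in> carrier R"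
    by (auto simp: AGL1_carrier)
  have ia: "inv a \<in> carrier R - {\<zero>}" "inv a \<otimes> a = \<one>" using a inv_nonzero[OF a] by (auto simp: field_Units)
  then show "\<one>\<^bsub>AGL1 R\<^esub> \<otimes>\<^bsub>AGL1 R\<^esub> x = x" using a b by (simp add: x AGL1_one aff_mult)
  have "aff (inv a) (\<ominus> (inv a \<otimes> b)) \<otimes>\<^bsub>AGL1 R\<^esub> x = \<one>\<^bsub>AGL1 R\<^esub>"
    using a b ia by (simp add: x AGL1_one aff_mult r_neg)
  then show "\<exists>y\<in>carrier (AGL1 R). y \<otimes>\<^bsub>AGL1 R\<^esub> x = \<one>\<^bsub>AGL1 R\<^esub>"
    using ia b
    by (intro bexI[of _ "aff (inv a) (\<ominus> (inv a \<otimes> b))"] aff_in_AGL1) auto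
  fix y assume "y \<in> carrier (AGL1 R)"
  then obtain c d where y: "y = aff c d" and c: "c \<in> carrier R - {\<zero>}" and d: "d \<in> carrier R"
    by (auto simp: AGL1_carrier)
  have ac: "a \<otimes> c \<in> carrier R - {\<zero>}" using a c by (auto simp: integral_iff)
  show "x \<otimes>\<^bsub>AGL1 R\<^esub> y \<in> carrier (AGL1 R)"

    unfolding x y aff_mult[OF a b c d] by (rule aff_in_AGL1[OF ac]) (use a b d in auto)
  fix z assume "z \<in> carrier (AGL1 R)"
  then obtain e f where z: "z = aff e f" and e: "e \<in> carrier R - {\<zero>}" and f: "f \<in> carrier R"
    by (auto simp: AGL1_carrier)
  have ce: "c \<otimes> e \<in> carrier R - {\<zero>}" using e c by (auto simp: integral_iff)
  show "x \<otimes>\<^bsub>AGL1 R\<^esub> y \<otimes>\<^bsub>AGL1 R\<^esub> z = x \<otimes>\<^bsub>AGL1 R\<^esub> (y \<otimes>\<^bsub>AGL1 R\<^esub> z)"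
    using a b c d e f ac ce by (simp add: x y z aff_mult m_assoc r_distr a_assoc)
qed (simp add: AGL1_one aff_in_AGL1)

end

context expander_setting begin

abbreviation A :: "('a \<Rightarrow> 'a) monoid" where
  "A \<equiv> gen_group F G H"

lemma V_carrier: "v \<in> V \<Longrightarrow> v \<in> carrier F"
  using V_closed(1) by blast

lemma aff_group_subgroup: "subgroup {aff h v | h v. h \<in> H \<and> v \<in> V} (AGL1 F)"
proof (rule Group.group.subgroupI[OF AGL1_group])
  show "{aff h v | h v. h \<in> H \<and> v \<in> V} \<subseteq> carrier (AGL1 F)"
    using H_carrier V_carrier by (auto intro!: aff_in_AGL1)
  show "{aff h v | h v. h \<in> H \<and> v \<in> V} \<noteq> {}" using one_H V_closed(2) by blast
  fix x assume "x \<in> {aff h v | h v. h \<in> H \<and> v \<in> V}"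
  then obtain h v where x: "x = aff h v" and h: "h \<in> H" and v: "v \<in> V" by blast
  have "inv h \<in> H" using H_inv h by blast
  have "aff (inv h) (\<ominus> (inv h \<otimes> v)) \<otimes>\<^bsub>AGL1 F\<^esub> x = \<one>\<^bsub>AGL1 F\<^esub>"
    using H_carrier[OF h] H_carrier[OF \<open>inv h \<in> H\<close>] V_carrier[OF v] H_inv[OF h]
    by (simp add: x AGL1_one aff_mult r_neg)
  then have "inv\<^bsub>AGL1 F\<^esub> x = aff (inv h) (\<ominus> (inv h \<otimes> v))"
    using H_carrier[OF h] H_carrier[OF \<open>inv h \<in> H\<close>] V_carrier[OF v]
    by (intro Group.group.inv_equality[OF AGL1_group]) (auto simp: x intro!: aff_in_AGL1)
  then show "inv\<^bsub>AGL1 F\<^esub> x \<in> {aff h v | h v. h \<in> H \<and> v \<in> V}"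
    using \<open>inv h \<in> H\<close> H_V[OF _ v] V_closed(4) by blast
  fix y assume "y \<in> {aff h v | h v. h \<in> H \<and> v \<in> V}"
  then obtain k w where y: "y = aff k w" and k: "k \<in> H" and w: "w \<in> V" by blast
  have "x \<otimes>\<^bsub>AGL1 F\<^esub> y = aff (h \<otimes> k) (h \<otimes> w \<oplus> v)"
    using H_carrier h k V_carrier v w by (simp add: x y aff_mult)
  then show "x \<otimes>\<^bsub>AGL1 F\<^esub> y \<in> {aff h v | h v. h \<in> H \<and> v \<in> V}"
    using H_mult[OF h k] H_V[OF h w] v V_closed(3) by blast
qed

text \<open>Conjugating the translation by \<open>g\<close> with the scaling by \<open>h\<close>
  gives the translation by \<open>h \<otimes> g\<close>. So the translations in the generated group
  include those by the generators of \<open>V\<close>, and the group is the semidirect product of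
  \<open>V\<close> with \<open>H\<close>.\<close>

lemma A_carrier: "carrier A = {aff h v | h v. h \<in> H \<and> v \<in> V}"
proof
  have "translation_grp F G \<union> scaling_grp F H \<subseteq> {aff h v | h v. h \<in> H \<and> v \<in> V}"
    using one_H G_subset_V V_closed(2) by (auto simp: translation_grp_def scaling_grp_def)
  then show "carrier A \<subseteq> {aff h v | h v. h \<in> H \<and> v \<in> V}"
    unfolding gen_group_def
    by (rule group.subgroup_generated_minimal[OF AGL1_group aff_group_subgroup])
  have sub: "subgroup (carrier A) (AGL1 F)"
    unfolding gen_group_def by (rule group.subgroup_subgroup_generated[OF AGL1_group])
  have gen: "aff \<one> g \<in> carrier A" "aff h \<zero> \<in> carrier A" if "g \<in> G" "h \<in> H" for g h
  proof -
    have "aff \<one> g \<in> carrier (AGL1 F)" "aff h \<zero> \<in> carrier (AGL1 F)"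
      using that G_subset H_carrier by (auto intro!: aff_in_AGL1)
    then show "aff \<one> g \<in> carrier A" "aff h \<zero> \<in> carrier A"
      unfolding gen_group_def carrier_subgroup_generated
      using that by (auto intro!: generate.incl simp: translation_grp_def scaling_grp_def)
  qed
  let ?W = "{v \<in> carrier F. aff \<one> v \<in> carrier A}"
  have one: "\<one> \<in> carrier F - {\<zero>}" by simp
  have "asub ?W"
  proof (rule asubI)
    show "\<zero> \<in> ?W" using gen(2)[OF _ one_H] G_subset asubD(2)[OF subfield_asub[OF G(1)]] by auto
    fix x assume x: "x \<in> ?W"
    have "inv\<^bsub>AGL1 F\<^esub> (aff \<one> x) = aff \<one> (\<ominus> x)"
      using x one by (intro Group.group.inv_equality[OF AGL1_group])
        (auto simp: aff_mult AGL1_one r_neg intro!: aff_in_AGL1)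
    then show "\<ominus> x \<in> ?W" using subgroup.m_inv_closed[OF sub, of "aff \<one> x"] x by simp
    fix y assume y: "y \<in> ?W"
    have "aff \<one> x \<otimes>\<^bsub>AGL1 F\<^esub> aff \<one> y = aff \<one> (x \<oplus> y)"
      using x y by (simp add: aff_mult a_comm)
    then show "x \<oplus> y \<in> ?W" using subgroup.m_closed[OF sub, of "aff \<one> x" "aff \<one> y"] x y by simp
  qed auto
  moreover have "h \<otimes> g \<in> ?W" if h: "h \<in> H" and g: "g \<in> G" for h g
  proof -
    have ih: "inv h \<in> H" using H_inv h by blast
    have "aff h \<zero> \<otimes>\<^bsub>AGL1 F\<^esub> aff \<one> g \<otimes>\<^bsub>AGL1 F\<^esub> aff (inv h) \<zero> = aff \<one> (h \<otimes> g)"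
      using H_carrier[OF h] H_carrier[OF ih] g G_subset H_inv[OF h]
      by (auto simp: aff_mult subset_iff)
    moreover have "aff h \<zero> \<otimes>\<^bsub>AGL1 F\<^esub> aff \<one> g \<otimes>\<^bsub>AGL1 F\<^esub> aff (inv h) \<zero> \<in> carrier A"
      using gen[OF g h] gen[OF g ih] by (intro subgroup.m_closed[OF sub])
    ultimately show ?thesis using H_carrier[OF h] g G_subset by auto
  qed
  ultimately have "V \<subseteq> ?W" by (rule V_subset)
  show "{aff h v | h v. h \<in> H \<and> v \<in> V} \<subseteq> carrier A"
  proof clarify
    fix h v assume h: "h \<in> H" and v: "v \<in> V"
    have "aff \<one> v \<otimes>\<^bsub>AGL1 F\<^esub> aff h \<zero> \<in> carrier A"
      using \<open>V \<subseteq> ?W\<close> v gen(2)[OF _ h] asubD(2)[OF subfield_asub[OF G(1)]]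
      by (intro subgroup.m_closed[OF sub]) auto
    then show "aff h v \<in> carrier A"
      using H_carrier[OF h] V_carrier[OF v] by (simp add: aff_mult)
  qed
qed

lemma A_mult: "x \<otimes>\<^bsub>A\<^esub> y = x \<otimes>\<^bsub>AGL1 F\<^esub> y"
  by (simp add: gen_group_def subgroup_generated_def)

lemma A_one: "\<one>\<^bsub>A\<^esub> = aff \<one> \<zero>"
  by (simp add: gen_group_def subgroup_generated_def AGL1_one)

lemma A_group: "Group.group A"
  unfolding gen_group_def by (rule group.group_subgroup_generated[OF AGL1_group])

lemma A_in_AGL1: "f \<in> carrier A \<Longrightarrow> f \<in> carrier (AGL1 F)"
  using subgroup.subset[OF aff_group_subgroup] by (auto simp: A_carrier)

lemma A_bij: "bij_betw (\<lambda>(h, v). aff h v) (H \<times> V) (carrier A)"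
proof (rule bij_betw_imageI)
  show "inj_on (\<lambda>(h, v). aff h v) (H \<times> V)"
    using H_carrier V_carrier by (auto simp: inj_on_def dest!: aff_inj)
qed (auto simp: A_carrier)

lemma H_finite: "finite H"
  using H_carrier finite_carrier by (metis Diff_iff finite_subset subsetI)

lemma V_finite: "finite V"
  by (rule asub_finite[OF V_asub])

lemma order_A: "Coset.order A = card H * p ^ (m * (m + 1))"
  using bij_betw_same_card[OF A_bij] by (simp add: Coset.order_def card_cartesian_product card_V)

end

section \<open>The evaluation points and their orbits\<close>

locale evaluation_setting = expander_setting F p m G K H
  for F :: "('a, 'b) ring_scheme" (structure) and p m G K H +
  fixes \<alpha> :: 'a
  assumes \<alpha>: "\<alpha> \<in> carrier F"
    and stab: "stabilizer (gen_group F G H) (\<lambda>\<phi>. \<phi>) \<alpha> = {\<one>\<^bsub>gen_group F G H\<^esub>}"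
begin

abbreviation \<Omega> :: "'a set" where
  "\<Omega> \<equiv> eval_set F G H \<alpha>"

text \<open>Coordinates on \<open>\<Omega>\<close>: the image of \<open>\<alpha>\<close> under
  \<open>aff h v\<close>. Since \<open>\<alpha>\<close> has trivial stabilizer, positions of the
  code correspond one to one to the edges \<open>(h, v)\<close> of the coset graph.\<close>

definition pt :: "'a \<times> 'a \<Rightarrow> 'a" where
  "pt = (\<lambda>(h, v). h \<otimes> \<alpha> \<oplus> v)"

lemma \<Omega>_eq: "\<Omega> = pt ` (H \<times> V)"
proof -
  have "\<Omega> = (\<lambda>f. f \<alpha>) ` carrier A" by (auto simp: eval_set_def orbit_def)
  also have "carrier A = (\<lambda>(h, v). aff h v) ` (H \<times> V)"
    using bij_betw_imp_surj_on[OF A_bij] by simp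
  also have "(\<lambda>f. f \<alpha>) ` \<dots> = pt ` (H \<times> V)"
    unfolding image_image using \<alpha> by (intro image_cong) (auto simp: pt_def)
  finally show ?thesis .
qed

lemma pt_inj: "inj_on pt (H \<times> V)"
proof (rule inj_onI, clarify)
  fix h v k w assume h: "h \<in> H" and v: "v \<in> V" and k: "k \<in> H" and w: "w \<in> V"
    and eq: "pt (h, v) = pt (k, w)"
  interpret A: Group.group A by (rule A_group)
  have a: "aff h v \<in> carrier A" "aff k w \<in> carrier A" using h k v w by (auto simp: A_carrier)
  have happ: "(x \<otimes>\<^bsub>A\<^esub> y) \<alpha> = x (y \<alpha>)" if "x \<in> carrier A" "y \<in> carrier A" for x y
    using that A_in_AGL1 \<alpha> by (simp add: A_mult AGL1_apply)
  let ?c = "inv\<^bsub>A\<^esub> (aff k w) \<otimes>\<^bsub>A\<^esub> aff h v"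
  have "?c \<alpha> = (inv\<^bsub>A\<^esub> (aff k w)) (aff h v \<alpha>)" using a by (intro happ) auto
  also have "aff h v \<alpha> = aff k w \<alpha>" using eq \<alpha> by (simp add: pt_def)
  also have "(inv\<^bsub>A\<^esub> (aff k w)) (aff k w \<alpha>) = (inv\<^bsub>A\<^esub> (aff k w) \<otimes>\<^bsub>A\<^esub> aff k w) \<alpha>"
    using a by (intro happ[symmetric]) auto
  also have "\<dots> = \<alpha>" using a \<alpha> by (simp add: A_one)
  finally have "?c \<in> stabilizer A (\<lambda>\<phi>. \<phi>) \<alpha>" using a by (simp add: stabilizer_def)
  then have "?c = \<one>\<^bsub>A\<^esub>" using stab by simp
  then have "aff h v = aff k w" using a by (metis A.inv_solve_left A.one_closed A.r_one)
  then show "h = k \<and> v = w" using h k v w H_carrier V_carrier by (auto dest!: aff_inj)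
qed

lemma card_\<Omega>: "card \<Omega> = Coset.order A"
  using card_image[OF pt_inj] by (simp add: \<Omega>_eq order_A card_cartesian_product card_V)

lemma pt_carrier: "e \<in> H \<times> V \<Longrightarrow> pt e \<in> carrier F"
  using H_carrier V_carrier \<alpha> by (auto simp: pt_def)

lemma \<Omega>_carrier: "\<Omega> \<subseteq> carrier F"
  using pt_carrier by (auto simp: \<Omega>_eq)

lemma pt_translate: "h \<in> H \<Longrightarrow> v \<in> V \<Longrightarrow> w \<in> V \<Longrightarrow> pt (h, v) \<oplus> w = pt (h, v \<oplus> w)"
  using H_carrier[of h] V_carrier \<alpha> by (simp add: pt_def a_assoc)

lemma pt_scale: "h \<in> H \<Longrightarrow> k \<in> H \<Longrightarrow> v \<in> V \<Longrightarrow> k \<otimes> pt (h, v) = pt (k \<otimes> h, k \<otimes> v)"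
  using H_carrier V_carrier \<alpha> by (simp add: pt_def r_distr m_assoc)

text \<open>Every scaling fixes zero, whereas the group acts freely on \<open>\<Omega>\<close>. This
  makes all \<open>H\<close>-orbits in \<open>\<Omega>\<close> full-sized.\<close>

lemma zero_notin_\<Omega>: "\<zero> \<notin> \<Omega>"
proof
  assume "\<zero> \<in> \<Omega>"
  then obtain h v where h: "h \<in> H" and v: "v \<in> V" and z: "\<zero> = pt (h, v)" by (auto simp: \<Omega>_eq)
  have "1 < card H" using H(2) p_gt_1 one_less_power[OF p_gt_1, of m] m by linarith
  then obtain k where k: "k \<in> H" "k \<noteq> \<one>"
    using one_H by (metis card_le_Suc0_iff_eq H_finite not_less One_nat_def)
  have "pt (k \<otimes> h, k \<otimes> v) = pt (h, v)"
    using pt_scale[OF h k(1) v] z[symmetric] H_carrier[OF k(1)] by simp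
  then have "k \<otimes> h = h" using inj_onD[OF pt_inj] h v k H_mult H_V by blast
  then have "k \<otimes> h = \<one> \<otimes> h" using H_carrier[OF h] by simp
  then show False using k H_carrier[OF h] H_carrier[OF k(1)] m_rcancel[of h k \<one>] by auto
qed

lemma left_orbits_eq: "left_orbits F G H \<alpha> = (\<lambda>\<beta>. (\<lambda>g. \<beta> \<oplus> g) ` G) ` \<Omega>"
proof -
  have "orbit ((AGL1 F)\<lparr>carrier := translation_grp F G\<rparr>) (\<lambda>\<phi>. \<phi>) \<beta> = (\<lambda>g. \<beta> \<oplus> g) ` G"
    if "\<beta> \<in> \<Omega>" for \<beta>
    using that \<Omega>_carrier G_subset
    by (auto simp: orbit_def translation_grp_def image_iff subset_iff a_comm; metis aff_apply l_one a_comm)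
  then show ?thesis by (auto simp: left_orbits_def orbits_def)
qed

lemma right_orbits_eq: "right_orbits F G H \<alpha> = (\<lambda>\<beta>. (\<lambda>h. h \<otimes> \<beta>) ` H) ` \<Omega>"
proof -
  have "orbit ((AGL1 F)\<lparr>carrier := scaling_grp F H\<rparr>) (\<lambda>\<phi>. \<phi>) \<beta> = (\<lambda>h. h \<otimes> \<beta>) ` H"
    if "\<beta> \<in> \<Omega>" for \<beta>
  proof -
    have "aff h \<zero> \<beta> = h \<otimes> \<beta>" if "h \<in> H" for h
      using that \<open>\<beta> \<in> \<Omega>\<close> \<Omega>_carrier H_carrier by (simp add: subset_iff)
    moreover have "orbit ((AGL1 F)\<lparr>carrier := scaling_grp F H\<rparr>) (\<lambda>\<phi>. \<phi>) \<beta> = (\<lambda>h. aff h \<zero> \<beta>) ` H"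
      by (auto simp: orbit_def scaling_grp_def)
    ultimately show ?thesis by simp
  qed
  then show ?thesis by (auto simp: right_orbits_def orbits_def)
qed

lemma translate_in_\<Omega>: "\<beta> \<in> \<Omega> \<Longrightarrow> g \<in> G \<Longrightarrow> \<beta> \<oplus> g \<in> \<Omega>"
  using pt_translate G_subset_V V_closed(3) by (fastforce simp: \<Omega>_eq)

lemma scale_in_\<Omega>: "\<beta> \<in> \<Omega> \<Longrightarrow> h \<in> H \<Longrightarrow> h \<otimes> \<beta> \<in> \<Omega>"
  using pt_scale H_mult H_V by (fastforce simp: \<Omega>_eq)

lemma card_left_orbit:
  assumes "\<beta> \<in> \<Omega>"
  shows "card ((\<lambda>g. \<beta> \<oplus> g) ` G) = card G"
  by (rule card_image) (use assms \<Omega>_carrier G_subset in \<open>auto simp: inj_on_def subset_iff\<close>)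

lemma card_right_orbit:
  assumes "\<beta> \<in> \<Omega>"
  shows "card ((\<lambda>h. h \<otimes> \<beta>) ` H) = card H"
proof (rule card_image)
  have "\<beta> \<in> carrier F - {\<zero>}" using assms \<Omega>_carrier zero_notin_\<Omega> by auto
  then show "inj_on (\<lambda>h. h \<otimes> \<beta>) H" using H_carrier by (auto simp: inj_on_def m_rcancel)
qed

end

section \<open>Expansion\<close>

context expander_setting begin

lemma V_comm_group: "comm_group ((add_monoid F)\<lparr>carrier := V\<rparr>)"
  using V_carrier
  by (intro Group.group.group_comm_groupI add.subgroup_imp_group[OF V_asub]) (auto simp: a_comm)

lemma H_inv_inv: "h \<in> H \<Longrightarrow> inv (inv h) = h"
  using H_carrier Units_inv_inv field_Units by blast

lemma dilate_asub:
  assumes "h \<in> H"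
  shows "asub ((\<lambda>g. inv h \<otimes> g) ` G)"
proof -
  have ih: "inv h \<in> carrier F" using H_inv(1)[OF assms] H_carrier by blast
  note Gd = asubD[OF subfield_asub[OF G(1)]]
  show ?thesis
  proof (rule asubI)
    show "(\<lambda>g. inv h \<otimes> g) ` G \<subseteq> carrier F" using ih G_subset by auto
    show "\<zero> \<in> (\<lambda>g. inv h \<otimes> g) ` G" using ih Gd(2) by (auto intro!: image_eqI[of _ _ \<zero>])
    fix x y assume "x \<in> (\<lambda>g. inv h \<otimes> g) ` G" "y \<in> (\<lambda>g. inv h \<otimes> g) ` G"
    then obtain g g' where g: "g \<in> G" "g' \<in> G" "x = inv h \<otimes> g" "y = inv h \<otimes> g'" by blast
    have "x \<oplus> y = inv h \<otimes> (g \<oplus> g')" using g ih G_subset by (auto simp: r_distr subset_iff)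
    then show "x \<oplus> y \<in> (\<lambda>g. inv h \<otimes> g) ` G" using Gd(3)[OF g(1,2)] by blast
  next
    fix x assume "x \<in> (\<lambda>g. inv h \<otimes> g) ` G"
    then obtain g where g: "g \<in> G" "x = inv h \<otimes> g" by blast
    have "\<ominus> x = inv h \<otimes> (\<ominus> g)" using g ih G_subset by (auto simp: r_minus subset_iff)
    then show "\<ominus> x \<in> (\<lambda>g. inv h \<otimes> g) ` G" using Gd(4)[OF g(1)] by blast
  qed
qed

text \<open>If many dilates \<open>h\<^sup>-\<^sup>1 G\<close> lie in an additive subgroup, the scalars \<open>k \<in> K\<close> with
  \<open>k G\<close> inside it form an additive subgroup of \<open>K\<close> with more than \<open>p ^ m\<close> elements, hence all of \<open>K\<close>.\<close>

lemma dilates_generate: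
  assumes J: "J \<subseteq> H" "p ^ m < card J" and W: "asub W"
    and sub: "\<And>h g. h \<in> J \<Longrightarrow> g \<in> G \<Longrightarrow> inv h \<otimes> g \<in> W"
  shows "V \<subseteq> W"
proof -
  define S where "S = {k \<in> K. \<forall>g\<in>G. k \<otimes> g \<in> W}"
  have inv_J: "inv h \<in> S" if "h \<in> J" for h
    using that J(1) H_inv(1)[of h] H_subset_K sub by (auto simp: S_def)
  have Sub: "asub S"
  proof (rule asubI)
    note Kd = asubD[OF subfield_asub[OF K(1)]] and Wd = asubD[OF W]
    show "S \<subseteq> carrier F" "\<zero> \<in> S" using K_subset Kd(2) Wd(2) G_subset by (auto simp: S_def subset_iff)
    fix x assume x: "x \<in> S"
    then show "\<ominus> x \<in> S" using Kd Wd G_subset K_subset by (auto simp: S_def l_minus subset_iff)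
    fix y assume "y \<in> S"
    then show "x \<oplus> y \<in> S" using x Kd Wd G_subset K_subset by (auto simp: S_def l_distr subset_iff)
  qed
  have "inj_on (m_inv F) J"
    by (rule inj_on_inverseI[where g = "m_inv F"]) (use J(1) H_inv_inv in blast)
  then have "card J = card (m_inv F ` J)" by (simp add: card_image)
  also have "\<dots> \<le> card S" using inv_J asub_finite[OF Sub] by (intro card_mono) auto
  finally have "S = K" using J(2) Sub by (intro additive_subgroup_of_K) (auto simp: S_def)
  then have "\<And>h g. h \<in> H \<Longrightarrow> g \<in> G \<Longrightarrow> h \<otimes> g \<in> W"
    using H_subset_K by (auto simp: S_def)
  then show ?thesis by (rule V_subset[OF W])
qed

text \<open>Adjacency in coordinates: a function \<open>f\<close> on the right vertices, identified
  with \<open>V\<close>, is averaged over the \<open>card G\<close> neighbours of the left vertex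
  that contains \<open>(h, v)\<close>.\<close>

definition left_mean :: "('a \<Rightarrow> real) \<Rightarrow> 'a \<Rightarrow> 'a \<Rightarrow> real" where
  "left_mean f h v = (\<Sum>g\<in>G. f (inv h \<otimes> (v \<oplus> g))) / real (card G)"

lemma sum_dilate:
  assumes "h \<in> H"
  shows "(\<Sum>v\<in>V. f (inv h \<otimes> v)) = (\<Sum>v\<in>V. (f v :: real))"
  by (rule sum.reindex_bij_witness[where i = "\<lambda>v. h \<otimes> v" and j = "\<lambda>v. inv h \<otimes> v"])
    (use assms H_inv[OF assms] H_V H_carrier V_carrier in \<open>auto simp flip: m_assoc\<close>)

lemma sum_dilate': "h \<in> H \<Longrightarrow> (\<Sum>v\<in>V. f (h \<otimes> v)) = (\<Sum>v\<in>V. (f v :: real))"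
  using sum_dilate[OF H_inv(1), of h f] H_inv_inv by simp

text \<open>For fixed \<open>h\<close>, substituting \<open>h \<otimes> v\<close> for
  \<open>v\<close> turns \<open>left_mean\<close> into the average over the subgroup
  \<open>inv h G\<close> and preserves sums over \<open>V\<close>. The trivial bound has
  \<open>card H\<close> in place of \<open>p ^ m\<close>; the quotient of the two is the
  expansion.\<close>

lemma left_mean_squares_le:
  assumes "(\<Sum>v\<in>V. f v) = 0"
  shows "(\<Sum>h\<in>H. \<Sum>v\<in>V. (left_mean f h v)\<^sup>2) \<le> real (p ^ m) * (\<Sum>v\<in>V. (f v)\<^sup>2)"
proof -
  let ?A = "(add_monoid F)\<lparr>carrier := V\<rparr>"
  let ?U = "\<lambda>h. (\<lambda>g. inv h \<otimes> g) ` G"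
  \<comment> \<open>\<open>f\<close> is cut off outside \<open>V\<close>, as
    \<open>sum_avg_squares_le\<close> is about functions supported on the group.\<close>
  define f' where "f' = (\<lambda>v. if v \<in> V then f v else 0)"
  interpret A: comm_group ?A by (rule V_comm_group)
  have U_V: "?U h \<subseteq> V" if "h \<in> H" for h
    using HG_in_V H_inv(1)[OF that] by blast
  have U: "subgroup (?U h) ?A" if "h \<in> H" for h
    by (rule add.subgroup_incl[OF dilate_asub[OF that] V_asub U_V[OF that]])
  have le: "(\<Sum>h\<in>H. \<Sum>v\<in>carrier ?A. (avg ?A (?U h) f' v)\<^sup>2) \<le> real (p ^ m) * (\<Sum>v\<in>carrier ?A. (f' v)\<^sup>2)"
  proof (rule A.sum_avg_squares_le)
    fix J assume J: "J \<subseteq> H" "p ^ m < card J"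
    have Uc: "(\<Union>h\<in>J. ?U h) \<subseteq> carrier ?A" using U_V J by auto
    have "asub (generate ?A (\<Union>h\<in>J. ?U h))"
      by (rule add.incl_subgroup[OF V_asub A.generate_is_subgroup[OF Uc]])
    moreover have "inv h \<otimes> g \<in> generate ?A (\<Union>h\<in>J. ?U h)" if "h \<in> J" "g \<in> G" for h g
      by (rule generate.incl) (use that in blast)
    ultimately have "V \<subseteq> generate ?A (\<Union>h\<in>J. ?U h)" by (rule dilates_generate[OF J])
    then show "carrier ?A \<subseteq> generate ?A (\<Union>h\<in>J. ?U h)" by simp
  qed (use U assms V_finite H_finite in \<open>auto simp: f'_def\<close>)
  have eq: "avg ?A (?U h) f' v = left_mean f h (h \<otimes> v)" if h: "h \<in> H" and v: "v \<in> V" for h v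
  proof -
    have hc: "h \<in> carrier F" "inv h \<in> carrier F" "inv h \<otimes> h = \<one>" using h H_carrier H_inv[OF h] by auto
    have inj: "inj_on (\<lambda>g. inv h \<otimes> g) G"
      using m_lcancel[of "inv h"] H_carrier[OF H_inv(1)[OF h]] G_subset by (auto intro!: inj_onI)
    have "(\<Sum>u\<in>?U h. f' (v \<oplus> u)) = (\<Sum>g\<in>G. f (inv h \<otimes> (h \<otimes> v \<oplus> g)))"
      unfolding sum.reindex[OF inj]
    proof (rule sum.cong)
      fix g assume g: "g \<in> G"
      have "inv h \<otimes> (h \<otimes> v \<oplus> g) = v \<oplus> inv h \<otimes> g"
        using hc g G_subset V_carrier[OF v] by (auto simp: r_distr subset_iff simp flip: m_assoc)
      moreover have "v \<oplus> inv h \<otimes> g \<in> V" using U_V[OF h] g v V_closed(3) by blast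
      ultimately show "((\<lambda>u. f' (v \<oplus> u)) \<circ> (\<otimes>) (inv h)) g = f (inv h \<otimes> (h \<otimes> v \<oplus> g))"
        by (simp add: f'_def)
    qed simp
    then show ?thesis using v by (simp add: avg_def left_mean_def card_image[OF inj])
  qed
  have "(\<Sum>h\<in>H. \<Sum>v\<in>V. (left_mean f h v)\<^sup>2) = (\<Sum>h\<in>H. \<Sum>v\<in>V. (left_mean f h (h \<otimes> v))\<^sup>2)"
  proof (rule sum.cong)
    fix h assume h: "h \<in> H"
    show "(\<Sum>v\<in>V. (left_mean f h v)\<^sup>2) = (\<Sum>v\<in>V. (left_mean f h (h \<otimes> v))\<^sup>2)"
      by (rule sum_dilate'[OF h, symmetric])
  qed simp
  also have "\<dots> = (\<Sum>h\<in>H. \<Sum>v\<in>V. (avg ?A (?U h) f' v)\<^sup>2)"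
    by (intro sum.cong refl) (simp only: eq)
  also have "\<dots> \<le> real (p ^ m) * (\<Sum>v\<in>V. (f v)\<^sup>2)"
    using le by (simp add: f'_def)
  finally show ?thesis .
qed

end

section \<open>The code as a Tanner code\<close>

context finite_field begin

lemma polys_mult_X:
  assumes "r \<in> polys k"
  shows "up_ring.monom (UP F) \<one> 1 \<otimes>\<^bsub>UP F\<^esub> r \<in> polys (Suc k)"
proof (cases k)
  case 0
  then have "r = \<zero>\<^bsub>UP F\<^esub>" using assms by (auto simp: polys_def intro!: U.up_eqI)
  then show ?thesis by simp
next
  case (Suc l)
  then show ?thesis using polys_mult[of "up_ring.monom (UP F) \<one> 1" 1 r l] assms
    by (simp add: polys_monom)
qed

text \<open>The explicit remainder \<open>r\<close> records that the product is monic of degree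
  \<open>card S\<close>, so that it can be compared with \<open>X ^ (p ^ m) - X\<close> when
  \<open>S\<close> is \<open>G\<close>.\<close>

lemma linear_factor_product:
  assumes "finite S" "S \<subseteq> carrier F"
  defines "lin \<equiv> \<lambda>S. \<Otimes>\<^bsub>UP F\<^esub>a \<in> S. up_ring.monom (UP F) \<one> 1 \<ominus>\<^bsub>UP F\<^esub> up_ring.monom (UP F) a 0"
  shows "lin S \<in> carrier (UP F) \<and> (\<exists>r\<in>polys (card S). lin S = up_ring.monom (UP F) \<one> (card S) \<oplus>\<^bsub>UP F\<^esub> r)
    \<and> (\<forall>x\<in>carrier F. ev (lin S) x = \<zero> \<longleftrightarrow> x \<in> S)"
  using assms(1,2)
proof (induction S rule: finite_induct)
  case empty
  have "lin {} = \<one>\<^bsub>UP F\<^esub>" by (simp add: lin_def)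
  moreover have "\<exists>r\<in>polys (card {}). \<one>\<^bsub>UP F\<^esub> = up_ring.monom (UP F) \<one> (card {}) \<oplus>\<^bsub>UP F\<^esub> r"
    by (intro bexI[of _ "\<zero>\<^bsub>UP F\<^esub>"]) auto
  moreover have "ev \<one>\<^bsub>UP F\<^esub> x \<noteq> \<zero>" if "x \<in> carrier F" for x
    unfolding U.evalRR_one[OF that] by simp
  ultimately show ?case using U.UP_one_closed by (metis empty_iff)
next
  case (insert a S)
  let ?k = "card S"
  define X where "X = up_ring.monom (UP F) \<one> 1"
  define Y where "Y = up_ring.monom (UP F) \<one> ?k"
  define c where "c = up_ring.monom (UP F) a 0"
  have a: "a \<in> carrier F" using insert by simp
  obtain r where r: "r \<in> polys ?k" and linS: "lin S = Y \<oplus>\<^bsub>UP F\<^esub> r" and linc: "lin S \<in> carrier (UP F)"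
    and roots: "\<forall>x\<in>carrier F. ev (lin S) x = \<zero> \<longleftrightarrow> x \<in> S"
    using insert.IH insert.prems unfolding Y_def by blast
  have cs: "X \<in> carrier (UP F)" "Y \<in> carrier (UP F)" "c \<in> carrier (UP F)" "r \<in> carrier (UP F)"
    using a r by (auto simp: X_def Y_def c_def intro: polysD)
  have ins: "lin (insert a S) = (X \<ominus>\<^bsub>UP F\<^esub> c) \<otimes>\<^bsub>UP F\<^esub> lin S"
    unfolding lin_def X_def c_def by (subst U.P.finprod_insert) (use insert a in auto)
  have eq1: "lin (insert a S) = X \<otimes>\<^bsub>UP F\<^esub> Y \<oplus>\<^bsub>UP F\<^esub> (X \<otimes>\<^bsub>UP F\<^esub> r \<ominus>\<^bsub>UP F\<^esub> c \<otimes>\<^bsub>UP F\<^esub> Y \<ominus>\<^bsub>UP F\<^esub> c \<otimes>\<^bsub>UP F\<^esub> r)"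
    unfolding ins linS using cs by algebra
  have eq2: "X \<otimes>\<^bsub>UP F\<^esub> Y = up_ring.monom (UP F) \<one> (card (insert a S))"
    using insert(1,2) U.monom_one_mult[of 1 ?k] by (simp add: X_def Y_def)
  have mem: "X \<otimes>\<^bsub>UP F\<^esub> r \<ominus>\<^bsub>UP F\<^esub> c \<otimes>\<^bsub>UP F\<^esub> Y \<ominus>\<^bsub>UP F\<^esub> c \<otimes>\<^bsub>UP F\<^esub> r \<in> polys (card (insert a S))"
  proof -
    have "c \<in> polys (Suc 0)" unfolding c_def by (rule polys_monom[OF a]) simp
    moreover have "Y \<in> polys (Suc ?k)" unfolding Y_def by (rule polys_monom) auto
    moreover have "r \<in> polys (Suc ?k)" using r polys_mono[of ?k "Suc ?k"] by (meson le_SucI order_refl subsetD)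
    ultimately have "c \<otimes>\<^bsub>UP F\<^esub> Y \<in> polys (Suc ?k)" "c \<otimes>\<^bsub>UP F\<^esub> r \<in> polys (Suc ?k)"
      using polys_mult[of c 0 _ ?k] by auto
    then show ?thesis using polys_mult_X[OF r] insert(1,2) by (auto simp: X_def)
  qed
  have "\<exists>r\<in>polys (card (insert a S)). lin (insert a S) = up_ring.monom (UP F) \<one> (card (insert a S)) \<oplus>\<^bsub>UP F\<^esub> r"
    using eq1 mem unfolding eq2 by blast
  moreover have "\<forall>x\<in>carrier F. ev (lin (insert a S)) x = \<zero> \<longleftrightarrow> x \<in> insert a S"
  proof
    fix x assume x: "x \<in> carrier F"
    have "ev (lin (insert a S)) x = (x \<ominus> a) \<otimes> ev (lin S) x"
      unfolding ins using x a cs linc by (simp add: U.evalRR_mult U.evalRR_sub) (simp add: X_def c_def U.evalRR_monom)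
    then show "ev (lin (insert a S)) x = \<zero> \<longleftrightarrow> x \<in> insert a S"
      using roots x a linc integral_iff[of "x \<ominus> a" "ev (lin S) x"] by simp
  qed
  moreover have "lin (insert a S) \<in> carrier (UP F)" unfolding ins using cs linc by simp
  ultimately show ?case by blast
qed

end

section \<open>Fibres of \<open>g\<close> and \<open>h\<close>\<close>

context expander_setting begin

lemma pm_gt_1: "1 < p ^ m"
  using one_less_power[OF p_gt_1, of m] m by simp

text \<open>The product over \<open>G\<close> and \<open>X ^ (p ^ m) - X\<close> are both monic of
  degree \<open>p ^ m\<close>, so their difference has smaller degree; it vanishes at the
  \<open>p ^ m\<close> elements of \<open>G\<close>.\<close>

lemma poly_g_form_and_roots:
  "poly_g F G = up_ring.monom (UP F) \<one> (p ^ m) \<ominus>\<^bsub>UP F\<^esub> up_ring.monom (UP F) \<one> 1"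
  "x \<in> carrier F \<Longrightarrow> ev (poly_g F G) x = \<zero> \<longleftrightarrow> x \<in> G"
proof -
  let ?X = "up_ring.monom (UP F) \<one> 1" and ?Y = "up_ring.monom (UP F) \<one> (p ^ m)"
  have fG: "finite G" using G_subset finite_carrier finite_subset by blast
  obtain r where r: "r \<in> polys (p ^ m)" and g: "poly_g F G = ?Y \<oplus>\<^bsub>UP F\<^esub> r"
    and roots: "\<forall>x\<in>carrier F. ev (poly_g F G) x = \<zero> \<longleftrightarrow> x \<in> G"
    using linear_factor_product[OF fG G_subset] by (auto simp: poly_g_def G(2))
  show "x \<in> carrier F \<Longrightarrow> ev (poly_g F G) x = \<zero> \<longleftrightarrow> x \<in> G" using roots by blast
  have rc: "r \<in> carrier (UP F)" using r by (rule polysD)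
  have "r \<oplus>\<^bsub>UP F\<^esub> ?X = \<zero>\<^bsub>UP F\<^esub>"
  proof (rule polys_eq_zero[where k = "p ^ m" and S = G])
    show "r \<oplus>\<^bsub>UP F\<^esub> ?X \<in> polys (p ^ m)" using r pm_gt_1 by (intro polys_add polys_monom) auto
    fix x assume x: "x \<in> G"
    have xc: "x \<in> carrier F" using x G_subset by blast
    have "ev (poly_g F G) x = \<zero>" using roots x xc by blast
    moreover have "ev (poly_g F G) x = x [^] (p ^ m) \<oplus> ev r x"
      using xc rc by (simp add: g U.evalRR_add U.evalRR_monom)
    moreover have "x [^] (p ^ m) = x" using subfield_pow_card[OF G(1) x] by (simp add: G(2))
    moreover have "ev (r \<oplus>\<^bsub>UP F\<^esub> ?X) x = ev r x \<oplus> x"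
      using xc rc by (simp add: U.evalRR_add U.evalRR_monom)
    moreover have "ev r x \<oplus> x = x \<oplus> ev r x" using xc rc by (intro a_comm) auto
    ultimately show "ev (r \<oplus>\<^bsub>UP F\<^esub> ?X) x = \<zero>" by metis
  qed (use G_subset G(2) in auto)
  then have "r = \<ominus>\<^bsub>UP F\<^esub> ?X" using rc U.P.minus_equality by fastforce
  then show "poly_g F G = ?Y \<ominus>\<^bsub>UP F\<^esub> ?X" using g by (simp add: U.P.minus_eq)
qed

lemma poly_g_closed: "poly_g F G \<in> carrier (UP F)"
  by (simp add: poly_g_form_and_roots(1))

lemma deg_poly_g: "deg F (poly_g F G) = p ^ m"
  using pm_gt_1 unfolding poly_g_form_and_roots(1) by (subst U.deg_minus_eq) auto

lemma ev_poly_g: "x \<in> carrier F \<Longrightarrow> ev (poly_g F G) x = x [^] (p ^ m) \<ominus> x"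
  by (simp add: poly_g_form_and_roots(1) U.evalRR_sub U.evalRR_monom)

text \<open>\<open>g\<close> is additive because the Frobenius map is. Its fibres are therefore
  cosets of its kernel \<open>G\<close>.\<close>

lemma ev_poly_g_diff:
  assumes "x \<in> carrier F" "y \<in> carrier F"
  shows "ev (poly_g F G) (x \<ominus> y) = ev (poly_g F G) x \<ominus> ev (poly_g F G) y"
proof -
  have "x [^] (p ^ m) \<in> carrier F" "y [^] (p ^ m) \<in> carrier F" using assms by auto
  then show ?thesis using assms unfolding ev_poly_g[OF assms(1)] ev_poly_g[OF assms(2)]
      ev_poly_g[OF minus_closed[OF assms]] frobenius_diff[OF assms] by algebra
qed

lemma ev_poly_g_eq_iff:
  assumes "x \<in> carrier F" "y \<in> carrier F"
  shows "ev (poly_g F G) x = ev (poly_g F G) y \<longleftrightarrow> x \<ominus> y \<in> G"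
  using poly_g_form_and_roots(2)[OF minus_closed[OF assms]] assms poly_g_closed by (simp add: ev_poly_g_diff)

lemma poly_h_closed: "poly_h F H \<in> carrier (UP F)"
  by (simp add: poly_h_def)

lemma deg_poly_h: "deg F (poly_h F H) = card H"
  by (simp add: poly_h_def)

lemma ev_poly_h: "x \<in> carrier F \<Longrightarrow> ev (poly_h F H) x = x [^] card H"
  by (simp add: poly_h_def U.evalRR_monom)

lemma H_card_pos: "0 < card H"
  using H(2) by simp

text \<open>The elements of \<open>H\<close> already exhaust the number of roots allowed by the
  degree. Hence the fibres of \<open>h\<close> away from zero are the cosets of
  \<open>H\<close>.\<close>

lemma H_eq_roots: "H = {x \<in> carrier F. x [^] card H = \<one>}"
proof (rule card_seteq)
  show "finite {x \<in> carrier F. x [^] card H = \<one>}" using finite_carrier by simp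
  show "card {x \<in> carrier F. x [^] card H = \<one>} \<le> card H"
    using num_roots_le_deg[OF finite_carrier] H_card_pos by simp
  show "H \<subseteq> {x \<in> carrier F. x [^] card H = \<one>}"
  proof
    fix h assume h: "h \<in> H"
    interpret M: Group.group "(mult_of F)\<lparr>carrier := H\<rparr>"
      using Group.group.subgroup_imp_group[OF field_mult_group H_subgroup] .
    have "h [^]\<^bsub>(mult_of F)\<lparr>carrier := H\<rparr>\<^esub> card H = \<one>"
      using M.pow_order_eq_1[of h] h by (simp add: Coset.order_def)
    then have "h [^] card H = \<one>" by (simp add: nat_pow_def)
    then show "h \<in> {x \<in> carrier F. x [^] card H = \<one>}" using H_carrier[OF h] by simp
  qed
qed

lemma ev_poly_h_eq_iff:
  assumes x: "x \<in> carrier F" and y: "y \<in> carrier F - {\<zero>}"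
  shows "ev (poly_h F H) x = ev (poly_h F H) y \<longleftrightarrow> x \<otimes> inv y \<in> H"
proof -
  have iy: "inv y \<in> carrier F - {\<zero>}" "y \<otimes> inv y = \<one>" using inv_nonzero[OF y] y by (auto simp: field_Units)
  have "x \<otimes> inv y \<in> H \<longleftrightarrow> (x \<otimes> inv y) [^] card H = \<one>" using H_eq_roots x iy by blast
  also have "\<dots> \<longleftrightarrow> x [^] card H \<otimes> (inv y) [^] card H = y [^] card H \<otimes> (inv y) [^] card H"
    using x y iy by (simp flip: nat_pow_distrib)
  also have "\<dots> \<longleftrightarrow> x [^] card H = y [^] card H"
  proof -
    have "(inv y) [^] card H \<noteq> \<zero>"
      using iy y nat_pow_distrib[of y "inv y" "card H"] by (metis Diff_iff nat_pow_closed nat_pow_one r_null zero_not_one)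
    then show ?thesis using x y iy by (simp add: m_rcancel)
  qed
  finally show ?thesis using x y by (simp add: ev_poly_h)
qed

end

section \<open>Base degrees as degrees on orbits\<close>

context evaluation_setting begin

lemma left_fiber:
  assumes \<beta>: "\<beta> \<in> \<Omega>"
  shows "{x \<in> \<Omega>. ev (poly_g F G) x = ev (poly_g F G) \<beta>} = (\<lambda>g. \<beta> \<oplus> g) ` G"
proof (intro equalityI subsetI)
  fix x assume x: "x \<in> {x \<in> \<Omega>. ev (poly_g F G) x = ev (poly_g F G) \<beta>}"
  have c: "x \<in> carrier F" "\<beta> \<in> carrier F" using x \<beta> \<Omega>_carrier by auto
  then have "x \<ominus> \<beta> \<in> G" using x ev_poly_g_eq_iff by blast
  moreover have "x = \<beta> \<oplus> (x \<ominus> \<beta>)" using c by algebra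
  ultimately show "x \<in> (\<lambda>g. \<beta> \<oplus> g) ` G" by blast
next
  fix x assume "x \<in> (\<lambda>g. \<beta> \<oplus> g) ` G"
  then obtain g where g: "g \<in> G" "x = \<beta> \<oplus> g" by blast
  have c: "g \<in> carrier F" "\<beta> \<in> carrier F" using g \<beta> \<Omega>_carrier G_subset by auto
  then have "x \<ominus> \<beta> = g" unfolding g(2) by algebra
  then show "x \<in> {x \<in> \<Omega>. ev (poly_g F G) x = ev (poly_g F G) \<beta>}"
    using translate_in_\<Omega>[OF \<beta> g(1)] g c ev_poly_g_eq_iff[of x \<beta>] by simp
qed

lemma right_fiber:
  assumes \<beta>: "\<beta> \<in> \<Omega>"
  shows "{x \<in> \<Omega>. ev (poly_h F H) x = ev (poly_h F H) \<beta>} = (\<lambda>h. h \<otimes> \<beta>) ` H"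
proof -
  have b: "\<beta> \<in> carrier F - {\<zero>}" using \<beta> \<Omega>_carrier zero_notin_\<Omega> by auto
  have ib: "inv \<beta> \<in> carrier F" "\<beta> \<otimes> inv \<beta> = \<one>" "inv \<beta> \<otimes> \<beta> = \<one>"
    using inv_nonzero[OF b] b by (auto simp: field_Units)
  show ?thesis
  proof (intro equalityI subsetI)
    fix x assume x: "x \<in> {x \<in> \<Omega>. ev (poly_h F H) x = ev (poly_h F H) \<beta>}"
    have c: "x \<in> carrier F" using x \<Omega>_carrier by auto
    then have "x \<otimes> inv \<beta> \<in> H" using x ev_poly_h_eq_iff[OF c b] by blast
    moreover have "x = (x \<otimes> inv \<beta>) \<otimes> \<beta>" using c b ib by (simp add: m_assoc)
    ultimately show "x \<in> (\<lambda>h. h \<otimes> \<beta>) ` H" by blast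
  next
    fix x assume "x \<in> (\<lambda>h. h \<otimes> \<beta>) ` H"
    then obtain h where h: "h \<in> H" "x = h \<otimes> \<beta>" by blast
    then have "x \<otimes> inv \<beta> = h" using H_carrier b ib by (simp add: m_assoc)
    then show "x \<in> {x \<in> \<Omega>. ev (poly_h F H) x = ev (poly_h F H) \<beta>}"
      using scale_in_\<Omega>[OF \<beta> h(1)] h ev_poly_h_eq_iff[of x, OF _ b] \<Omega>_carrier by auto
  qed
qed

lemma left_orbits_fibers:
  "left_orbits F G H \<alpha> = (\<lambda>y. {x \<in> \<Omega>. ev (poly_g F G) x = y}) ` ev (poly_g F G) ` \<Omega>"
  unfolding left_orbits_eq image_image by (intro image_cong refl) (simp only: left_fiber)

lemma right_orbits_fibers:
  "right_orbits F G H \<alpha> = (\<lambda>y. {x \<in> \<Omega>. ev (poly_h F H) x = y}) ` ev (poly_h F H) ` \<Omega>"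
  unfolding right_orbits_eq image_image by (intro image_cong refl) (simp only: right_fiber)

lemma base_deg_g_iff:
  assumes "f \<in> polys (card \<Omega>)"
  shows "base_deg F (poly_g F G) f < ereal t \<longleftrightarrow> (\<forall>S\<in>left_orbits F G H \<alpha>. eval_word F S f \<in> RS_code F S t)"
proof -
  have *: "base_deg F (poly_g F G) f < ereal t \<longleftrightarrow> (\<forall>y\<in>ev (poly_g F G) ` \<Omega>.
      eval_word F {x \<in> \<Omega>. ev (poly_g F G) x = y} f \<in> RS_code F {x \<in> \<Omega>. ev (poly_g F G) x = y} t)"
    by (rule base_deg_less_iff_local[OF poly_g_closed deg_poly_g _ \<Omega>_carrier _ assms])
      (use left_fiber card_left_orbit G(2) pm_gt_1 in auto)
  show ?thesis unfolding * left_orbits_fibers by (simp only: ball_simps)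
qed

lemma base_deg_h_iff:
  assumes "f \<in> polys (card \<Omega>)"
  shows "base_deg F (poly_h F H) f < ereal t \<longleftrightarrow> (\<forall>S\<in>right_orbits F G H \<alpha>. eval_word F S f \<in> RS_code F S t)"
proof -
  have *: "base_deg F (poly_h F H) f < ereal t \<longleftrightarrow> (\<forall>y\<in>ev (poly_h F H) ` \<Omega>.
      eval_word F {x \<in> \<Omega>. ev (poly_h F H) x = y} f \<in> RS_code F {x \<in> \<Omega>. ev (poly_h F H) x = y} t)"
    by (rule base_deg_less_iff_local[OF poly_h_closed deg_poly_h _ \<Omega>_carrier _ assms])
      (use right_fiber card_right_orbit H_card_pos in auto)
  show ?thesis unfolding * right_orbits_fibers by (simp only: ball_simps)
qed

lemma orbits_subset: "S \<in> left_orbits F G H \<alpha> \<Longrightarrow> S \<subseteq> \<Omega>" "S \<in> right_orbits F G H \<alpha> \<Longrightarrow> S \<subseteq> \<Omega>"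
  by (auto simp: left_orbits_fibers right_orbits_fibers)

definition msgs :: "real \<Rightarrow> (nat \<Rightarrow> 'a) set" where
  "msgs r = {f \<in> polys (card \<Omega>).
     (\<forall>S\<in>left_orbits F G H \<alpha>. eval_word F S f \<in> RS_code F S (r * real (card G))) \<and>
     (\<forall>S\<in>right_orbits F G H \<alpha>. eval_word F S f \<in> RS_code F S (r * real (card H)))}"

lemma msg_space_eq: "msg_space F G H r (int (Coset.order A)) = msgs r"
proof -
  have "f \<in> carrier (UP F) \<and> up_deg F f < ereal (real_of_int (int (Coset.order A))) \<longleftrightarrow> f \<in> polys (card \<Omega>)" for f
    using up_deg_less_iff[of f "real (card \<Omega>)"] polysD by (auto simp: card_\<Omega>)
  then show ?thesis unfolding msg_space_def msgs_def using base_deg_g_iff base_deg_h_iff by blast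
qed

lemma eval_code_eq: "eval_code F G H \<alpha> r (int (Coset.order A)) = eval_word F \<Omega> ` msgs r"
  by (simp add: eval_code_def msg_space_eq)

lemma eval_word_restrict: "S \<subseteq> \<Omega> \<Longrightarrow> restrict (eval_word F \<Omega> f) S = eval_word F S f"
  by (auto simp: eval_word_def fun_eq_iff)

text \<open>For \<open>D = n\<close> interpolation makes every word on \<open>\<Omega>\<close> the
  evaluation of a polynomial of degree below \<open>D\<close>, so the two base degree conditions,
  which are conditions on orbits, alone cut out the code.\<close>

lemma eval_code_eq_tanner: "eval_code F G H \<alpha> r (int (Coset.order A)) = tanner_code F G H \<alpha> r"
proof -
  have "eval_word F \<Omega> ` msgs r = {c \<in> eval_word F \<Omega> ` polys (card \<Omega>).
     (\<forall>S\<in>left_orbits F G H \<alpha>. restrict c S \<in> RS_code F S (r * real (card G))) \<and>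
     (\<forall>S\<in>right_orbits F G H \<alpha>. restrict c S \<in> RS_code F S (r * real (card H)))}"
    by (auto simp: msgs_def eval_word_restrict orbits_subset)
  also have "\<dots> = tanner_code F G H \<alpha> r"
    unfolding interpolation[OF \<Omega>_carrier] tanner_code_def ..
  finally show ?thesis by (simp add: eval_code_eq)
qed

end

section \<open>Mixing estimate and supports of codewords\<close>

context expander_setting begin

lemma sum_translate_V:
  assumes "w \<in> V"
  shows "(\<Sum>v\<in>V. f (v \<oplus> w)) = (\<Sum>v\<in>V. (f v :: real))"
proof (rule sum.reindex_bij_witness[where i = "\<lambda>v. v \<ominus> w" and j = "\<lambda>v. v \<oplus> w"])
  fix v assume v: "v \<in> V"
  have c: "v \<in> carrier F" "w \<in> carrier F" using v assms V_carrier by auto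
  show "v \<oplus> w \<ominus> w = v" "v \<ominus> w \<oplus> w = v" using c by algebra+
  show "v \<ominus> w \<in> V" "v \<oplus> w \<in> V" using v assms V_closed by auto
qed simp

text \<open>Averaging over translations by \<open>G\<close> is self-adjoint and fixes the invariant
  factor \<open>a\<close>.\<close>

lemma sum_left_mean:
  assumes inv: "\<And>v g. v \<in> V \<Longrightarrow> g \<in> G \<Longrightarrow> a (v \<oplus> g) = (a v :: real)" and h: "h \<in> H"
  shows "(\<Sum>v\<in>V. a v * left_mean f h v) = (\<Sum>v\<in>V. a v * f (inv h \<otimes> v))"
proof -
  have "card G \<noteq> 0" using G(2) p_gt_1 by simp
  have "(\<Sum>v\<in>V. a v * left_mean f h v) = (\<Sum>v\<in>V. \<Sum>g\<in>G. a (v \<oplus> g) * f (inv h \<otimes> (v \<oplus> g))) / real (card G)"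
    unfolding left_mean_def by (simp add: inv sum_distrib_left sum_divide_distrib)
  also have "\<dots> = (\<Sum>g\<in>G. \<Sum>v\<in>V. a (v \<oplus> g) * f (inv h \<otimes> (v \<oplus> g))) / real (card G)"
    by (subst sum.swap) simp
  also have "(\<Sum>g\<in>G. \<Sum>v\<in>V. a (v \<oplus> g) * f (inv h \<otimes> (v \<oplus> g))) = (\<Sum>g\<in>G. \<Sum>v\<in>V. a v * f (inv h \<otimes> v))"
    using G_subset_V by (intro sum.cong refl sum_translate_V) auto
  finally show ?thesis using \<open>card G \<noteq> 0\<close> by simp
qed

text \<open>Here \<open>a\<close> indicates a set of left vertices, lifted to pairs
  \<open>(h, v)\<close>, and \<open>b\<close> a set of right vertices; the left side counts the
  edges between them. The mean of \<open>b\<close> gives the main term. The rest has mean zero and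
  norm at most that of \<open>b\<close>, so Cauchy-Schwarz and \<open>left_mean_squares_le\<close>
  give the error term.\<close>

lemma mixing:
  fixes a :: "'a \<Rightarrow> 'a \<Rightarrow> real" and b :: "'a \<Rightarrow> real"
  assumes inv: "\<And>h v g. h \<in> H \<Longrightarrow> v \<in> V \<Longrightarrow> g \<in> G \<Longrightarrow> a h (v \<oplus> g) = a h v"
    and a: "\<And>h v. a h v \<in> {0, 1}" and b: "\<And>w. b w \<in> {0, 1}"
  shows "(\<Sum>h\<in>H. \<Sum>v\<in>V. a h v * b (inv h \<otimes> v))
    \<le> (\<Sum>h\<in>H. \<Sum>v\<in>V. a h v) * (\<Sum>w\<in>V. b w) / real (card V)
      + sqrt (real (p ^ m) * (\<Sum>h\<in>H. \<Sum>v\<in>V. a h v) * (\<Sum>w\<in>V. b w))"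
proof -
  define \<mu> where "\<mu> = (\<Sum>w\<in>V. b w) / real (card V)"
  define c where "c = (\<lambda>w. b w - \<mu>)"
  have V0: "card V \<noteq> 0" using card_V p_gt_1 by simp
  have asq: "(a h v)\<^sup>2 = a h v" "0 \<le> a h v" for h v using a[of h v] by auto
  have bsq: "(b w)\<^sup>2 = b w" "0 \<le> b w" for w using b[of w] by auto
  have mean: "(\<Sum>w\<in>V. c w) = 0" using V0 by (simp add: c_def \<mu>_def sum_subtractf)
  have "(\<Sum>w\<in>V. (c w)\<^sup>2) = (\<Sum>w\<in>V. b w) - 2 * \<mu> * (\<Sum>w\<in>V. b w) + card V * \<mu>\<^sup>2"
    by (simp add: c_def power2_diff bsq sum.distrib sum_subtractf sum_distrib_left mult_ac)
  also have "\<dots> = (\<Sum>w\<in>V. b w) - card V * \<mu>\<^sup>2"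
    using V0 by (simp add: \<mu>_def power2_eq_square)
  finally have csq: "(\<Sum>w\<in>V. (c w)\<^sup>2) \<le> (\<Sum>w\<in>V. b w)" by simp
  have "(\<Sum>h\<in>H. \<Sum>v\<in>V. a h v * c (inv h \<otimes> v)) = (\<Sum>h\<in>H. \<Sum>v\<in>V. a h v * left_mean c h v)"
    using inv by (intro sum.cong refl sum_left_mean[symmetric]) auto
  also have "\<dots> = (\<Sum>(h, v)\<in>H \<times> V. a h v * left_mean c h v)"
    by (rule sum.cartesian_product)
  also have "\<dots> \<le> sqrt ((\<Sum>(h, v)\<in>H \<times> V. (a h v)\<^sup>2) * (\<Sum>(h, v)\<in>H \<times> V. (left_mean c h v)\<^sup>2))"
    using Cauchy_Schwarz_ineq_sum[of "\<lambda>(h, v). a h v" "\<lambda>(h, v). left_mean c h v" "H \<times> V"]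
    by (intro real_le_rsqrt) (simp add: case_prod_unfold)
  also have "(\<Sum>(h, v)\<in>H \<times> V. (a h v)\<^sup>2) = (\<Sum>h\<in>H. \<Sum>v\<in>V. a h v)"
    by (simp add: asq sum.cartesian_product)
  also have "(\<Sum>(h, v)\<in>H \<times> V. (left_mean c h v)\<^sup>2) = (\<Sum>h\<in>H. \<Sum>v\<in>V. (left_mean c h v)\<^sup>2)"
    by (simp add: sum.cartesian_product)
  also have "sqrt ((\<Sum>h\<in>H. \<Sum>v\<in>V. a h v) * (\<Sum>h\<in>H. \<Sum>v\<in>V. (left_mean c h v)\<^sup>2))
      \<le> sqrt ((\<Sum>h\<in>H. \<Sum>v\<in>V. a h v) * (real (p ^ m) * (\<Sum>w\<in>V. b w)))"
    using left_mean_squares_le[OF mean] csq asq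
    by (intro real_sqrt_le_mono mult_left_mono order_trans[OF left_mean_squares_le[OF mean]]) (auto intro!: sum_nonneg)
  finally have off: "(\<Sum>h\<in>H. \<Sum>v\<in>V. a h v * c (inv h \<otimes> v))
      \<le> sqrt (real (p ^ m) * (\<Sum>h\<in>H. \<Sum>v\<in>V. a h v) * (\<Sum>w\<in>V. b w))"
    by (simp add: mult_ac)
  have "(\<Sum>h\<in>H. \<Sum>v\<in>V. a h v * b (inv h \<otimes> v))
      = (\<Sum>h\<in>H. \<Sum>v\<in>V. a h v * \<mu> + a h v * c (inv h \<otimes> v))"
    by (simp add: c_def algebra_simps)
  also have "\<dots> = (\<Sum>h\<in>H. \<Sum>v\<in>V. a h v) * \<mu> + (\<Sum>h\<in>H. \<Sum>v\<in>V. a h v * c (inv h \<otimes> v))"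
    by (simp add: sum.distrib sum_distrib_right)
  finally show ?thesis using off by (simp add: \<mu>_def)
qed

text \<open>\<open>X\<close> is a set of edges of the coset graph, the edge \<open>(h, v)\<close> being the map \<open>x \<mapsto> h x + v\<close>. Its left ends number at most \<open>1 / s\<close>
  times \<open>card X / card G\<close> and its right ends at most \<open>1 / s\<close> times \<open>card X / card H\<close>, while by the mixing
  estimate few left and right ends span few edges.\<close>

lemma expanding_support:
  fixes X :: "('a \<times> 'a) set" and s :: real
  assumes X: "X \<subseteq> H \<times> V" "X \<noteq> {}" and s: "0 < s"
    and left: "\<And>h v. (h, v) \<in> X \<Longrightarrow> s * real (card G) \<le> real (card {g \<in> G. (h, v \<oplus> g) \<in> X})"
    and right: "\<And>h v. (h, v) \<in> X \<Longrightarrow> s * real (card H) \<le> real (card {k \<in> H. (k \<otimes> h, k \<otimes> v) \<in> X})"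
  shows "s\<^sup>2 - s * sqrt (real (p ^ m) / real (card H)) \<le> real (card X) / real (card H * card V)"
proof -
  \<comment> \<open>\<open>a\<close> and \<open>b\<close> indicate the left and right ends of edges
    in \<open>X\<close>; the edges at the right vertex \<open>w\<close> are the pairs
    \<open>(k, k \<otimes> w)\<close>. In the sums below a left vertex is counted
    \<open>card G\<close> times, a right vertex once.\<close>
  define a :: "'a \<Rightarrow> 'a \<Rightarrow> real" where "a = (\<lambda>h v. if \<exists>g\<in>G. (h, v \<oplus> g) \<in> X then 1 else 0)"
  define b :: "'a \<Rightarrow> real" where "b = (\<lambda>w. if \<exists>k\<in>H. (k, k \<otimes> w) \<in> X then 1 else 0)"
  define \<chi> :: "'a \<Rightarrow> 'a \<Rightarrow> real" where "\<chi> = (\<lambda>h v. if (h, v) \<in> X then 1 else 0)"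
  note Gd = asubD[OF subfield_asub[OF G(1)]]
  have finX: "finite X" using X finite_subset H_finite V_finite by blast
  have cG: "0 < card G" using G(2) p_gt_1 by simp
  have cH: "0 < card H" using H(2) by simp
  have X\<chi>: "(\<Sum>h\<in>H. \<Sum>v\<in>V. \<chi> h v) = card X"
  proof -
    have "(\<Sum>h\<in>H. \<Sum>v\<in>V. \<chi> h v) = (\<Sum>e\<in>H \<times> V. if e \<in> X then 1 else 0)"
      by (simp add: \<chi>_def sum.cartesian_product case_prod_unfold)
    also have "\<dots> = card ((H \<times> V) \<inter> X)"
      using H_finite V_finite by (simp add: sum.If_cases Int_def)
    also have "(H \<times> V) \<inter> X = X" using X by blast
    finally show ?thesis .
  qed
  have coset: "(\<exists>g'\<in>G. (h, v \<oplus> g \<oplus> g') \<in> X) \<longleftrightarrow> (\<exists>g'\<in>G. (h, v \<oplus> g') \<in> X)" if v: "v \<in> V" and g: "g \<in> G" for h v g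
  proof
    have c: "v \<in> carrier F" "g \<in> carrier F" using v g V_carrier G_subset by auto
    assume "\<exists>g'\<in>G. (h, v \<oplus> g \<oplus> g') \<in> X"
    then show "\<exists>g'\<in>G. (h, v \<oplus> g') \<in> X" using c Gd(1,3) g by (auto simp: a_assoc subset_iff)
  next
    have c: "v \<in> carrier F" "g \<in> carrier F" using v g V_carrier G_subset by auto
    assume "\<exists>g'\<in>G. (h, v \<oplus> g') \<in> X"
    then obtain g' where g': "g' \<in> G" "(h, v \<oplus> g') \<in> X" by blast
    have "g' \<in> carrier F" using g' G_subset by blast
    then have "v \<oplus> g \<oplus> (g' \<ominus> g) = v \<oplus> g'" using c by algebra
    then show "\<exists>g'\<in>G. (h, v \<oplus> g \<oplus> g') \<in> X" using g' g Gd(5) by metis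
  qed
  have inv: "a h (v \<oplus> g) = a h v" if "h \<in> H" "v \<in> V" "g \<in> G" for h v g
    using coset[OF that(2,3)] by (simp add: a_def)
  have sum_a: "(\<Sum>h\<in>H. \<Sum>v\<in>V. a h v) * s \<le> card X"
  proof -
    have loc: "a h v * (s * card G) \<le> (\<Sum>g\<in>G. \<chi> h (v \<oplus> g))" if h: "h \<in> H" and v: "v \<in> V" for h v
    proof (cases "\<exists>g\<in>G. (h, v \<oplus> g) \<in> X")
      case True
      then obtain g where g: "g \<in> G" "(h, v \<oplus> g) \<in> X" by blast
      have c: "v \<in> carrier F" "g \<in> carrier F" using v g V_carrier G_subset by auto
      have "s * real (card G) \<le> card {g' \<in> G. (h, v \<oplus> g \<oplus> g') \<in> X}" by (rule left[OF g(2)])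
      also have "real (card {g' \<in> G. (h, v \<oplus> g \<oplus> g') \<in> X}) = (\<Sum>g'\<in>G. \<chi> h (v \<oplus> g \<oplus> g'))"
        using asub_finite[OF subfield_asub[OF G(1)]] by (simp add: \<chi>_def sum.If_cases Int_def)
      also have "\<dots> = (\<Sum>g'\<in>G. \<chi> h (v \<oplus> g'))"
      proof (rule sum.reindex_bij_witness[where i = "\<lambda>x. x \<ominus> g" and j = "\<lambda>x. g \<oplus> x"])
        fix x assume x: "x \<in> G"
        then have xc: "x \<in> carrier F" using G_subset by blast
        show "g \<oplus> x \<ominus> g = x" "g \<oplus> (x \<ominus> g) = x" using c xc by algebra+
        show "x \<ominus> g \<in> G" "g \<oplus> x \<in> G" using x g Gd by auto
        show "\<chi> h (v \<oplus> (g \<oplus> x)) = \<chi> h (v \<oplus> g \<oplus> x)" using c xc by (simp add: a_assoc)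
      qed
      finally show ?thesis using True by (simp add: a_def)
    next
      case False
      then show ?thesis by (simp add: a_def \<chi>_def sum_nonneg)
    qed
    have "(\<Sum>h\<in>H. \<Sum>v\<in>V. a h v) * (s * card G) \<le> (\<Sum>h\<in>H. \<Sum>v\<in>V. \<Sum>g\<in>G. \<chi> h (v \<oplus> g))"
      unfolding sum_distrib_right by (intro sum_mono loc)
    also have "\<dots> = (\<Sum>h\<in>H. \<Sum>g\<in>G. \<Sum>v\<in>V. \<chi> h (v \<oplus> g))"
      by (intro sum.cong refl sum.swap)
    also have "\<dots> = (\<Sum>h\<in>H. \<Sum>g\<in>G. \<Sum>v\<in>V. \<chi> h v)"
      using G_subset_V by (intro sum.cong refl sum_translate_V) auto
    also have "\<dots> = (\<Sum>h\<in>H. \<Sum>v\<in>V. \<chi> h v) * card G"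
      by (simp add: sum_distrib_left mult.commute[of _ "real (card G)"])
    finally show ?thesis unfolding X\<chi> using cG by (simp add: mult.assoc[symmetric])
  qed
  have sum_b: "(\<Sum>w\<in>V. b w) * (s * card H) \<le> card X"
  proof -
    have loc: "b w * (s * card H) \<le> (\<Sum>k\<in>H. \<chi> k (k \<otimes> w))" if w: "w \<in> V" for w
    proof (cases "\<exists>k\<in>H. (k, k \<otimes> w) \<in> X")
      case True
      then obtain k where k: "k \<in> H" "(k, k \<otimes> w) \<in> X" by blast
      have kc: "k \<in> carrier F" "inv k \<in> carrier F" "inv k \<in> H" "inv k \<otimes> k = \<one>" "k \<otimes> inv k = \<one>"
        using k(1) H_carrier H_inv by auto
      have "s * real (card H) \<le> card {l \<in> H. (l \<otimes> k, l \<otimes> (k \<otimes> w)) \<in> X}" by (rule right[OF k(2)])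
      also have "real (card {l \<in> H. (l \<otimes> k, l \<otimes> (k \<otimes> w)) \<in> X}) = (\<Sum>l\<in>H. \<chi> (l \<otimes> k) (l \<otimes> (k \<otimes> w)))"
        using H_finite by (simp add: \<chi>_def sum.If_cases Int_def)
      also have "\<dots> = (\<Sum>l\<in>H. \<chi> l (l \<otimes> w))"
      proof (rule sum.reindex_bij_witness[where i = "\<lambda>x. x \<otimes> inv k" and j = "\<lambda>x. x \<otimes> k"])
        fix x assume x: "x \<in> H"
        then have xc: "x \<in> carrier F" using H_carrier by blast
        show "x \<otimes> k \<otimes> inv k = x" "x \<otimes> inv k \<otimes> k = x" using xc kc by (simp_all add: m_assoc)
        show "x \<otimes> inv k \<in> H" "x \<otimes> k \<in> H" using x k kc H_mult by auto
        show "\<chi> (x \<otimes> k) (x \<otimes> k \<otimes> w) = \<chi> (x \<otimes> k) (x \<otimes> (k \<otimes> w))"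
          using xc kc V_carrier[OF w] by (simp add: m_assoc)
      qed
      finally show ?thesis using True by (simp add: b_def)
    next
      case False
      then show ?thesis by (simp add: b_def \<chi>_def sum_nonneg)
    qed
    have "(\<Sum>w\<in>V. b w) * (s * card H) \<le> (\<Sum>w\<in>V. \<Sum>k\<in>H. \<chi> k (k \<otimes> w))"
      unfolding sum_distrib_right by (intro sum_mono loc)
    also have "\<dots> = (\<Sum>k\<in>H. \<Sum>w\<in>V. \<chi> k (k \<otimes> w))" by (rule sum.swap)
    also have "\<dots> = (\<Sum>k\<in>H. \<Sum>w\<in>V. \<chi> k w)"
      by (intro sum.cong refl sum_dilate')
    finally show ?thesis unfolding X\<chi> .
  qed
  have "card X \<le> (\<Sum>h\<in>H. \<Sum>v\<in>V. a h v * b (inv h \<otimes> v))"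
    unfolding X\<chi>[symmetric]
  proof (intro sum_mono)
    fix h v assume h: "h \<in> H" and v: "v \<in> V"
    have hc: "h \<in> carrier F" "inv h \<in> carrier F" "h \<otimes> inv h = \<one>" using h H_carrier H_inv by auto
    have "h \<otimes> (inv h \<otimes> v) = v" using hc V_carrier[OF v] by (simp flip: m_assoc)
    then have "b (inv h \<otimes> v) = 1" if "(h, v) \<in> X"
      using that h by (auto simp: b_def intro!: bexI[of _ h])
    moreover have "a h v = 1" if "(h, v) \<in> X"
      using that Gd(2) V_carrier[OF v] by (auto simp: a_def intro!: bexI[of _ \<zero>])
    ultimately show "\<chi> h v \<le> a h v * b (inv h \<otimes> v)" by (auto simp: \<chi>_def a_def b_def)
  qed
  also have "\<dots> \<le> (\<Sum>h\<in>H. \<Sum>v\<in>V. a h v) * (\<Sum>w\<in>V. b w) / real (card V)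
      + sqrt (real (p ^ m) * (\<Sum>h\<in>H. \<Sum>v\<in>V. a h v) * (\<Sum>w\<in>V. b w))"
    by (rule mixing[OF inv]) (auto simp: a_def b_def)
  finally have main: "card X \<le> (\<Sum>h\<in>H. \<Sum>v\<in>V. a h v) * (\<Sum>w\<in>V. b w) / real (card V)
      + sqrt (real (p ^ m) * (\<Sum>h\<in>H. \<Sum>v\<in>V. a h v) * (\<Sum>w\<in>V. b w))" .
  define x where "x = real (card X)"
  define P where "P = (\<Sum>h\<in>H. \<Sum>v\<in>V. a h v)"
  define Q where "Q = (\<Sum>w\<in>V. b w)"
  have x: "0 < x" using X finX by (simp add: x_def card_gt_0_iff)
  have P: "0 \<le> P" "P \<le> x / s" using sum_a s by (auto simp: P_def x_def a_def pos_le_divide_eq intro!: sum_nonneg)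
  have Q: "0 \<le> Q" "Q \<le> x / (s * card H)" using sum_b s cH by (auto simp: Q_def x_def b_def pos_le_divide_eq intro!: sum_nonneg)
  have PQ: "P * Q \<le> (x / s) * (x / (s * card H))" using P Q x s by (intro mult_mono) auto
  have "x \<le> P * Q / card V + sqrt (real (p ^ m) * (P * Q))"
    using main by (simp add: x_def P_def Q_def mult.assoc)
  also have "\<dots> \<le> (x / s) * (x / (s * card H)) / card V + sqrt (real (p ^ m) * ((x / s) * (x / (s * card H))))"
    using PQ by (intro add_mono divide_right_mono real_sqrt_le_mono mult_left_mono) auto
  also have "real (p ^ m) * ((x / s) * (x / (s * card H))) = (x / s)\<^sup>2 * (real (p ^ m) / card H)"
    by (simp add: power2_eq_square mult_ac)
  also have "sqrt \<dots> = (x / s) * sqrt (real (p ^ m) / card H)"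
    using x s by (subst real_sqrt_mult) simp
  finally have fin: "x \<le> (x / s) * (x / (s * card H)) / card V + (x / s) * sqrt (real (p ^ m) / card H)" .
  \<comment> \<open>\<open>y\<close> is the relative size of \<open>X\<close> and \<open>l\<close>
    the error from mixing. Cancelling \<open>x\<close> and multiplying by \<open>s\<^sup>2\<close>
    turns the estimate into \<open>s\<^sup>2 \<le> y + s * l\<close>.\<close>
  define y where "y = x / (real (card H) * real (card V))"
  define l where "l = sqrt (real (p ^ m) / card H)"
  have "(x / s) * (x / (s * card H)) / card V = x * (y / s\<^sup>2)"
    by (simp add: y_def power2_eq_square field_simps)
  then have "x * 1 \<le> x * (y / s\<^sup>2 + l / s)"
    using fin[folded l_def] by (simp add: distrib_left)
  then have "1 \<le> y / s\<^sup>2 + l / s" using x by (simp only: mult_le_cancel_left_pos)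
  then have "s\<^sup>2 * 1 \<le> s\<^sup>2 * (y / s\<^sup>2 + l / s)" using s by (intro mult_left_mono) auto
  also have "\<dots> = y + s * l" using s by (simp add: distrib_left power2_eq_square)
  finally show ?thesis by (simp add: y_def l_def x_def)
qed

end

section \<open>The coset graph\<close>

text \<open>A row of a matrix of intersection sizes, applied to a function \<open>Z\<close> of the
  classes, becomes a sum over the elements of \<open>S\<close>; \<open>c\<close> assigns to an
  element its class.\<close>

lemma sum_card_Int_partition:
  fixes Z :: "'a set \<Rightarrow> real"
  assumes X: "finite X" "\<Union> \<P> = X" and disj: "pairwise disjnt \<P>"
    and c: "\<And>P \<phi>. P \<in> \<P> \<Longrightarrow> \<phi> \<in> P \<Longrightarrow> c \<phi> = P" and S: "S \<subseteq> X"
  shows "(\<Sum>P\<in>\<P>. real (card (S \<inter> P)) * Z P) = (\<Sum>\<phi>\<in>S. Z (c \<phi>))"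
proof -
  have fin: "finite P" if "P \<in> \<P>" for P using that X by (metis Sup_upper finite_subset)
  have "(\<Sum>P\<in>\<P>. real (card (S \<inter> P)) * Z P) = (\<Sum>P\<in>\<P>. \<Sum>\<phi>\<in>P. if \<phi> \<in> S then Z (c \<phi>) else 0)"
  proof (rule sum.cong)
    fix P assume P: "P \<in> \<P>"
    have "(\<Sum>\<phi>\<in>P. if \<phi> \<in> S then Z (c \<phi>) else 0) = (\<Sum>\<phi>\<in>P. if \<phi> \<in> S then Z P else 0)"
      using c[OF P] by (intro sum.cong) auto
    also have "\<dots> = real (card (S \<inter> P)) * Z P"
      using fin[OF P] by (simp add: sum.If_cases Int_commute)
    finally show "real (card (S \<inter> P)) * Z P = (\<Sum>\<phi>\<in>P. if \<phi> \<in> S then Z (c \<phi>) else 0)" by simp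
  qed simp
  also have "\<dots> = (\<Sum>\<phi>\<in>\<Union> \<P>. if \<phi> \<in> S then Z (c \<phi>) else 0)"
    using fin disj by (intro sum.Union_disjoint_sets[symmetric, unfolded comp_def])
      (auto simp: disjoint_def pairwise_def disjnt_def)
  also have "\<dots> = (\<Sum>\<phi>\<in>S. Z (c \<phi>))"
    using X S by (simp add: sum.If_cases Int_absorb1)
  finally show ?thesis .
qed

context expander_setting begin

abbreviation T\<^sub>G :: "('a \<Rightarrow> 'a) set" where "T\<^sub>G \<equiv> translation_grp F G"
abbreviation S\<^sub>H :: "('a \<Rightarrow> 'a) set" where "S\<^sub>H \<equiv> scaling_grp F H"

lemma T_subgroup: "subgroup T\<^sub>G A"
proof -
  interpret A: Group.group A by (rule A_group)
  note Gd = asubD[OF subfield_asub[OF G(1)]]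
  have one: "\<one> \<in> carrier F - {\<zero>}" by simp
  have mult: "aff \<one> g \<otimes>\<^bsub>A\<^esub> aff \<one> g' = aff \<one> (g \<oplus> g')" if "g \<in> G" "g' \<in> G" for g g'
    using that G_subset by (auto simp: A_mult aff_mult subset_iff a_comm)
  show ?thesis
  proof (rule A.subgroupI)
    show "T\<^sub>G \<subseteq> carrier A" using one_H G_subset_V by (auto simp: translation_grp_def A_carrier)
    show "T\<^sub>G \<noteq> {}" using Gd(2) by (auto simp: translation_grp_def)
    fix x assume "x \<in> T\<^sub>G"
    then obtain g where g: "g \<in> G" "x = aff \<one> g" by (auto simp: translation_grp_def)
    have "g \<in> carrier F" using g G_subset by auto
    then have "aff \<one> (\<ominus> g) \<otimes>\<^bsub>A\<^esub> x = \<one>\<^bsub>A\<^esub>"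
      using mult[of "\<ominus> g" g] g Gd(4) by (simp add: A_one l_neg)
    then have "inv\<^bsub>A\<^esub> x = aff \<one> (\<ominus> g)"
      using g Gd(4) one_H G_subset_V by (intro A.inv_equality) (auto simp: A_carrier)
    then show "inv\<^bsub>A\<^esub> x \<in> T\<^sub>G" using g Gd(4) by (auto simp: translation_grp_def)
    fix y assume "y \<in> T\<^sub>G"
    then obtain g' where "g' \<in> G" "y = aff \<one> g'" by (auto simp: translation_grp_def)
    then show "x \<otimes>\<^bsub>A\<^esub> y \<in> T\<^sub>G" using g mult Gd(3) by (auto simp: translation_grp_def)
  qed
qed

lemma S_subgroup: "subgroup S\<^sub>H A"
proof -
  interpret A: Group.group A by (rule A_group)
  have mult: "aff h \<zero> \<otimes>\<^bsub>A\<^esub> aff k \<zero> = aff (h \<otimes> k) \<zero>" if "h \<in> H" "k \<in> H" for h k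
    using H_carrier[OF that(1)] H_carrier[OF that(2)] by (simp add: A_mult aff_mult)
  show ?thesis
  proof (rule A.subgroupI)
    show "S\<^sub>H \<subseteq> carrier A" using V_closed(2) by (auto simp: scaling_grp_def A_carrier)
    show "S\<^sub>H \<noteq> {}" using one_H by (auto simp: scaling_grp_def)
    fix x assume "x \<in> S\<^sub>H"
    then obtain h where h: "h \<in> H" "x = aff h \<zero>" by (auto simp: scaling_grp_def)
    have "aff (inv h) \<zero> \<otimes>\<^bsub>A\<^esub> x = \<one>\<^bsub>A\<^esub>"
      using mult[OF H_inv(1)[OF h(1)] h(1)] H_inv(2)[OF h(1)] h(2) by (simp add: A_one)
    then have "inv\<^bsub>A\<^esub> x = aff (inv h) \<zero>"
      using h H_inv(1)[OF h(1)] V_closed(2) by (intro A.inv_equality) (auto simp: A_carrier)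
    then show "inv\<^bsub>A\<^esub> x \<in> S\<^sub>H" using H_inv(1)[OF h(1)] by (auto simp: scaling_grp_def)
    fix y assume "y \<in> S\<^sub>H"
    then obtain k where "k \<in> H" "y = aff k \<zero>" by (auto simp: scaling_grp_def)
    then show "x \<otimes>\<^bsub>A\<^esub> y \<in> S\<^sub>H" using h mult H_mult by (auto simp: scaling_grp_def)
  qed
qed

lemma T_coset:
  assumes "h \<in> H" "v \<in> V"
  shows "T\<^sub>G #>\<^bsub>A\<^esub> aff h v = (\<lambda>g. aff h (v \<oplus> g)) ` G"
proof -
  have "aff \<one> g \<otimes>\<^bsub>A\<^esub> aff h v = aff h (v \<oplus> g)" if "g \<in> G" for g
    using H_carrier[OF assms(1)] V_carrier[OF assms(2)] that G_subset
    by (auto simp: A_mult aff_mult subset_iff)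
  then show ?thesis by (force simp: r_coset_def translation_grp_def)
qed

text \<open>\<open>aff h v\<close> is the translation by \<open>inv h \<otimes> v\<close> followed
  by the scaling by \<open>h\<close>. This labels the right vertices by the points of
  \<open>V\<close>.\<close>

lemma S_coset_eq:
  assumes h: "h \<in> H" and v: "v \<in> V"
  shows "S\<^sub>H #>\<^bsub>A\<^esub> aff h v = S\<^sub>H #>\<^bsub>A\<^esub> aff \<one> (inv h \<otimes> v)"
proof -
  interpret A: Group.group A by (rule A_group)
  have w: "inv h \<otimes> v \<in> V" using H_V H_inv(1)[OF h] v by blast
  have hc: "h \<in> carrier F - {\<zero>}" "inv h \<in> carrier F" "h \<otimes> inv h = \<one>"
    using h H_carrier H_inv by auto
  have "h \<otimes> (inv h \<otimes> v) = v" using hc V_carrier[OF v] by (simp flip: m_assoc)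
  then have e: "aff h \<zero> \<otimes>\<^bsub>A\<^esub> aff \<one> (inv h \<otimes> v) = aff h v"
    using hc V_carrier[OF w] V_carrier[OF v] by (simp add: A_mult aff_mult)
  have "aff h v \<in> S\<^sub>H #>\<^bsub>A\<^esub> aff \<one> (inv h \<otimes> v)"
    unfolding r_coset_def using e h by (force simp: scaling_grp_def)
  then show ?thesis
    using A.repr_independence[OF _ _ S_subgroup] w one_H by (metis (mono_tags, lifting) A_carrier mem_Collect_eq)
qed

lemma card_T: "card T\<^sub>G = card G"
proof -
  have "T\<^sub>G = aff \<one> ` G" by (auto simp: translation_grp_def)
  moreover have "inj_on (aff \<one>) G" using G_subset by (auto intro!: inj_onI dest!: aff_inj)
  ultimately show ?thesis by (simp add: card_image)
qed

lemma card_S: "card S\<^sub>H = card H"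
proof -
  have "S\<^sub>H = (\<lambda>h. aff h \<zero>) ` H" by (auto simp: scaling_grp_def)
  moreover have "inj_on (\<lambda>h. aff h \<zero>) H" using H_carrier by (auto intro!: inj_onI dest!: aff_inj)
  ultimately show ?thesis by (simp add: card_image)
qed

lemma A_finite: "finite (carrier A)"
  using bij_betw_finite[OF A_bij] H_finite V_finite by simp

lemma subgroup_cosets:
  assumes U: "subgroup U A"
  shows "\<Union> (rcosets\<^bsub>A\<^esub> U) = carrier A" "pairwise disjnt (rcosets\<^bsub>A\<^esub> U)" "finite (rcosets\<^bsub>A\<^esub> U)"
    and "\<And>P \<phi>. P \<in> rcosets\<^bsub>A\<^esub> U \<Longrightarrow> \<phi> \<in> P \<Longrightarrow> U #>\<^bsub>A\<^esub> \<phi> = P"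
    and "\<And>P. P \<in> rcosets\<^bsub>A\<^esub> U \<Longrightarrow> card P = card U"
    and "card (rcosets\<^bsub>A\<^esub> U) * card U = card H * p ^ (m * (m + 1))"
proof -
  interpret A: Group.group A by (rule A_group)
  show "\<Union> (rcosets\<^bsub>A\<^esub> U) = carrier A" by (rule A.rcosets_part_G[OF U])
  show "pairwise disjnt (rcosets\<^bsub>A\<^esub> U)" by (rule A.rcos_disjoint[OF U])
  show "finite (rcosets\<^bsub>A\<^esub> U)" using A_finite by (simp add: RCOSETS_def)
  show "U #>\<^bsub>A\<^esub> \<phi> = P" if P: "P \<in> rcosets\<^bsub>A\<^esub> U" "\<phi> \<in> P" for P \<phi>
  proof -
    obtain x where x: "x \<in> carrier A" "P = U #>\<^bsub>A\<^esub> x" using P(1) by (auto simp: RCOSETS_def)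
    show ?thesis using A.repr_independence[OF _ x(1) U, of \<phi>] P(2) x(2) by simp
  qed
  show "card P = card U" if "P \<in> rcosets\<^bsub>A\<^esub> U" for P
    using A.card_rcosets_equal[OF that subgroup.subset[OF U]] by simp
  show "card (rcosets\<^bsub>A\<^esub> U) * card U = card H * p ^ (m * (m + 1))"
    using A.lagrange[OF U] by (simp add: order_A)
qed

lemma sum_A: "(\<Sum>\<phi>\<in>carrier A. f \<phi>) = (\<Sum>h\<in>H. \<Sum>v\<in>V. (f (aff h v) :: real))"
proof -
  have "(\<Sum>\<phi>\<in>carrier A. f \<phi>) = (\<Sum>e\<in>H \<times> V. f (case e of (h, v) \<Rightarrow> aff h v))"
    by (rule sum.reindex_bij_betw[OF A_bij, symmetric])
  then show ?thesis by (simp add: sum.cartesian_product case_prod_unfold)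
qed

lemma sum_over_cosets:
  fixes Z :: "('a \<Rightarrow> 'a) set \<Rightarrow> real"
  assumes U: "subgroup U A"
  shows "real (card U) * (\<Sum>P\<in>rcosets\<^bsub>A\<^esub> U. Z P) = (\<Sum>h\<in>H. \<Sum>v\<in>V. Z (U #>\<^bsub>A\<^esub> aff h v))"
proof -
  note c = subgroup_cosets[OF U]
  have "(\<Sum>P\<in>rcosets\<^bsub>A\<^esub> U. real (card (carrier A \<inter> P)) * Z P) = (\<Sum>\<phi>\<in>carrier A. Z (U #>\<^bsub>A\<^esub> \<phi>))"
    by (rule sum_card_Int_partition[OF A_finite c(1,2,4)]) auto
  moreover have "(\<Sum>P\<in>rcosets\<^bsub>A\<^esub> U. real (card (carrier A \<inter> P)) * Z P) = (\<Sum>P\<in>rcosets\<^bsub>A\<^esub> U. real (card U) * Z P)"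
  proof (rule sum.cong)
    fix P assume P: "P \<in> rcosets\<^bsub>A\<^esub> U"
    have "carrier A \<inter> P = P" using c(1) P by blast
    then show "real (card (carrier A \<inter> P)) * Z P = real (card U) * Z P" using c(5)[OF P] by simp
  qed simp
  ultimately show ?thesis by (simp add: sum_A sum_distrib_left)
qed

lemma sum_over_right_cosets:
  fixes Z :: "('a \<Rightarrow> 'a) set \<Rightarrow> real"
  shows "(\<Sum>P\<in>rcosets\<^bsub>A\<^esub> S\<^sub>H. Z P) = (\<Sum>w\<in>V. Z (S\<^sub>H #>\<^bsub>A\<^esub> aff \<one> w))"
proof -
  have "real (card H) * (\<Sum>P\<in>rcosets\<^bsub>A\<^esub> S\<^sub>H. Z P) = (\<Sum>h\<in>H. \<Sum>v\<in>V. Z (S\<^sub>H #>\<^bsub>A\<^esub> aff h v))"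
    using sum_over_cosets[OF S_subgroup] by (simp add: card_S)
  also have "\<dots> = (\<Sum>h\<in>H. \<Sum>v\<in>V. Z (S\<^sub>H #>\<^bsub>A\<^esub> aff \<one> (inv h \<otimes> v)))"
    by (intro sum.cong refl) (simp add: S_coset_eq)
  also have "\<dots> = (\<Sum>h\<in>H. \<Sum>w\<in>V. Z (S\<^sub>H #>\<^bsub>A\<^esub> aff \<one> w))"
    by (intro sum.cong refl sum_dilate)
  also have "\<dots> = real (card H) * (\<Sum>w\<in>V. Z (S\<^sub>H #>\<^bsub>A\<^esub> aff \<one> w))" by simp
  finally show ?thesis using H(2) by simp
qed

text \<open>In coset coordinates the matrix is \<open>left_mean\<close> times
  \<open>card G / D\<close>. Each left coset occurs for \<open>card G\<close> pairs
  \<open>(h, v)\<close>, so the sum of squares over rows is that of \<open>left_mean\<close> divided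
  by \<open>card H\<close>. Row sums \<open>card G / D\<close> and column sums
  \<open>card H / D\<close> multiply to 1, which gives the row sums required by
  \<open>second_singular_value_le\<close>.\<close>

lemma second_singular_value_norm_biadjacency:
  "0 \<le> second_singular_value (norm_biadjacency F G H) \<and>
   second_singular_value (norm_biadjacency F G H) \<le> sqrt (real (p ^ m) / real (card H))"
proof -
  define L where "L = rcosets\<^bsub>A\<^esub> T\<^sub>G"
  define R where "R = rcosets\<^bsub>A\<^esub> S\<^sub>H"
  define D where "D = sqrt (real (card G) * real (card H))"
  define M where "M = norm_biadjacency F G H"
  note Lf = subgroup_cosets[OF T_subgroup, folded L_def] and Rf = subgroup_cosets[OF S_subgroup, folded R_def]
  have cG: "0 < card G" using G(2) p_gt_1 by simp
  have cH: "0 < card H" using H(2) by simp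
  have D2: "D * D = real (card G) * real (card H)" and D0: "D \<noteq> 0" using cG cH by (auto simp: D_def)
  have cR: "card R = p ^ (m * (m + 1))" using Rf(6) cH by (simp add: card_S)
  \<comment> \<open>At least two cosets are needed on each side for a second singular value to
    exist.\<close>
  have "1 < card R" unfolding cR using m by (intro one_less_power p_gt_1) auto
  then obtain k where k: "card R = Suc k" "1 \<le> k" by (cases "card R") auto
  have "card L * p ^ m = card H * p ^ (m * m) * p ^ m"
    using Lf(6) by (auto simp: card_T G(2) power_add)
  moreover have "p ^ m \<noteq> 0" using p_gt_1 by auto
  ultimately have cL: "card L = card H * p ^ (m * m)" by (metis mult_right_cancel)
  have "1 < p ^ m" using one_less_power[OF p_gt_1, of m] m by simp
  then have "2 \<le> card H" using H(2) by simp
  moreover have "1 \<le> p ^ (m * m)" using p_gt_1 by simp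
  ultimately have l: "2 \<le> card L" unfolding cL by (metis mult_le_mono nat_mult_1_right)
  have bL: "bij_betw (from_nat_into L) {..<card L} L" and bR: "bij_betw (from_nat_into R) {..<card R} R"
    using Lf(3) Rf(3) by (auto intro: bij_betw_from_nat_into_finite)
  have Mc: "M \<in> carrier_mat (card L) (Suc k)"
    by (simp add: M_def norm_biadjacency_def Let_def L_def R_def k(1)[unfolded R_def, symmetric])
  have Mij: "M $$ (i, j) = real (card (from_nat_into L i \<inter> from_nat_into R j)) / D"
    if "i < card L" "j < Suc k" for i j
    using that by (simp add: M_def norm_biadjacency_def Let_def L_def R_def D_def k(1)[unfolded R_def, symmetric])
  have L_in: "from_nat_into L i \<in> L" if "i < card L" for i using bL that by (auto simp: bij_betw_def)
  have R_in: "from_nat_into R j \<in> R" if "j < Suc k" for j using bR that k(1) by (auto simp: bij_betw_def)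
  have row: "(\<Sum>j<Suc k. M $$ (i, j) * Z (from_nat_into R j)) = (\<Sum>\<phi>\<in>from_nat_into L i. Z (S\<^sub>H #>\<^bsub>A\<^esub> \<phi>)) / D"
    if i: "i < card L" for i and Z :: "('a \<Rightarrow> 'a) set \<Rightarrow> real"
  proof -
    have sub: "from_nat_into L i \<subseteq> carrier A" using L_in[OF i] Lf(1) by blast
    have "(\<Sum>j<Suc k. M $$ (i, j) * Z (from_nat_into R j))
        = (\<Sum>j<card R. real (card (from_nat_into L i \<inter> from_nat_into R j)) * Z (from_nat_into R j)) / D"
      unfolding sum_divide_distrib k(1) by (intro sum.cong refl) (use i Mij in auto)
    also have "(\<Sum>j<card R. real (card (from_nat_into L i \<inter> from_nat_into R j)) * Z (from_nat_into R j))
        = (\<Sum>P\<in>R. real (card (from_nat_into L i \<inter> P)) * Z P)"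
      by (rule sum.reindex_bij_betw[OF bR])
    also have "\<dots> = (\<Sum>\<phi>\<in>from_nat_into L i. Z (S\<^sub>H #>\<^bsub>A\<^esub> \<phi>))"
      by (rule sum_card_Int_partition[OF A_finite Rf(1,2,4) sub])
    finally show ?thesis .
  qed
  have row1: "(\<Sum>j<Suc k. M $$ (i, j)) = card G / D" if i: "i < card L" for i
    using row[OF i, of "\<lambda>_. 1"] Lf(5)[OF L_in[OF i]] by (simp add: card_T del: sum.lessThan_Suc)
  have col1: "(\<Sum>i<card L. M $$ (i, j)) = card H / D" if j: "j < Suc k" for j
  proof -
    have sub: "from_nat_into R j \<subseteq> carrier A" using R_in[OF j] Rf(1) by blast
    have "(\<Sum>i<card L. M $$ (i, j)) = (\<Sum>i<card L. real (card (from_nat_into R j \<inter> from_nat_into L i)) * 1) / D"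
      unfolding sum_divide_distrib by (intro sum.cong refl) (use j Mij in \<open>auto simp: Int_commute\<close>)
    also have "(\<Sum>i<card L. real (card (from_nat_into R j \<inter> from_nat_into L i)) * 1)
        = (\<Sum>P\<in>L. real (card (from_nat_into R j \<inter> P)) * 1)"
      by (rule sum.reindex_bij_betw[OF bL])
    also have "\<dots> = (\<Sum>\<phi>\<in>from_nat_into R j. 1)"
      by (rule sum_card_Int_partition[OF A_finite Lf(1,2,4) sub])
    finally show ?thesis using Rf(5)[OF R_in[OF j]] by (simp add: card_S)
  qed
  have "0 \<le> second_singular_value M \<and> second_singular_value M \<le> sqrt (real (p ^ m) / real (card H))"
  proof (rule second_singular_value_le[OF Mc k(2) l])
    show "0 \<le> real (p ^ m) / real (card H)" by simp
    show "real (p ^ m) / real (card H) < 1" using H(2) by (simp flip: of_nat_power)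
  next
    fix i assume i: "i < Suc k"
    have "(\<Sum>j<Suc k. (transpose_mat M * M) $$ (i, j)) = (\<Sum>j<Suc k. \<Sum>a<card L. M $$ (a, i) * M $$ (a, j))"
      using Mc i by (intro sum.cong refl) (simp add: scalar_prod_def atLeast0LessThan)
    also have "\<dots> = (\<Sum>a<card L. M $$ (a, i) * (\<Sum>j<Suc k. M $$ (a, j)))"
      by (subst sum.swap) (simp only: sum_distrib_left)
    also have "\<dots> = (\<Sum>a<card L. M $$ (a, i)) * (card G / D)"
      unfolding sum_distrib_right by (intro sum.cong refl) (simp only: row1 lessThan_iff)
    also have "\<dots> = 1" using col1[OF i] D2 cG cH D0 by (simp add: mult.commute)
    finally show "(\<Sum>j<Suc k. (transpose_mat M * M) $$ (i, j)) = 1" .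
  next
    fix x :: "nat \<Rightarrow> real" assume mean: "(\<Sum>j<Suc k. x j) = 0"
    \<comment> \<open>\<open>Y\<close> carries the vector \<open>x\<close> over to the right cosets,
      and \<open>f\<close> carries it on to \<open>V\<close>, preserving all sums over
      entries.\<close>
    define Y where "Y = (\<lambda>P. x (the_inv_into {..<card R} (from_nat_into R) P))"
    have Yx: "Y (from_nat_into R j) = x j" if "j < Suc k" for j
      unfolding Y_def using bR that k(1) by (subst the_inv_into_f_f) (auto simp: bij_betw_def)
    define f where "f = (\<lambda>w. Y (S\<^sub>H #>\<^bsub>A\<^esub> aff \<one> w))"
    have sumf: "(\<Sum>w\<in>V. \<psi> (f w)) = (\<Sum>j<Suc k. \<psi> (x j))" for \<psi> :: "real \<Rightarrow> real"
    proof -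
      have "(\<Sum>w\<in>V. \<psi> (f w)) = (\<Sum>P\<in>R. \<psi> (Y P))"
        unfolding f_def R_def by (rule sum_over_right_cosets[symmetric])
      also have "\<dots> = (\<Sum>j<card R. \<psi> (Y (from_nat_into R j)))"
        by (rule sum.reindex_bij_betw[OF bR, symmetric])
      also have "\<dots> = (\<Sum>j<Suc k. \<psi> (x j))" unfolding k(1) by (intro sum.cong refl) (simp add: Yx)
      finally show ?thesis .
    qed
    have coset: "(\<Sum>\<phi>\<in>T\<^sub>G #>\<^bsub>A\<^esub> aff h v. Y (S\<^sub>H #>\<^bsub>A\<^esub> \<phi>)) = card G * left_mean f h v"
      if h: "h \<in> H" and v: "v \<in> V" for h v
    proof -
      have vg: "v \<oplus> g \<in> V" if "g \<in> G" for g using that v G_subset_V V_closed(3) by blast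
      have inj: "inj_on (\<lambda>g. aff h (v \<oplus> g)) G"
      proof (rule inj_onI)
        fix g g' assume g: "g \<in> G" "g' \<in> G" and e: "aff h (v \<oplus> g) = aff h (v \<oplus> g')"
        have "v \<oplus> g = v \<oplus> g'" using aff_inj[OF e] H_carrier[OF h] V_carrier[OF vg] g by simp
        moreover have "g \<in> carrier F" "g' \<in> carrier F" using g G_subset by auto
        ultimately show "g = g'" using V_carrier[OF v] by simp
      qed
      have "(\<Sum>\<phi>\<in>T\<^sub>G #>\<^bsub>A\<^esub> aff h v. Y (S\<^sub>H #>\<^bsub>A\<^esub> \<phi>)) = (\<Sum>g\<in>G. Y (S\<^sub>H #>\<^bsub>A\<^esub> aff h (v \<oplus> g)))"
        unfolding T_coset[OF h v] by (simp add: sum.reindex[OF inj])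
      also have "\<dots> = (\<Sum>g\<in>G. f (inv h \<otimes> (v \<oplus> g)))"
        by (intro sum.cong refl) (simp add: f_def S_coset_eq[OF h vg])
      finally show ?thesis using cG by (simp add: left_mean_def)
    qed
    have "(\<Sum>i<card L. (\<Sum>j<Suc k. M $$ (i, j) * x j)\<^sup>2)
        = (\<Sum>i<card L. ((\<Sum>\<phi>\<in>from_nat_into L i. Y (S\<^sub>H #>\<^bsub>A\<^esub> \<phi>)) / D)\<^sup>2)"
    proof (intro sum.cong refl)
      fix i assume "i \<in> {..<card L}"
      then have "(\<Sum>j<Suc k. M $$ (i, j) * Y (from_nat_into R j)) = (\<Sum>\<phi>\<in>from_nat_into L i. Y (S\<^sub>H #>\<^bsub>A\<^esub> \<phi>)) / D"
        by (intro row) simp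
      moreover have "(\<Sum>j<Suc k. M $$ (i, j) * Y (from_nat_into R j)) = (\<Sum>j<Suc k. M $$ (i, j) * x j)"
        by (intro sum.cong refl) (simp add: Yx)
      ultimately show "(\<Sum>j<Suc k. M $$ (i, j) * x j)\<^sup>2 = ((\<Sum>\<phi>\<in>from_nat_into L i. Y (S\<^sub>H #>\<^bsub>A\<^esub> \<phi>)) / D)\<^sup>2"
        by simp
    qed
    also have "\<dots> = (\<Sum>P\<in>L. ((\<Sum>\<phi>\<in>P. Y (S\<^sub>H #>\<^bsub>A\<^esub> \<phi>)) / D)\<^sup>2)"
      by (rule sum.reindex_bij_betw[OF bL])
    also have "\<dots> = (\<Sum>h\<in>H. \<Sum>v\<in>V. ((\<Sum>\<phi>\<in>T\<^sub>G #>\<^bsub>A\<^esub> aff h v. Y (S\<^sub>H #>\<^bsub>A\<^esub> \<phi>)) / D)\<^sup>2) / card G"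
      using sum_over_cosets[OF T_subgroup, of "\<lambda>P. ((\<Sum>\<phi>\<in>P. Y (S\<^sub>H #>\<^bsub>A\<^esub> \<phi>)) / D)\<^sup>2"] cG
      by (simp add: card_T L_def field_simps)
    also have "\<dots> = (\<Sum>h\<in>H. \<Sum>v\<in>V. (card G * left_mean f h v / D)\<^sup>2) / card G"
      by (intro arg_cong[of _ _ "\<lambda>s. s / real (card G)"] sum.cong refl) (simp only: coset)
    also have "\<dots> = (\<Sum>h\<in>H. \<Sum>v\<in>V. (left_mean f h v)\<^sup>2) / card H"
    proof -
      have "(card G * left_mean f h v / D)\<^sup>2 / card G = (left_mean f h v)\<^sup>2 / card H" for h v
        using D2 cG cH by (simp add: power2_eq_square field_simps)
      then show ?thesis by (simp add: sum_divide_distrib)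
    qed
    also have "\<dots> \<le> (real (p ^ m) * (\<Sum>w\<in>V. (f w)\<^sup>2)) / card H"
      using sumf[of "\<lambda>x. x"] mean by (intro divide_right_mono left_mean_squares_le) auto
    also have "\<dots> = real (p ^ m) / real (card H) * (\<Sum>j<Suc k. (x j)\<^sup>2)"
      using sumf[of "\<lambda>x. x\<^sup>2"] by simp
    finally show "(\<Sum>i<card L. (\<Sum>j<Suc k. M $$ (i, j) * x j)\<^sup>2)
        \<le> real (p ^ m) / real (card H) * (\<Sum>j<Suc k. (x j)\<^sup>2)" .
  qed
  then show ?thesis by (simp add: M_def)
qed

end

section \<open>Dimension and minimum distance\<close>

context finite_field begin

lemma card_field_gt_1: "1 < card (carrier F)"
proof -
  have "card {\<zero>, \<one>} \<le> card (carrier F)" using finite_carrier by (intro card_mono) auto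
  then show ?thesis by simp
qed

text \<open>Turns every bound on a dimension into a count of elements: upper bounds come from
  surjections, lower bounds from injections.\<close>

lemma card_vectorspace:
  assumes V: "vectorspace F V" and fin: "finite (carrier V)"
  shows "card (carrier V) = card (carrier F) ^ vectorspace.dim F V"
proof -
  interpret V: vectorspace F V by (rule V)
  have "V.span (carrier V) = carrier V"
    using V.in_own_span[of "carrier V"] V.span_is_subset2[of "carrier V"] by blast
  then have "V.fin_dim" unfolding V.fin_dim_def using fin by blast
  then obtain \<beta> where \<beta>: "finite \<beta>" "V.basis \<beta>" using V.finite_basis_exists by blast
  have \<beta>c: "\<beta> \<subseteq> carrier V" using \<beta> V.basis_def by blast
  note crit = V.basis_criterion[OF \<beta>(1) \<beta>c, THEN iffD1, OF \<beta>(2)]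
  have "bij_betw (\<lambda>a. V.lincomb a \<beta>) (\<beta> \<rightarrow>\<^sub>E carrier F) (carrier V)"
  proof (rule bij_betw_imageI)
    have cl: "V.lincomb a \<beta> \<in> carrier V" if "a \<in> \<beta> \<rightarrow>\<^sub>E carrier F" for a
      using that \<beta>c \<beta>(1) by (intro V.lincomb_closed) auto
    show "inj_on (\<lambda>a. V.lincomb a \<beta>) (\<beta> \<rightarrow>\<^sub>E carrier F)"
    proof (rule inj_onI)
      fix a b assume "a \<in> \<beta> \<rightarrow>\<^sub>E carrier F" "b \<in> \<beta> \<rightarrow>\<^sub>E carrier F" "V.lincomb a \<beta> = V.lincomb b \<beta>"
      then show "a = b" using crit cl[of b] by blast
    qed
    show "(\<lambda>a. V.lincomb a \<beta>) ` (\<beta> \<rightarrow>\<^sub>E carrier F) = carrier V"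
      using crit cl by blast
  qed
  then have "card (carrier V) = card (carrier F) ^ card \<beta>"
    using bij_betw_same_card[of _ "\<beta> \<rightarrow>\<^sub>E carrier F" "carrier V"] \<beta>(1) by (simp add: card_PiE)
  then show ?thesis using V.dim_basis[OF \<beta>] by simp
qed

text \<open>Serves the local Reed-Solomon codes and the global code alike, both being images of sets
  of polynomials closed under addition and scaling.\<close>

lemma card_eval_code:
  assumes S: "S \<subseteq> carrier F" and P: "P \<subseteq> carrier (UP F)" "\<zero>\<^bsub>UP F\<^esub> \<in> P"
    and add: "\<And>f g. f \<in> P \<Longrightarrow> g \<in> P \<Longrightarrow> f \<oplus>\<^bsub>UP F\<^esub> g \<in> P"
    and smult: "\<And>a f. a \<in> carrier F \<Longrightarrow> f \<in> P \<Longrightarrow> a \<odot>\<^bsub>UP F\<^esub> f \<in> P"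
  shows "card (eval_word F S ` P)
    = card (carrier F) ^ vectorspace.dim F ((ring.func_space F S)\<lparr>carrier := eval_word F S ` P\<rparr>)"
proof -
  have "vectorspace F (func_space S)"
    by (intro vectorspace.intro func_space_is_module field_axioms)
  then interpret W: vectorspace F "func_space S" .
  have ev0: "eval_word F S \<zero>\<^bsub>UP F\<^esub> = (\<lambda>v\<in>S. \<zero>)"
    unfolding eval_word_def by (rule restrict_ext) (use S in \<open>auto simp: ev_zero\<close>)
  have evadd: "eval_word F S (f \<oplus>\<^bsub>UP F\<^esub> g) = (\<lambda>v\<in>S. eval_word F S f v \<oplus> eval_word F S g v)"
    if "f \<in> P" "g \<in> P" for f g
    unfolding eval_word_def
    by (rule restrict_ext) (use S P that in \<open>auto simp: U.evalRR_add subset_iff\<close>)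
  have evsmult: "eval_word F S (a \<odot>\<^bsub>UP F\<^esub> f) = (\<lambda>v\<in>S. a \<otimes> eval_word F S f v)"
    if "a \<in> carrier F" "f \<in> P" for a f
    unfolding eval_word_def
    by (rule restrict_ext) (use S P that in \<open>auto simp: ev_smult subset_iff\<close>)
  have sub: "eval_word F S ` P \<subseteq> S \<rightarrow>\<^sub>E carrier F" using eval_word_in[OF S] P(1) by blast
  have "LinearCombinations.submodule F (eval_word F S ` P) (func_space S)"
    unfolding submodule_def
  proof (intro conjI allI impI)
    show "Module.module F (func_space S)" by (rule func_space_is_module)
    show "eval_word F S ` P \<subseteq> carrier (func_space S)" using sub by (simp add: func_space_def)
    show "\<zero>\<^bsub>func_space S\<^esub> \<in> eval_word F S ` P"
      using P(2) ev0 by (auto simp: func_space_def intro!: image_eqI[of _ _ "\<zero>\<^bsub>UP F\<^esub>"])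
    fix v w assume "v \<in> eval_word F S ` P" "w \<in> eval_word F S ` P"
    then obtain f g where fg: "f \<in> P" "g \<in> P" "v = eval_word F S f" "w = eval_word F S g" by blast
    then have "v \<oplus>\<^bsub>func_space S\<^esub> w = eval_word F S (f \<oplus>\<^bsub>UP F\<^esub> g)"
      by (simp add: func_space_def evadd)
    then show "v \<oplus>\<^bsub>func_space S\<^esub> w \<in> eval_word F S ` P" using add[OF fg(1,2)] by blast
  next
    fix a v assume a: "a \<in> carrier F" and "v \<in> eval_word F S ` P"
    then obtain f where f: "f \<in> P" "v = eval_word F S f" by blast
    then have "a \<odot>\<^bsub>func_space S\<^esub> v = eval_word F S (a \<odot>\<^bsub>UP F\<^esub> f)"
      using a by (simp add: func_space_def evsmult)
    then show "a \<odot>\<^bsub>func_space S\<^esub> v \<in> eval_word F S ` P" using smult[OF a f(1)] by blast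
  qed
  then have "VectorSpace.subspace F (eval_word F S ` P) (func_space S)"
    unfolding subspace_def using W.vectorspace_axioms by blast
  then have "vectorspace F ((func_space S)\<lparr>carrier := eval_word F S ` P\<rparr>)"
    by (rule W.subspace_is_vs)
  moreover have "finite (eval_word F S ` P)"
    using sub finite_carrier S by (meson finite_PiE finite_subset)
  ultimately show ?thesis using card_vectorspace by fastforce
qed

text \<open>The summand 1 accounts for rounding \<open>t\<close> up to an integer degree
  bound.\<close>

lemma RS_code_rate:
  assumes S: "S \<subseteq> carrier F" "0 < card S" and t: "0 \<le> t"
  shows "code_rate F S (RS_code F S t) \<le> (t + 1) / card S"
proof -
  let ?k = "nat \<lceil>t\<rceil>"
  define d where "d = vectorspace.dim F ((ring.func_space F S)\<lparr>carrier := RS_code F S t\<rparr>)"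
  have "card (eval_word F S ` polys ?k) = card (carrier F) ^ d"
    unfolding d_def RS_code_eq by (rule card_eval_code[OF S(1)]) (auto dest: polysD)
  then have "card (carrier F) ^ d \<le> card (carrier F) ^ ?k"
    using card_image_le[OF finite_polys, of "eval_word F S" ?k] by (simp add: card_polys)
  then have "d \<le> ?k" using card_field_gt_1 by simp
  then have "real d \<le> t + 1" using t by linarith
  then show ?thesis unfolding code_rate_def d_def[symmetric] by (intro divide_right_mono) auto
qed

text \<open>Stated for two words that differ at a given position, because distinct global codewords
  may well agree on some orbits. The number of agreements is bounded by the number of roots of the
  difference.\<close>

lemma RS_code_distance:
  assumes S: "S \<subseteq> carrier F" and x: "x \<in> RS_code F S t" "y \<in> RS_code F S t" and \<beta>: "\<beta> \<in> S" "x \<beta> \<noteq> y \<beta>"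
  shows "real (card S) - t \<le> card {\<beta> \<in> S. x \<beta> \<noteq> y \<beta>}"
proof -
  let ?k = "nat \<lceil>t\<rceil>"
  have fS: "finite S" using S finite_carrier finite_subset by blast
  obtain f g where f: "f \<in> polys ?k" "x = eval_word F S f" and g: "g \<in> polys ?k" "y = eval_word F S g"
    using x by (auto simp: RS_code_eq)
  have c: "f \<in> carrier (UP F)" "g \<in> carrier (UP F)" using f g polysD by auto
  let ?u = "f \<ominus>\<^bsub>UP F\<^esub> g"
  have u: "?u \<in> polys ?k" using f g by auto
  have evu: "ev ?u \<gamma> = \<zero> \<longleftrightarrow> x \<gamma> = y \<gamma>" if "\<gamma> \<in> S" for \<gamma>
  proof -
    have "\<gamma> \<in> carrier F" using that S by blast
    then show ?thesis using c that by (simp add: U.evalRR_sub f(2) g(2) eval_word_def)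
  qed
  have nz: "?u \<noteq> \<zero>\<^bsub>UP F\<^esub>"
  proof
    assume u0: "?u = \<zero>\<^bsub>UP F\<^esub>"
    have "ev ?u \<beta> = \<zero>" unfolding u0 using \<beta>(1) S(1) by (intro ev_zero) blast
    then show False using evu[OF \<beta>(1)] \<beta>(2) by simp
  qed
  have uc: "?u \<in> carrier (UP F)" using u by (rule polysD)
  have deg: "deg F ?u < ?k" using polys_iff_deg[OF uc, of ?k] u nz by blast
  have "{\<gamma> \<in> S. x \<gamma> = y \<gamma>} \<subseteq> {a \<in> carrier F. ev ?u a = \<zero>}" using evu S by blast
  then have "card {\<gamma> \<in> S. x \<gamma> = y \<gamma>} \<le> card {a \<in> carrier F. ev ?u a = \<zero>}"
    using finite_carrier by (intro card_mono) auto
  also have "\<dots> \<le> deg F ?u" using U.roots_bound[OF uc nz finite_carrier] by (rule conjunct2)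
  finally have "real (card {\<gamma> \<in> S. x \<gamma> = y \<gamma>}) \<le> t" using deg by linarith
  moreover have "card S = card {\<gamma> \<in> S. x \<gamma> = y \<gamma>} + card {\<gamma> \<in> S. x \<gamma> \<noteq> y \<gamma>}"
    by (subst card_Un_disjoint[symmetric]) (use fS in \<open>auto intro!: arg_cong[of _ _ card]\<close>)
  ultimately show ?thesis by linarith
qed

lemma min_dist_attained:
  assumes "x \<in> C" "y \<in> C" "x \<noteq> y"
  shows "\<exists>x\<in>C. \<exists>y\<in>C. x \<noteq> y \<and> min_dist S C = card {\<beta> \<in> S. x \<beta> \<noteq> y \<beta>}"
proof -
  have "min_dist S C \<in> {card {\<beta> \<in> S. x \<beta> \<noteq> y \<beta>} | x y. x \<in> C \<and> y \<in> C \<and> x \<noteq> y}"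
    unfolding min_dist_def by (rule Inf_nat_def1) (use assms in blast)
  then show ?thesis by blast
qed

text \<open>Gives two distinct codewords, so the infimum in \<open>min_dist\<close> runs over a
  nonempty set. Over the empty set it would be 0, and the lower bounds would fail.\<close>

lemma constant_words:
  assumes S: "S \<subseteq> carrier F" "S \<noteq> {}"
  shows "eval_word F S \<zero>\<^bsub>UP F\<^esub> \<noteq> eval_word F S \<one>\<^bsub>UP F\<^esub>"
proof
  assume e: "eval_word F S \<zero>\<^bsub>UP F\<^esub> = eval_word F S \<one>\<^bsub>UP F\<^esub>"
  obtain \<beta> where "\<beta> \<in> S" using S by blast
  then have "ev \<zero>\<^bsub>UP F\<^esub> \<beta> = ev \<one>\<^bsub>UP F\<^esub> \<beta>" "\<beta> \<in> carrier F"
    using fun_cong[OF e, of \<beta>] S by (auto simp: eval_word_def)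
  then show False using ev_zero[of \<beta>] U.evalRR_one[of \<beta>] by simp
qed

lemma one_in_polys: "0 < k \<Longrightarrow> \<one>\<^bsub>UP F\<^esub> \<in> polys k"
  by (simp add: polys_def)

lemma RS_code_rel_min_dist:
  assumes S: "S \<subseteq> carrier F" "0 < card S" and t: "0 < t"
  shows "1 - t / card S \<le> rel_min_dist S (RS_code F S t)"
proof -
  have ne: "S \<noteq> {}" using S by auto
  have "eval_word F S \<zero>\<^bsub>UP F\<^esub> \<in> RS_code F S t" "eval_word F S \<one>\<^bsub>UP F\<^esub> \<in> RS_code F S t"
    unfolding RS_code_eq using t one_in_polys[of "nat \<lceil>t\<rceil>"] by auto
  then obtain x y where xy: "x \<in> RS_code F S t" "y \<in> RS_code F S t" "x \<noteq> y"
    and d: "min_dist S (RS_code F S t) = card {\<beta> \<in> S. x \<beta> \<noteq> y \<beta>}"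
    using min_dist_attained[OF _ _ constant_words[OF S(1) ne]] by blast
  have "x \<in> S \<rightarrow>\<^sub>E carrier F" "y \<in> S \<rightarrow>\<^sub>E carrier F"
    using xy eval_word_in[OF S(1)] polysD by (auto simp: RS_code_eq)
  then obtain \<beta> where "\<beta> \<in> S" "x \<beta> \<noteq> y \<beta>" using xy(3) by (metis PiE_ext)
  then have "real (card S) - t \<le> min_dist S (RS_code F S t)"
    unfolding d using RS_code_distance[OF S(1) xy(1,2)] by blast
  then have "(real (card S) - t) / card S \<le> min_dist S (RS_code F S t) / card S"
    by (intro divide_right_mono) auto
  then show ?thesis using S(2) by (simp add: rel_min_dist_def diff_divide_distrib)
qed

end

section \<open>Minimum distance of the global code\<close>

context evaluation_setting begin

lemma one_in_msgs: "0 < r \<Longrightarrow> \<one>\<^bsub>UP F\<^esub> \<in> msgs r" and zero_in_msgs: "\<zero>\<^bsub>UP F\<^esub> \<in> msgs r"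
proof -
  have "0 < card \<Omega>" using H_card_pos p_gt_1 by (simp add: card_\<Omega> order_A)
  moreover have "0 < card G" using G(2) p_gt_1 by simp
  ultimately show "0 < r \<Longrightarrow> \<one>\<^bsub>UP F\<^esub> \<in> msgs r"
    using H_card_pos by (auto simp: msgs_def RS_code_eq intro!: imageI one_in_polys)
  show "\<zero>\<^bsub>UP F\<^esub> \<in> msgs r" by (simp add: msgs_def RS_code_eq)
qed

text \<open>\<open>X\<close> is the set of edges at which two closest codewords differ. On any orbit
  that it meets, the local distance makes it occupy at least the fraction \<open>1 - r\<close>, so
  \<open>expanding_support\<close> applies with \<open>s = 1 - r\<close>.\<close>

lemma rel_min_dist_ge:
  assumes r: "0 < r" "r < 1"
  shows "(1 - r)\<^sup>2 - (1 - r) * sqrt (real (p ^ m) / real (card H))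
    \<le> rel_min_dist \<Omega> (eval_code F G H \<alpha> r (int (Coset.order A)))"
proof -
  let ?C = "eval_word F \<Omega> ` msgs r"
  have "0 < card \<Omega>" using H_card_pos p_gt_1 by (simp add: card_\<Omega> order_A)
  then have "\<Omega> \<noteq> {}" by auto
  obtain x y where xy: "x \<in> ?C" "y \<in> ?C" "x \<noteq> y" and d: "min_dist \<Omega> ?C = card {\<beta> \<in> \<Omega>. x \<beta> \<noteq> y \<beta>}"
    using min_dist_attained[OF imageI[OF zero_in_msgs] imageI[OF one_in_msgs[OF r(1)]]
        constant_words[OF \<Omega>_carrier \<open>\<Omega> \<noteq> {}\<close>]] by blast
  obtain f where f: "f \<in> msgs r" "x = eval_word F \<Omega> f" using xy(1) by blast
  obtain g where g: "g \<in> msgs r" "y = eval_word F \<Omega> g" using xy(2) by blast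
  define X where "X = {e \<in> H \<times> V. x (pt e) \<noteq> y (pt e)}"
  have imX: "pt ` X = {\<beta> \<in> \<Omega>. x \<beta> \<noteq> y \<beta>}" by (auto simp: X_def \<Omega>_eq)
  have "inj_on pt X" using pt_inj by (rule inj_on_subset) (auto simp: X_def)
  then have cX: "card X = min_dist \<Omega> ?C" unfolding d imX[symmetric] by (rule card_image[symmetric])
  have loc: "real (card S) - t \<le> card {\<beta> \<in> S. x \<beta> \<noteq> y \<beta>}"
    if S: "S \<subseteq> \<Omega>" "eval_word F S f \<in> RS_code F S t" "eval_word F S g \<in> RS_code F S t" "\<beta> \<in> S" "x \<beta> \<noteq> y \<beta>"
    for S t \<beta>
  proof -
    have eq: "eval_word F S f \<gamma> = x \<gamma>" "eval_word F S g \<gamma> = y \<gamma>" if "\<gamma> \<in> S" for \<gamma>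
      using that S(1) by (auto simp: eval_word_def f g)
    have "real (card S) - t \<le> card {\<beta> \<in> S. eval_word F S f \<beta> \<noteq> eval_word F S g \<beta>}"
      using S eq \<Omega>_carrier by (intro RS_code_distance[of S _ _ _ \<beta>]) auto
    also have "{\<beta> \<in> S. eval_word F S f \<beta> \<noteq> eval_word F S g \<beta>} = {\<beta> \<in> S. x \<beta> \<noteq> y \<beta>}" using eq by auto
    finally show ?thesis .
  qed
  have "(1 - r)\<^sup>2 - (1 - r) * sqrt (real (p ^ m) / real (card H)) \<le> real (card X) / real (card H * card V)"
  proof (rule expanding_support)
    show "X \<subseteq> H \<times> V" by (auto simp: X_def)
    have "x \<in> \<Omega> \<rightarrow>\<^sub>E carrier F" "y \<in> \<Omega> \<rightarrow>\<^sub>E carrier F"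
      using f g eval_word_in[OF \<Omega>_carrier] polysD by (auto simp: msgs_def)
    then obtain \<beta> where "\<beta> \<in> \<Omega>" "x \<beta> \<noteq> y \<beta>" using xy(3) by (metis PiE_ext)
    then have "pt ` X \<noteq> {}" unfolding imX by blast
    then show "X \<noteq> {}" by blast
    show "0 < 1 - r" using r by simp
  next
    fix h v assume "(h, v) \<in> X"
    then have h: "h \<in> H" and v: "v \<in> V" and ne: "x (pt (h, v)) \<noteq> y (pt (h, v))" by (auto simp: X_def)
    define \<beta> where "\<beta> = pt (h, v)"
    have \<beta>: "\<beta> \<in> \<Omega>" using h v by (auto simp: \<beta>_def \<Omega>_eq)
    have vg: "v \<oplus> g \<in> V" if "g \<in> G" for g using that v G_subset_V V_closed(3) by blast
    let ?S = "(\<lambda>g. \<beta> \<oplus> g) ` G"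
    have S: "?S \<in> left_orbits F G H \<alpha>" using \<beta> by (auto simp: left_orbits_eq)
    have "\<beta> \<in> ?S" using \<beta> \<Omega>_carrier asubD(2)[OF subfield_asub[OF G(1)]]
      by (auto intro!: image_eqI[of _ _ \<zero>])
    then have "real (card ?S) - r * card G \<le> card {\<gamma> \<in> ?S. x \<gamma> \<noteq> y \<gamma>}"
      using f(1) g(1) S ne orbits_subset(1)[OF S] by (intro loc[of ?S _ \<beta>]) (auto simp: msgs_def \<beta>_def)
    also have "{\<gamma> \<in> ?S. x \<gamma> \<noteq> y \<gamma>} = (\<lambda>g. \<beta> \<oplus> g) ` {g \<in> G. (h, v \<oplus> g) \<in> X}"
      using h v vg pt_translate[OF h v] G_subset_V by (auto simp: X_def \<beta>_def subset_iff)
    also have "card \<dots> = card {g \<in> G. (h, v \<oplus> g) \<in> X}"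
      using \<beta> \<Omega>_carrier G_subset by (intro card_image) (auto simp: inj_on_def subset_iff)
    finally show "(1 - r) * real (card G) \<le> real (card {g \<in> G. (h, v \<oplus> g) \<in> X})"
      using card_left_orbit[OF \<beta>] by (simp add: algebra_simps)
  next
    fix h v assume "(h, v) \<in> X"
    then have h: "h \<in> H" and v: "v \<in> V" and ne: "x (pt (h, v)) \<noteq> y (pt (h, v))" by (auto simp: X_def)
    define \<beta> where "\<beta> = pt (h, v)"
    have \<beta>: "\<beta> \<in> \<Omega>" using h v by (auto simp: \<beta>_def \<Omega>_eq)
    have bc: "\<beta> \<in> carrier F - {\<zero>}" using \<beta> \<Omega>_carrier zero_notin_\<Omega> by auto
    let ?S = "(\<lambda>k. k \<otimes> \<beta>) ` H"
    have S: "?S \<in> right_orbits F G H \<alpha>" using \<beta> by (auto simp: right_orbits_eq)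
    have "\<beta> \<in> ?S" using bc one_H by (auto intro!: image_eqI[of _ _ \<one>])
    then have "real (card ?S) - r * card H \<le> card {\<gamma> \<in> ?S. x \<gamma> \<noteq> y \<gamma>}"
      using f(1) g(1) S ne orbits_subset(2)[OF S] by (intro loc[of ?S _ \<beta>]) (auto simp: msgs_def \<beta>_def)
    also have "{\<gamma> \<in> ?S. x \<gamma> \<noteq> y \<gamma>} = (\<lambda>k. k \<otimes> \<beta>) ` {k \<in> H. (k \<otimes> h, k \<otimes> v) \<in> X}"
      using h v pt_scale[OF h _ v] H_mult H_V by (auto simp: X_def \<beta>_def)
    also have "card \<dots> = card {k \<in> H. (k \<otimes> h, k \<otimes> v) \<in> X}"
      using bc H_carrier by (intro card_image) (auto simp: inj_on_def m_rcancel)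
    finally show "(1 - r) * real (card H) \<le> real (card {k \<in> H. (k \<otimes> h, k \<otimes> v) \<in> X})"
      using card_right_orbit[OF \<beta>] by (simp add: algebra_simps)
  qed
  also have "real (card X) / real (card H * card V) = rel_min_dist \<Omega> ?C"
    by (simp add: rel_min_dist_def cX card_\<Omega> order_A card_V)
  finally show ?thesis by (simp only: eval_code_eq)
qed

end

section \<open>The rate\<close>

text \<open>The positions \<open>j\<close> for which \<open>g ^ (p ^ j)\<close> has full degree \<open>p ^ m\<close> on the \<open>H\<close>-orbits.\<close>

definition special_digits :: "nat \<Rightarrow> nat set" where
  "special_digits m = {j. j < m * (m + 1) + 1 \<and> (j mod (m + 1) = 0 \<or> j mod (m + 1) = m)}"

text \<open>There are \<open>m + 1\<close> multiples of \<open>m + 1\<close> in the range and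
  \<open>m\<close> numbers of residue \<open>m\<close>.\<close>

lemma card_special_digits:
  assumes m: "1 \<le> m"
  shows "card (special_digits m) = 2 * m + 1"
proof -
  have "special_digits m = (\<lambda>k. k * (m + 1)) ` {..m} \<union> (\<lambda>k. k * (m + 1) + m) ` {..<m}"
  proof (intro equalityI subsetI)
    fix j assume j: "j \<in> special_digits m"
    have jd: "j = (j div (m + 1)) * (m + 1) + j mod (m + 1)" by (simp only: div_mult_mod_eq)
    have lt: "j \<le> m * (m + 1)" using j by (simp add: special_digits_def)
    from j consider "j mod (m + 1) = 0" | "j mod (m + 1) = m" by (auto simp: special_digits_def)
    then show "j \<in> (\<lambda>k. k * (m + 1)) ` {..m} \<union> (\<lambda>k. k * (m + 1) + m) ` {..<m}"
    proof cases
      case 1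
      have e: "m * (m + 1) div (m + 1) = m" by (rule div_mult_self_is_m) simp
      have "j div (m + 1) \<le> m" using div_le_mono[OF lt, of "m + 1"] unfolding e .
      then show ?thesis using jd 1 by (intro UnI1 image_eqI[of _ _ "j div (m + 1)"]) auto
    next
      case 2
      have "j div (m + 1) < m"
      proof (rule ccontr)
        assume "\<not> j div (m + 1) < m"
        then have "m * (m + 1) \<le> (j div (m + 1)) * (m + 1)" by (intro mult_right_mono) auto
        then show False using jd 2 lt m by linarith
      qed
      then show ?thesis using jd 2 by (intro UnI2 image_eqI[of _ _ "j div (m + 1)"]) auto
    qed
  next
    fix j assume "j \<in> (\<lambda>k. k * (m + 1)) ` {..m} \<union> (\<lambda>k. k * (m + 1) + m) ` {..<m}"
    then consider k where "k \<le> m" "j = k * (m + 1)" | k where "k < m" "j = k * (m + 1) + m" by auto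
    then show "j \<in> special_digits m"
    proof cases
      case 1
      have "k * (m + 1) \<le> m * (m + 1)" using 1 by (intro mult_right_mono) auto
      then have "j < m * (m + 1) + 1" using 1(2) by linarith
      moreover have "j mod (m + 1) = 0" unfolding 1(2) by (rule mod_mult_self2_is_0)
      ultimately show ?thesis unfolding special_digits_def by blast
    next
      case 2
      have "(k + 1) * (m + 1) \<le> m * (m + 1)" using 2 by (intro mult_right_mono) auto
      moreover have "j mod (m + 1) = m" using 2(2) by (metis add.commute lessI mod_less mod_mult_self1 Suc_eq_plus1)
      ultimately show ?thesis using 2 by (simp add: special_digits_def)
    qed
  qed
  moreover have "(\<lambda>k. k * (m + 1)) ` {..m} \<inter> (\<lambda>k. k * (m + 1) + m) ` {..<m} = {}"
  proof -
    have "k * (m + 1) \<noteq> l * (m + 1) + m" for k l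
    proof
      assume "k * (m + 1) = l * (m + 1) + m"
      then have "(k * (m + 1)) mod (m + 1) = (l * (m + 1) + m) mod (m + 1)" by simp
      also have "\<dots> = m" by (metis add.commute lessI mod_less mod_mult_self1 Suc_eq_plus1)
      finally show False using m by (metis mod_mult_self2_is_0 not_one_le_zero)
    qed
    then show ?thesis by blast
  qed
  moreover have "inj_on (\<lambda>k. k * (m + 1)) {..m}" "inj_on (\<lambda>k. k * (m + 1) + m) {..<m}"
    by (auto intro!: inj_onI simp del: mult_Suc_right add_Suc_right)
  ultimately show ?thesis by (simp add: card_Un_disjoint card_image del: mult_Suc_right add_Suc_right)
qed

text \<open>Base \<open>p\<close> digits of exponents of \<open>g\<close>. The number of digits is
  chosen since \<open>card \<Omega> / p ^ m\<close>, the number of terms available in an expansion,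
  is about \<open>\<gamma> p ^ (m * (m + 1) + 1)\<close>.\<close>

definition digit_functions :: "nat \<Rightarrow> nat \<Rightarrow> nat \<Rightarrow> (nat \<Rightarrow> nat) set" where
  "digit_functions m p M = {f \<in> {..<m * (m + 1) + 1} \<rightarrow>\<^sub>E {..<p}. (\<Sum>j\<in>special_digits m. f j) \<le> M}"

lemma finite_digit_functions: "finite (digit_functions m p M)"
  by (rule finite_subset[of _ "{..<m * (m + 1) + 1} \<rightarrow>\<^sub>E {..<p}"]) (auto simp: digit_functions_def finite_PiE)

text \<open>The special digits range over the lattice points of a simplex of size \<open>M\<close>,
  which are admissible digits because \<open>M < p\<close>. The other \<open>m * m - m\<close>
  digits are free.\<close>

lemma card_digit_functions:
  assumes m: "1 \<le> m" and M: "M < p"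
  shows "real M ^ (2 * m + 1) * real p ^ (m * m - m) \<le> fact (2 * m + 1) * real (card (digit_functions m p M))"
proof -
  let ?N = "m * (m + 1) + 1"
  let ?Sp = "special_digits m"
  let ?Fr = "{..<?N} - ?Sp"
  have Sp: "?Sp \<subseteq> {..<?N}" by (auto simp: special_digits_def)
  then have finSp: "finite ?Sp" using finite_subset by blast
  have "card ?Fr = ?N - (2 * m + 1)"
    using card_Diff_subset[OF finSp Sp] card_special_digits[OF m] by simp
  then have cFr: "card ?Fr = m * m - m" by simp
  define mg where "mg = (\<lambda>(s :: nat \<Rightarrow> nat, t :: nat \<Rightarrow> nat) j. if j \<in> ?Sp then s j else t j)"
  have inj: "inj_on mg (simplex_points ?Sp M \<times> (?Fr \<rightarrow>\<^sub>E {..<p}))"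
  proof (rule inj_onI, clarify)
    fix s t s' t' assume s: "s \<in> simplex_points ?Sp M" "s' \<in> simplex_points ?Sp M"
      and t: "t \<in> ?Fr \<rightarrow>\<^sub>E {..<p}" "t' \<in> ?Fr \<rightarrow>\<^sub>E {..<p}" and e: "mg (s, t) = mg (s', t')"
    have ej: "(if j \<in> ?Sp then s j else t j) = (if j \<in> ?Sp then s' j else t' j)" for j
      using fun_cong[OF e, of j] by (simp add: mg_def)
    have s': "s \<in> ?Sp \<rightarrow>\<^sub>E UNIV" "s' \<in> ?Sp \<rightarrow>\<^sub>E UNIV" using s by (simp_all add: simplex_points_def)
    have "s j = s' j" for j
      using ej[of j] PiE_arb[OF s'(1), of j] PiE_arb[OF s'(2), of j] by (cases "j \<in> ?Sp") simp_all
    moreover have "t j = t' j" for j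
      using ej[of j] PiE_arb[OF t(1), of j] PiE_arb[OF t(2), of j] by (cases "j \<in> ?Sp") simp_all
    ultimately show "s = s' \<and> t = t'" by auto
  qed
  have sub: "mg ` (simplex_points ?Sp M \<times> (?Fr \<rightarrow>\<^sub>E {..<p})) \<subseteq> digit_functions m p M"
  proof clarify
    fix s t assume s: "s \<in> simplex_points ?Sp M" and t: "t \<in> ?Fr \<rightarrow>\<^sub>E {..<p}"
    have sM: "(\<Sum>j\<in>?Sp. s j) \<le> M" using s by (simp add: simplex_points_def)
    have sp: "s j < p" if "j \<in> ?Sp" for j
      using member_le_sum[OF that, of s] finSp sM M by simp
    have "mg (s, t) j < p" if "j < ?N" for j
      using sp[of j] PiE_mem[OF t, of j] that by (cases "j \<in> ?Sp") (auto simp: mg_def)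
    moreover have "mg (s, t) j = undefined" if "\<not> j < ?N" for j
      using that PiE_arb[OF t, of j] Sp by (auto simp: mg_def)
    moreover have "(\<Sum>j\<in>?Sp. mg (s, t) j) = (\<Sum>j\<in>?Sp. s j)"
      by (intro sum.cong) (auto simp: mg_def)
    ultimately show "mg (s, t) \<in> digit_functions m p M"
      using sM by (auto simp: digit_functions_def)
  qed
  have "card (simplex_points ?Sp M) * p ^ (m * m - m) = card (simplex_points ?Sp M \<times> (?Fr \<rightarrow>\<^sub>E {..<p}))"
    unfolding card_cartesian_product
    by (subst card_PiE) (simp_all only: card_lessThan prod_constant cFr finite_Diff finite_lessThan)
  also have "\<dots> \<le> card (digit_functions m p M)"
    using card_image[OF inj] card_mono[OF finite_digit_functions sub] by simp
  finally have c: "card (simplex_points ?Sp M) * p ^ (m * m - m) \<le> card (digit_functions m p M)" .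
  have "real M ^ (2 * m + 1) * real p ^ (m * m - m)
      \<le> (fact (2 * m + 1) * real (card (simplex_points ?Sp M))) * real p ^ (m * m - m)"
    using card_simplex_points_ge[OF finSp, of M] card_special_digits[OF m] by (intro mult_right_mono) auto
  also have "\<dots> = fact (2 * m + 1) * real (card (simplex_points ?Sp M) * p ^ (m * m - m))" by simp
  also have "\<dots> \<le> fact (2 * m + 1) * real (card (digit_functions m p M))"
    using c by (intro mult_left_mono) (simp_all only: of_nat_le_iff fact_ge_zero)
  finally show ?thesis .
qed

context finite_field begin

lemma polys_pow:
  assumes "u \<in> polys (Suc a)"
  shows "u [^]\<^bsub>UP F\<^esub> (n :: nat) \<in> polys (Suc (a * n))"
proof (induction n)
  case 0
  show ?case using one_in_polys by simp
next
  case (Suc n)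
  then show ?case using polys_mult[OF Suc.IH assms] by (simp add: add.commute)
qed

end

context evaluation_setting begin

text \<open>The degree on an \<open>H\<close>-orbit of
  \<open>g ^ (p ^ j) = x ^ (p ^ (m + j)) - x ^ (p ^ j)\<close>, as an upper bound, after both
  exponents of \<open>p\<close> are reduced modulo \<open>m + 1\<close>.\<close>

definition digit_weight :: "nat \<Rightarrow> nat" where
  "digit_weight j = max (p ^ ((m + j) mod (m + 1))) (p ^ (j mod (m + 1)))"

text \<open>On an \<open>H\<close>-orbit the map \<open>x \<mapsto> x ^ (p ^ e)\<close> depends on \<open>e\<close> modulo \<open>m + 1\<close> only, up to a
  constant factor, because \<open>H\<close> lies in the field with \<open>p ^ (m + 1)\<close> elements.\<close>

lemma frobenius_on_right_orbit:
  assumes \<beta>: "\<beta> \<in> \<Omega>"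
  shows "\<exists>t\<in>polys (Suc (p ^ (e mod (m + 1)))). \<forall>x\<in>(\<lambda>h. h \<otimes> \<beta>) ` H. ev t x = x [^] (p ^ e)"
proof -
  let ?b = "e mod (m + 1)"
  have bc: "\<beta> \<in> carrier F" "\<beta> \<noteq> \<zero>" using \<beta> \<Omega>_carrier zero_notin_\<Omega> by auto
  have bn: "\<beta> [^] (p ^ ?b) \<in> carrier F - {\<zero>}"
    using bc group.is_monoid[OF field_mult_group, THEN monoid.nat_pow_closed, of \<beta> "p ^ ?b"]
    by (auto simp: nat_pow_mult_of)
  define c where "c = \<beta> [^] (p ^ e) \<otimes> inv (\<beta> [^] (p ^ ?b))"
  have ib: "inv (\<beta> [^] (p ^ ?b)) \<in> carrier F" "inv (\<beta> [^] (p ^ ?b)) \<otimes> \<beta> [^] (p ^ ?b) = \<one>"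
    using inv_nonzero[OF bn] bn by (auto simp: field_Units)
  have c: "c \<in> carrier F" using bc ib by (simp add: c_def)
  have "ev (up_ring.monom (UP F) c (p ^ ?b)) x = x [^] (p ^ e)" if x: "x \<in> (\<lambda>h. h \<otimes> \<beta>) ` H" for x
  proof -
    from x obtain h where h: "h \<in> H" "x = h \<otimes> \<beta>" by (rule imageE)
    have hc: "h \<in> carrier F" using h H_carrier by auto
    have "e = (m + 1) * (e div (m + 1)) + ?b" by (simp only: mult_div_mod_eq)
    then have "h [^] (p ^ e) = (h [^] (p ^ ((m + 1) * (e div (m + 1))))) [^] (p ^ ?b)"
      using hc by (metis nat_pow_pow power_add)
    also have "h [^] (p ^ ((m + 1) * (e div (m + 1)))) = h"
      using subfield_pow_iterate[OF K] h(1) H_subset_K by blast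
    finally have hp: "h [^] (p ^ e) = h [^] (p ^ ?b)" .
    have "ev (up_ring.monom (UP F) c (p ^ ?b)) x = c \<otimes> x [^] (p ^ ?b)"
      using c hc bc h by (intro U.evalRR_monom) auto
    also have "\<dots> = c \<otimes> (h [^] (p ^ ?b) \<otimes> \<beta> [^] (p ^ ?b))"
      using h(2) hc bc by (simp add: nat_pow_distrib)
    also have "\<dots> = h [^] (p ^ ?b) \<otimes> (\<beta> [^] (p ^ e) \<otimes> (inv (\<beta> [^] (p ^ ?b)) \<otimes> \<beta> [^] (p ^ ?b)))"
      unfolding c_def using hc bc ib(1) bn by (simp add: m_ac)
    also have "\<dots> = h [^] (p ^ e) \<otimes> \<beta> [^] (p ^ e)" using ib(2) bc by (simp add: hp)
    also have "\<dots> = x [^] (p ^ e)" using h(2) hc bc by (simp add: nat_pow_distrib)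
    finally show ?thesis .
  qed
  moreover have "up_ring.monom (UP F) c (p ^ ?b) \<in> polys (Suc (p ^ ?b))" using c by (intro polys_monom) auto
  ultimately show ?thesis by blast
qed

text \<open>The power of \<open>g\<close> is split along the digits of its exponent. Each factor
  \<open>g ^ (p ^ j)\<close> is a difference of two monomials by the Frobenius map, so it can be
  lowered on the orbit separately, and the degrees add up with the digits as multiplicities.\<close>

lemma poly_g_power_on_right_orbit:
  assumes \<beta>: "\<beta> \<in> \<Omega>"
  shows "\<exists>t\<in>polys (Suc (\<Sum>j<n. d j * digit_weight j)).
    \<forall>x\<in>(\<lambda>h. h \<otimes> \<beta>) ` H. ev t x = ev (poly_g F G) x [^] (\<Sum>j<n. d j * p ^ j)"
proof (induction n)
  case 0
  have "x \<in> carrier F" if "x \<in> (\<lambda>h. h \<otimes> \<beta>) ` H" for x using that \<beta> \<Omega>_carrier H_carrier by auto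
  then have "ev \<one>\<^bsub>UP F\<^esub> x = ev (poly_g F G) x [^] (0 :: nat)" if "x \<in> (\<lambda>h. h \<otimes> \<beta>) ` H" for x
    using U.evalRR_one that by (simp only: nat_pow_0)
  then show ?case unfolding lessThan_0 sum.empty using one_in_polys[of "Suc 0"] by blast
next
  case (Suc n)
  have xc: "x \<in> carrier F" if "x \<in> (\<lambda>h. h \<otimes> \<beta>) ` H" for x using that \<beta> \<Omega>_carrier H_carrier by auto
  obtain t where t: "t \<in> polys (Suc (\<Sum>j<n. d j * digit_weight j))"
    and tx: "\<And>x. x \<in> (\<lambda>h. h \<otimes> \<beta>) ` H \<Longrightarrow> ev t x = ev (poly_g F G) x [^] (\<Sum>j<n. d j * p ^ j)"
    using Suc.IH by blast
  obtain u where u: "u \<in> polys (Suc (p ^ ((m + n) mod (m + 1))))"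
    and ux: "\<And>x. x \<in> (\<lambda>h. h \<otimes> \<beta>) ` H \<Longrightarrow> ev u x = x [^] (p ^ (m + n))"
    using frobenius_on_right_orbit[OF \<beta>, of "m + n"] by auto
  obtain w where w: "w \<in> polys (Suc (p ^ (n mod (m + 1))))"
    and wx: "\<And>x. x \<in> (\<lambda>h. h \<otimes> \<beta>) ` H \<Longrightarrow> ev w x = x [^] (p ^ n)"
    using frobenius_on_right_orbit[OF \<beta>, of n] by auto
  let ?v = "u \<ominus>\<^bsub>UP F\<^esub> w"
  have "u \<in> polys (Suc (digit_weight n))" "w \<in> polys (Suc (digit_weight n))"
    using u w polys_mono[of "Suc (p ^ ((m + n) mod (m + 1)))" "Suc (digit_weight n)"]
      polys_mono[of "Suc (p ^ (n mod (m + 1)))" "Suc (digit_weight n)"]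
    by (auto simp: digit_weight_def simp del: mod_Suc)
  then have v: "?v \<in> polys (Suc (digit_weight n))" by (rule polys_diff)
  have cs: "t \<in> carrier (UP F)" "u \<in> carrier (UP F)" "w \<in> carrier (UP F)" "?v \<in> carrier (UP F)"
    using t u w v polysD by blast+
  have vx: "ev ?v x = ev (poly_g F G) x [^] (p ^ n)" if x: "x \<in> (\<lambda>h. h \<otimes> \<beta>) ` H" for x
  proof -
    have "ev ?v x = x [^] (p ^ (m + n)) \<ominus> x [^] (p ^ n)"
      using cs xc[OF x] ux[OF x] wx[OF x] by (simp only: U.evalRR_sub)
    also have "\<dots> = (x [^] (p ^ m) \<ominus> x) [^] (p ^ n)"
      using xc[OF x] by (simp add: frobenius_diff nat_pow_pow power_add)
    finally show ?thesis using xc[OF x] by (simp add: ev_poly_g)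
  qed
  have "t \<otimes>\<^bsub>UP F\<^esub> ?v [^]\<^bsub>UP F\<^esub> d n \<in> polys (Suc ((\<Sum>j<n. d j * digit_weight j) + digit_weight n * d n))"
    by (intro polys_mult t polys_pow v)
  then have "t \<otimes>\<^bsub>UP F\<^esub> ?v [^]\<^bsub>UP F\<^esub> d n \<in> polys (Suc (\<Sum>j<Suc n. d j * digit_weight j))"
    by (simp only: sum.lessThan_Suc mult.commute)
  moreover have "ev (t \<otimes>\<^bsub>UP F\<^esub> ?v [^]\<^bsub>UP F\<^esub> d n) x = ev (poly_g F G) x [^] (\<Sum>j<Suc n. d j * p ^ j)"
    if x: "x \<in> (\<lambda>h. h \<otimes> \<beta>) ` H" for x
  proof -
    have gc: "ev (poly_g F G) x \<in> carrier F" using xc[OF x] poly_g_closed by simp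
    have "ev (t \<otimes>\<^bsub>UP F\<^esub> ?v [^]\<^bsub>UP F\<^esub> d n) x = ev t x \<otimes> ev (?v [^]\<^bsub>UP F\<^esub> d n) x"
      using cs xc[OF x] by (intro U.evalRR_mult) auto
    also have "ev (?v [^]\<^bsub>UP F\<^esub> d n) x = ev ?v x [^] d n" using cs xc[OF x] by (intro ev_pow)
    also have "ev t x \<otimes> \<dots> = ev (poly_g F G) x [^] ((\<Sum>j<n. d j * p ^ j) + p ^ n * d n)"
      unfolding tx[OF x] vx[OF x] using gc by (simp add: nat_pow_pow nat_pow_mult)
    finally show ?thesis by (simp only: sum.lessThan_Suc mult.commute)
  qed
  ultimately show ?case by blast
qed

text \<open>Special digits have weight at most \<open>p ^ m\<close> and sum at most
  \<open>M\<close>. Any other digit is below \<open>p\<close> and has weight at most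
  \<open>p ^ (m - 1)\<close>, so it costs at most \<open>p ^ m\<close>; there are fewer than
  \<open>m * m\<close> of these, a cost that stays bounded while \<open>M\<close> grows with
  \<open>p\<close>.\<close>

lemma sum_digit_weight_le:
  assumes d: "d \<in> digit_functions m p M"
  shows "(\<Sum>j<m * (m + 1) + 1. d j * digit_weight j) \<le> (M + m * m) * p ^ m"
proof -
  let ?N = "m * (m + 1) + 1"
  let ?Sp = "special_digits m"
  let ?Fr = "{..<?N} - ?Sp"
  have Sp: "?Sp \<subseteq> {..<?N}" by (auto simp: special_digits_def)
  have p1: "1 \<le> p" using p_gt_1 by simp
  have sp: "digit_weight j \<le> p ^ m" for j
    unfolding digit_weight_def using p1
    by (intro max.boundedI power_increasing) (metis Suc_eq_plus1 lessI less_Suc_eq_le mod_less_divisor zero_less_Suc)+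
  have fr: "d j * digit_weight j \<le> p ^ m" if j: "j \<in> ?Fr" for j
  proof -
    have jm: "j mod (m + 1) \<noteq> 0" "j mod (m + 1) \<noteq> m" using j by (auto simp: special_digits_def)
    have "j mod (m + 1) < m + 1" by simp
    then have jm': "j mod (m + 1) \<le> m - 1" "1 \<le> j mod (m + 1)" using jm by linarith+
    \<comment> \<open>Adding \<open>m\<close> lowers a nonzero residue modulo \<open>m + 1\<close>
      by one.\<close>
    have "(m + j) mod (m + 1) = (m + j mod (m + 1)) mod (m + 1)" by (simp only: mod_add_right_eq)
    also have "m + j mod (m + 1) = (j mod (m + 1) - 1) + (m + 1)" using jm' by simp
    also have "((j mod (m + 1) - 1) + (m + 1)) mod (m + 1) = (j mod (m + 1) - 1) mod (m + 1)"
      by (rule mod_add_self2)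
    also have "\<dots> = j mod (m + 1) - 1" using jm' m by (intro mod_less) linarith
    finally have "(m + j) mod (m + 1) \<le> m - 1" using jm' by linarith
    then have "digit_weight j \<le> p ^ (m - 1)"
      unfolding digit_weight_def using jm' p1 by (intro max.boundedI power_increasing) auto
    moreover have "d j \<le> p" using d j by (auto simp: digit_functions_def PiE_iff intro: less_imp_le)
    ultimately have "d j * digit_weight j \<le> p * p ^ (m - 1)" by (rule mult_le_mono[rotated])
    also have "\<dots> = p ^ m" using m by (metis Suc_1 Suc_le_D diff_Suc_1 power_Suc)
    finally show ?thesis .
  qed
  have "(\<Sum>j<?N. d j * digit_weight j) = (\<Sum>j\<in>?Sp. d j * digit_weight j) + (\<Sum>j\<in>?Fr. d j * digit_weight j)"
    using sum.subset_diff[OF Sp finite_lessThan, of "\<lambda>j. d j * digit_weight j"] by (simp only: add.commute)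
  also have "(\<Sum>j\<in>?Sp. d j * digit_weight j) \<le> (\<Sum>j\<in>?Sp. d j) * p ^ m"
    unfolding sum_distrib_right by (intro sum_mono mult_left_mono sp) auto
  also have "(\<Sum>j\<in>?Sp. d j) * p ^ m \<le> M * p ^ m"
    using d by (intro mult_right_mono) (auto simp: digit_functions_def)
  also have "(\<Sum>j\<in>?Fr. d j * digit_weight j) \<le> (\<Sum>j\<in>?Fr. p ^ m)" by (intro sum_mono fr)
  also have "(\<Sum>j\<in>?Fr. p ^ m) \<le> m * m * p ^ m"
  proof -
    have "card ?Fr = ?N - (2 * m + 1)"
      using card_Diff_subset[OF finite_subset[OF Sp finite_lessThan] Sp] card_special_digits[of m] m by simp
    also have "\<dots> \<le> m * m" by simp
    finally show ?thesis unfolding sum_constant of_nat_id by (rule mult_right_mono) simp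
  qed
  finally show ?thesis by (simp add: distrib_right)
qed

text \<open>A free coefficient with \<open>k\<close> parameters is placed at every exponent in
  \<open>I\<close>, and uniqueness of base expansions makes the resulting messages distinct. In
  \<open>bound\<close>, one summand \<open>p ^ m\<close> pays for the coefficient and
  \<open>(M + m * m) * p ^ m\<close> for the power of \<open>g\<close> on an
  \<open>H\<close>-orbit.\<close>

lemma code_dim_ge:
  fixes r :: real
  assumes r: "0 < r" "r < 1" and M: "M < p" and bound: "real ((M + m * m + 1) * p ^ m) \<le> r * card H"
  shows "nat \<lceil>r * card G\<rceil> * card (digit_functions m p M)
    \<le> vectorspace.dim F ((ring.func_space F \<Omega>)\<lparr>carrier := eval_word F \<Omega> ` msgs r\<rparr>)"
proof -
  let ?N = "m * (m + 1) + 1"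
  define k where "k = nat \<lceil>r * card G\<rceil>"
  define \<iota> where "\<iota> = (\<lambda>d. \<Sum>j<?N. d j * p ^ j)"
  define I where "I = \<iota> ` digit_functions m p M"
  define n where "n = card H * p ^ (m * m)"
  have cG: "card G = p ^ m" by (rule G(2))
  have pm: "0 < p ^ m" using p_gt_1 by simp
  have k0: "0 < k" using r pm by (simp add: k_def cG)
  have kG: "k \<le> p ^ m"
    using r mult_right_mono[of r 1 "real (p ^ m)"] by (simp add: k_def cG ceiling_le_iff nat_le_iff)
  have c\<Omega>: "card \<Omega> = p ^ m * n" by (simp add: card_\<Omega> order_A n_def power_add)
  have "inj_on \<iota> (digit_functions m p M)"
  proof (rule inj_onI)
    fix d d' assume d: "d \<in> digit_functions m p M" "d' \<in> digit_functions m p M" and e: "\<iota> d = \<iota> d'"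
    have "d j = d' j" if "j < ?N" for j
      by (rule digit_sum_inj[OF _ _ e[unfolded \<iota>_def] that]) (use d in \<open>auto simp: digit_functions_def PiE_iff\<close>)
    then show "d = d'" using d by (intro PiE_ext[of d "{..<?N}" "\<lambda>_. {..<p}"]) (auto simp: digit_functions_def)
  qed
  then have cI: "card I = card (digit_functions m p M)" by (simp add: I_def card_image)
  have finI: "finite I" by (simp add: I_def finite_digit_functions)
  have MH: "M + 1 \<le> card H div p ^ m \<and> (M + 1) * p ^ m \<le> card H"
  proof -
    have "real ((M + 1) * p ^ m) \<le> real ((M + m * m + 1) * p ^ m)" by (intro of_nat_mono mult_right_mono) auto
    also have "\<dots> \<le> r * card H" by (rule bound)
    also have "\<dots> \<le> 1 * real (card H)" using r by (intro mult_right_mono) auto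
    finally have "(M + 1) * p ^ m \<le> card H" by (simp only: mult_1 of_nat_le_iff)
    then show ?thesis using pm by (simp only: less_eq_div_iff_mult_less_eq)
  qed
  have I_less: "p ^ m * (i + 1) \<le> card \<Omega>" "i < n" if "i \<in> I" for i
  proof -
    obtain d where d: "d \<in> digit_functions m p M" "i = \<iota> d" using \<open>i \<in> I\<close> by (auto simp: I_def)
    \<comment> \<open>The highest position is itself special, so its digit is at most
      \<open>M\<close>. This keeps \<open>i\<close> below \<open>(M + 1) * p ^ (m * (m + 1))\<close>
      and the degree of the message below \<open>card \<Omega>\<close>.\<close>
    have top: "m * (m + 1) \<in> special_digits m" by (simp add: special_digits_def del: mult_Suc_right add_Suc_right)
    have "finite (special_digits m)" by (rule finite_subset[of _ "{..<?N}"]) (auto simp: special_digits_def)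
    then have "d (m * (m + 1)) \<le> M"
      using d(1) member_le_sum[OF top, of d] by (simp add: digit_functions_def)
    have "(\<Sum>j<m * (m + 1). d j * p ^ j) < p ^ (m * (m + 1))"
      by (rule digit_sum_less) (use d(1) in \<open>auto simp: digit_functions_def PiE_iff\<close>)
    moreover have "i = (\<Sum>j<m * (m + 1). d j * p ^ j) + d (m * (m + 1)) * p ^ (m * (m + 1))"
      by (simp add: d(2) \<iota>_def)
    moreover have "d (m * (m + 1)) * p ^ (m * (m + 1)) \<le> M * p ^ (m * (m + 1))"
      using \<open>d (m * (m + 1)) \<le> M\<close> by (rule mult_right_mono) simp
    ultimately have "i + 1 \<le> p ^ (m * (m + 1)) + M * p ^ (m * (m + 1))" by linarith
    then have "p ^ m * (i + 1) \<le> p ^ m * ((M + 1) * p ^ (m * (m + 1)))" by (intro mult_left_mono) auto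
    also have "\<dots> = ((M + 1) * p ^ m) * p ^ (m * (m + 1))" by (simp only: mult_ac)
    also have "\<dots> \<le> card H * p ^ (m * (m + 1))" using MH by (intro mult_right_mono) auto
    finally show le: "p ^ m * (i + 1) \<le> card \<Omega>" by (simp add: card_\<Omega> order_A)
    show "i < n" using le pm unfolding c\<Omega> by (simp only: nat_mult_le_cancel1 Suc_eq_plus1[symmetric] Suc_le_eq)
  qed
  define ext where "ext = (\<lambda>c :: nat \<Rightarrow> nat \<Rightarrow> 'a. \<lambda>i. if i \<in> I then c i else \<zero>\<^bsub>UP F\<^esub>)"
  define \<Phi> where "\<Phi> = (\<lambda>c. expand (poly_g F G) (ext c) n)"
  have g1: "1 \<le> p ^ m" using pm by linarith
  have ext_k: "ext c i \<in> polys k" if "c \<in> I \<rightarrow>\<^sub>E polys k" for c i using that by (auto simp: ext_def)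
  have ext_G: "ext c i \<in> polys (p ^ m)" if "c \<in> I \<rightarrow>\<^sub>E polys k" for c i
    using ext_k[OF that] polys_mono[OF kG] by blast
  have ext0: "ext c i = \<zero>\<^bsub>UP F\<^esub>" if "n \<le> i" for c i
    using I_less(2)[of i] that by (auto simp: ext_def)
  have g_polys: "poly_g F G \<in> polys (Suc (p ^ m))"
    using polys_iff_deg[OF poly_g_closed, of "Suc (p ^ m)"] deg_poly_g by simp
  have k1: "Suc (k - 1) = k" using k0 by simp
  have \<Phi>_msgs: "\<Phi> c \<in> msgs r" if c: "c \<in> I \<rightarrow>\<^sub>E polys k" for c
  proof -
    have ecl: "ext c i \<in> carrier (UP F)" for i using ext_k[OF c] by (rule polysD)
    have deg: "\<Phi> c \<in> polys (card \<Omega>)"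
      unfolding \<Phi>_def expand_def
    proof (rule polys_finsum)
      fix i
      show "ext c i \<otimes>\<^bsub>UP F\<^esub> poly_g F G [^]\<^bsub>UP F\<^esub> i \<in> polys (card \<Omega>)"
      proof (cases "i \<in> I")
        case True
        have "ext c i \<otimes>\<^bsub>UP F\<^esub> poly_g F G [^]\<^bsub>UP F\<^esub> i \<in> polys (Suc ((k - 1) + p ^ m * i))"
          by (intro polys_mult polys_pow g_polys) (use ext_k[OF c] k1 in simp)
        moreover have "Suc ((k - 1) + p ^ m * i) \<le> card \<Omega>"
        proof -
          have "Suc ((k - 1) + p ^ m * i) = k + p ^ m * i" using k0 by simp
          also have "\<dots> \<le> p ^ m * (i + 1)" using kG by simp
          finally show ?thesis using I_less(1)[OF True] by simp
        qed
        ultimately show ?thesis using polys_mono by blast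
      next
        case False
        then show ?thesis using poly_g_closed by (simp add: ext_def)
      qed
    qed simp
    have "base_deg F (poly_g F G) (\<Phi> c) < ereal (r * card G)"
      unfolding \<Phi>_def
      by (subst base_deg_less_iff[OF poly_g_closed deg_poly_g g1 ext_G[OF c] ext0])
        (use ext_k[OF c] in \<open>auto simp: k_def\<close>)
    then have left: "\<forall>S\<in>left_orbits F G H \<alpha>. eval_word F S (\<Phi> c) \<in> RS_code F S (r * real (card G))"
      using base_deg_g_iff[OF deg] by blast
    \<comment> \<open>\<open>\<Phi> c\<close> may itself have large degree. On one fixed orbit each
      of its terms takes the same values as some \<open>t i\<close> of small degree; the choice
      depends on the orbit.\<close>
    have right: "eval_word F S (\<Phi> c) \<in> RS_code F S (r * real (card H))" if S: "S \<in> right_orbits F G H \<alpha>" for S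
    proof -
      let ?K = "nat \<lceil>r * real (card H)\<rceil>"
      obtain \<beta> where \<beta>: "\<beta> \<in> \<Omega>" and Se: "S = (\<lambda>h. h \<otimes> \<beta>) ` H" using S by (auto simp: right_orbits_eq)
      have xc: "x \<in> carrier F" if "x \<in> S" for x using that orbits_subset(2)[OF S] \<Omega>_carrier by blast
      have "\<exists>t\<in>polys ?K. \<forall>x\<in>S. ev t x = ev (ext c i \<otimes>\<^bsub>UP F\<^esub> poly_g F G [^]\<^bsub>UP F\<^esub> i) x" for i
      proof (cases "i \<in> I")
        case True
        then obtain d where d: "d \<in> digit_functions m p M" "i = \<iota> d" by (auto simp: I_def)
        obtain t where t: "t \<in> polys (Suc (\<Sum>j<?N. d j * digit_weight j))"
          and tx: "\<And>x. x \<in> S \<Longrightarrow> ev t x = ev (poly_g F G) x [^] i"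
          using poly_g_power_on_right_orbit[OF \<beta>, where d = d and n = ?N] unfolding Se d(2) \<iota>_def by blast
        have tc: "t \<in> carrier (UP F)" using t by (rule polysD)
        have "ext c i \<otimes>\<^bsub>UP F\<^esub> t \<in> polys (Suc ((k - 1) + (\<Sum>j<?N. d j * digit_weight j)))"
          by (intro polys_mult t) (use ext_k[OF c] k1 in simp)
        moreover have "Suc ((k - 1) + (\<Sum>j<?N. d j * digit_weight j)) \<le> ?K"
        proof -
          have "Suc ((k - 1) + (\<Sum>j<?N. d j * digit_weight j)) \<le> p ^ m + (M + m * m) * p ^ m"
            using sum_digit_weight_le[OF d(1)] kG k0 by linarith
          also have "\<dots> = (M + m * m + 1) * p ^ m" by (simp add: distrib_right)
          also have "\<dots> \<le> ?K" using bound by linarith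
          finally show ?thesis .
        qed
        ultimately have "ext c i \<otimes>\<^bsub>UP F\<^esub> t \<in> polys ?K" using polys_mono by blast
        moreover have "ev (ext c i \<otimes>\<^bsub>UP F\<^esub> t) x = ev (ext c i \<otimes>\<^bsub>UP F\<^esub> poly_g F G [^]\<^bsub>UP F\<^esub> i) x" if x: "x \<in> S" for x
        proof -
          have "ev (poly_g F G [^]\<^bsub>UP F\<^esub> i) x = ev t x" unfolding tx[OF x] by (rule ev_pow[OF poly_g_closed xc[OF x]])
          then show ?thesis
            using U.evalRR_mult[OF ecl tc xc[OF x]] U.evalRR_mult[OF ecl U.P.nat_pow_closed[OF poly_g_closed] xc[OF x]] by metis
        qed
        ultimately show ?thesis by blast
      next
        case False
        then show ?thesis using poly_g_closed by (intro bexI[of _ "\<zero>\<^bsub>UP F\<^esub>"]) (auto simp: ext_def)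
      qed
      then obtain t where t: "\<And>i. t i \<in> polys ?K"
        and tx: "\<And>i x. x \<in> S \<Longrightarrow> ev (t i) x = ev (ext c i \<otimes>\<^bsub>UP F\<^esub> poly_g F G [^]\<^bsub>UP F\<^esub> i) x"
        by metis
      have tc: "t i \<in> carrier (UP F)" for i using t by (rule polysD)
      have "ev (\<Oplus>\<^bsub>UP F\<^esub>i\<in>{..<n}. t i) x = ev (\<Phi> c) x" if x: "x \<in> S" for x
      proof -
        have "ev (\<Oplus>\<^bsub>UP F\<^esub>i\<in>{..<n}. t i) x = (\<Oplus>i\<in>{..<n}. ev (t i) x)"
          by (rule ev_finsum) (use tc xc[OF x] in auto)
        also have "\<dots> = (\<Oplus>i\<in>{..<n}. ev (ext c i \<otimes>\<^bsub>UP F\<^esub> poly_g F G [^]\<^bsub>UP F\<^esub> i) x)"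
          using ecl poly_g_closed xc[OF x] by (intro add.finprod_cong') (auto simp: tx[OF x])
        also have "\<dots> = ev (\<Phi> c) x"
          unfolding \<Phi>_def expand_def by (rule ev_finsum[symmetric]) (use ecl poly_g_closed xc[OF x] in auto)
        finally show ?thesis .
      qed
      then have "eval_word F S (\<Phi> c) = eval_word F S (\<Oplus>\<^bsub>UP F\<^esub>i\<in>{..<n}. t i)"
        unfolding eval_word_def by (intro restrict_ext) simp
      moreover have "(\<Oplus>\<^bsub>UP F\<^esub>i\<in>{..<n}. t i) \<in> polys ?K" using t by (intro polys_finsum) auto
      ultimately show ?thesis by (simp add: RS_code_eq)
    qed
    show ?thesis unfolding msgs_def using deg left right by blast
  qed
  have \<Phi>_inj: "inj_on \<Phi> (I \<rightarrow>\<^sub>E polys k)"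
  proof (rule inj_onI)
    fix c c' assume c: "c \<in> I \<rightarrow>\<^sub>E polys k" "c' \<in> I \<rightarrow>\<^sub>E polys k" and e: "\<Phi> c = \<Phi> c'"
    have all: "\<forall>i<n. ext c i = ext c' i"
      by (rule expansion_unique[OF poly_g_closed deg_poly_g g1 ext_G[OF c(1)] ext_G[OF c(2)] e[unfolded \<Phi>_def]])
    show "c = c'"
    proof (rule PiE_ext[OF c])
      fix i assume i: "i \<in> I"
      then show "c i = c' i" using all[rule_format, OF I_less(2)[OF i]] by (simp add: ext_def)
    qed
  qed
  have "inj_on (eval_word F \<Omega>) (msgs r)"
    using eval_word_inj[OF \<Omega>_carrier order_refl] by (rule inj_on_subset) (auto simp: msgs_def)
  then have cC: "card (eval_word F \<Omega> ` msgs r) = card (msgs r)" by (rule card_image)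
  have "(card (carrier F) ^ k) ^ card I = card (I \<rightarrow>\<^sub>E polys k)"
    using finI by (simp add: card_PiE card_polys)
  also have "\<dots> = card (\<Phi> ` (I \<rightarrow>\<^sub>E polys k))" using \<Phi>_inj by (simp add: card_image)
  also have "\<dots> \<le> card (msgs r)"
  proof (rule card_mono)
    show "finite (msgs r)" by (rule finite_subset[OF _ finite_polys[of "card \<Omega>"]]) (auto simp: msgs_def)
  qed (use \<Phi>_msgs in blast)
  also have "\<dots> = card (carrier F) ^ vectorspace.dim F ((ring.func_space F \<Omega>)\<lparr>carrier := eval_word F \<Omega> ` msgs r\<rparr>)"
    unfolding cC[symmetric]
  proof (rule card_eval_code[OF \<Omega>_carrier])
    have cl: "eval_word F S (f \<oplus>\<^bsub>UP F\<^esub> g) \<in> RS_code F S t"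
      if h: "S \<subseteq> \<Omega>" "f \<in> carrier (UP F)" "g \<in> carrier (UP F)" "eval_word F S f \<in> RS_code F S t" "eval_word F S g \<in> RS_code F S t"
      for S f g t
    proof -
      obtain u v where u: "u \<in> polys (nat \<lceil>t\<rceil>)" "eval_word F S f = eval_word F S u"
        and v: "v \<in> polys (nat \<lceil>t\<rceil>)" "eval_word F S g = eval_word F S v"
        using h by (auto simp: RS_code_eq)
      have uc: "u \<in> carrier (UP F)" "v \<in> carrier (UP F)" using u v polysD by auto
      have "eval_word F S (f \<oplus>\<^bsub>UP F\<^esub> g) = eval_word F S (u \<oplus>\<^bsub>UP F\<^esub> v)"
        unfolding eval_word_def
      proof (rule restrict_ext)
        fix x assume x: "x \<in> S"
        have "x \<in> carrier F" using x h(1) \<Omega>_carrier by blast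
        moreover have "ev f x = ev u x" "ev g x = ev v x"
          using fun_cong[OF u(2), of x] fun_cong[OF v(2), of x] x by (auto simp: eval_word_def)
        ultimately show "ev (f \<oplus>\<^bsub>UP F\<^esub> g) x = ev (u \<oplus>\<^bsub>UP F\<^esub> v) x"
          using h uc by (simp only: U.evalRR_add)
      qed
      then show ?thesis using u v by (auto simp: RS_code_eq)
    qed
    have cs: "eval_word F S (a \<odot>\<^bsub>UP F\<^esub> f) \<in> RS_code F S t"
      if h: "S \<subseteq> \<Omega>" "f \<in> carrier (UP F)" "a \<in> carrier F" "eval_word F S f \<in> RS_code F S t" for S f a t
    proof -
      obtain u where u: "u \<in> polys (nat \<lceil>t\<rceil>)" "eval_word F S f = eval_word F S u"
        using h by (auto simp: RS_code_eq)
      have uc: "u \<in> carrier (UP F)" using u polysD by auto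
      have "eval_word F S (a \<odot>\<^bsub>UP F\<^esub> f) = eval_word F S (a \<odot>\<^bsub>UP F\<^esub> u)"
        unfolding eval_word_def
      proof (rule restrict_ext)
        fix x assume x: "x \<in> S"
        have "x \<in> carrier F" using x h(1) \<Omega>_carrier by blast
        moreover have "ev f x = ev u x" using fun_cong[OF u(2), of x] x by (auto simp: eval_word_def)
        ultimately show "ev (a \<odot>\<^bsub>UP F\<^esub> f) x = ev (a \<odot>\<^bsub>UP F\<^esub> u) x"
          using h uc by (simp only: ev_smult)
      qed
      then show ?thesis using u h(3) by (auto simp: RS_code_eq)
    qed
    show "msgs r \<subseteq> carrier (UP F)" by (auto simp: msgs_def dest: polysD)
    show "\<zero>\<^bsub>UP F\<^esub> \<in> msgs r" by (rule zero_in_msgs)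
    show "f \<oplus>\<^bsub>UP F\<^esub> g \<in> msgs r" if "f \<in> msgs r" "g \<in> msgs r" for f g
    proof -
      have fg: "f \<in> polys (card \<Omega>)" "g \<in> polys (card \<Omega>)" using that unfolding msgs_def by blast+
      show ?thesis
        using that polys_add[OF fg] cl[OF orbits_subset(1) polysD[OF fg(1)] polysD[OF fg(2)]]
          cl[OF orbits_subset(2) polysD[OF fg(1)] polysD[OF fg(2)]] unfolding msgs_def by simp
    qed
    show "a \<odot>\<^bsub>UP F\<^esub> f \<in> msgs r" if "a \<in> carrier F" "f \<in> msgs r" for a f
    proof -
      have f: "f \<in> polys (card \<Omega>)" using that unfolding msgs_def by blast
      show ?thesis
        using that polys_smult[OF that(1) f] cs[OF orbits_subset(1) polysD[OF f] that(1)]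
          cs[OF orbits_subset(2) polysD[OF f] that(1)] unfolding msgs_def by simp
    qed
  qed
  finally have "card (carrier F) ^ (k * card I)
      \<le> card (carrier F) ^ vectorspace.dim F ((ring.func_space F \<Omega>)\<lparr>carrier := eval_word F \<Omega> ` msgs r\<rparr>)"
    by (simp only: power_mult)
  then show ?thesis using card_field_gt_1 by (simp add: cI k_def)
qed

text \<open>The factors \<open>p ^ m\<close> from the coefficients and
  \<open>p ^ (m * m - m)\<close> from the free digits cancel against \<open>p ^ (m * m)\<close> in
  \<open>card \<Omega>\<close>.\<close>

lemma code_rate_ge:
  fixes r :: real
  assumes r: "0 < r" "r < 1" and M: "M < p" and bound: "real ((M + m * m + 1) * p ^ m) \<le> r * card H"
  shows "r * real M ^ (2 * m + 1) / (fact (2 * m + 1) * (real (card H) * real p ^ m))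
    \<le> code_rate F \<Omega> (eval_code F G H \<alpha> r (int (Coset.order A)))"
proof -
  define d where "d = vectorspace.dim F ((ring.func_space F \<Omega>)\<lparr>carrier := eval_word F \<Omega> ` msgs r\<rparr>)"
  have m1: "1 \<le> m" using m by simp
  have p0: "0 < real p" using p_gt_1 by simp
  define k where "k = nat \<lceil>r * card G\<rceil>"
  have rk: "r * real (p ^ m) \<le> real k" unfolding k_def G(2) by linarith
  have "(r * real (p ^ m)) * (real M ^ (2 * m + 1) * real p ^ (m * m - m))
      \<le> real k * (fact (2 * m + 1) * real (card (digit_functions m p M)))"
    by (rule mult_mono[OF rk card_digit_functions[OF m1 M]]) (use r in auto)
  also have "\<dots> = fact (2 * m + 1) * real (k * card (digit_functions m p M))" by simp
  also have "\<dots> \<le> fact (2 * m + 1) * real d"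
    unfolding d_def k_def using code_dim_ge[OF r M bound] by (intro mult_left_mono) (simp_all only: of_nat_le_iff fact_ge_zero)
  finally have le: "(r * real (p ^ m)) * (real M ^ (2 * m + 1) * real p ^ (m * m - m)) \<le> fact (2 * m + 1) * real d" .
  have "real p ^ m * real p ^ (m * m - m) = real p ^ (m * m)"
    using m1 by (simp flip: power_add)
  moreover have "(r * real (p ^ m)) * (real M ^ (2 * m + 1) * real p ^ (m * m - m))
      = r * real M ^ (2 * m + 1) * (real p ^ m * real p ^ (m * m - m))"
    by (simp only: of_nat_power mult_ac)
  ultimately have le': "r * real M ^ (2 * m + 1) * real p ^ (m * m) \<le> fact (2 * m + 1) * real d"
    using le by (simp only:)
  have c\<Omega>: "real (card \<Omega>) = real (card H) * real p ^ m * real p ^ (m * m)"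
    by (simp add: card_\<Omega> order_A power_add mult_ac)
  have "r * real M ^ (2 * m + 1) / (fact (2 * m + 1) * (real (card H) * real p ^ m))
      = (r * real M ^ (2 * m + 1) * real p ^ (m * m)) / (fact (2 * m + 1) * real (card \<Omega>))"
  proof -
    have "x / (f * (c * a)) = (x * b) / (f * (c * a * b))" if "b \<noteq> 0" for x f c a b :: real
      using that by (simp add: field_simps)
    then show ?thesis unfolding c\<Omega> using p0 by simp
  qed
  also have "\<dots> \<le> (fact (2 * m + 1) * real d) / (fact (2 * m + 1) * real (card \<Omega>))"
    using le' by (intro divide_right_mono) auto
  also have "\<dots> = real d / card \<Omega>" by simp
  finally show ?thesis by (simp add: code_rate_def eval_code_eq d_def)
qed

end

section \<open>Asymptotics\<close>

lemma eventually_at_top_admissible: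
  assumes "\<And>p. p \<in> admissible_primes \<gamma> \<Longrightarrow> N \<le> p \<Longrightarrow> P p"
  shows "eventually P (at_top_admissible \<gamma>)"
  unfolding at_top_admissible_def eventually_inf_principal eventually_at_top_linorder
  using assms by blast

lemma tendsto_at_top_admissible:
  "(f \<longlongrightarrow> l) at_top \<Longrightarrow> (f \<longlongrightarrow> l) (at_top_admissible \<gamma>)"
  unfolding at_top_admissible_def by (rule tendsto_mono[OF inf_le1])

lemma tendsto_le_Liminf:
  fixes f g :: "'a \<Rightarrow> real"
  assumes "(f \<longlongrightarrow> l) \<F>" and "eventually (\<lambda>x. f x \<le> g x) \<F>"
  shows "ereal l \<le> Liminf \<F> (\<lambda>x. ereal (g x))"
  unfolding le_Liminf_iff
proof (intro allI impI)
  fix y assume "y < ereal l"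
  then have "eventually (\<lambda>x. y < ereal (f x)) \<F>"
    using assms(1) by (intro order_tendstoD(1)[of "\<lambda>x. ereal (f x)"]) auto
  then show "eventually (\<lambda>x. y < ereal (g x)) \<F>"
    using assms(2) by eventually_elim (metis ereal_less_eq(3) less_le_trans)
qed

text \<open>\<open>n\<close> and \<open>f\<close> are compared through an auxiliary
  \<open>x\<close>, with the same lower constant \<open>c\<close> and upper constant 1. It is
  applied with \<open>x p\<close> equal to \<open>p\<close> to the power
  \<open>(m + 1)\<^sup>2\<close>, where \<open>x p powr e\<close> is an exact power of
  \<open>p\<close>.\<close>

lemma bigtheta_powr:
  fixes f n x :: "nat \<Rightarrow> real"
  assumes c: "0 < c" and e: "0 \<le> e"
    and ev: "eventually (\<lambda>p. 0 \<le> x p \<and> c * x p \<le> n p \<and> n p \<le> x p \<and>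
      c * x p powr e \<le> f p \<and> f p \<le> x p powr e) \<F>"
  shows "f \<in> \<Theta>[\<F>](\<lambda>p. n p powr e)"
proof (rule bigthetaI)
  show "f \<in> O[\<F>](\<lambda>p. n p powr e)"
  proof (rule bigoI[of _ "(1 / c) powr e"])
    show "eventually (\<lambda>p. norm (f p) \<le> (1 / c) powr e * norm (n p powr e)) \<F>"
      using ev
    proof eventually_elim
      case (elim p)
      have f0: "0 \<le> f p" using elim c by (meson mult_nonneg_nonneg less_imp_le order_trans powr_ge_zero)
      have "x p powr e = (1 / c * (c * x p)) powr e" using c by simp
      also have "\<dots> = (1 / c) powr e * (c * x p) powr e" by (rule powr_mult)
      also have "\<dots> \<le> (1 / c) powr e * n p powr e"
        using c elim e by (intro mult_left_mono powr_mono2) auto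
      finally show ?case using f0 elim by simp
    qed
  qed
  show "f \<in> \<Omega>[\<F>](\<lambda>p. n p powr e)"
    unfolding bigomega_iff_bigo
  proof (rule bigoI[of _ "1 / c"])
    show "eventually (\<lambda>p. norm (n p powr e) \<le> 1 / c * norm (f p)) \<F>"
      using ev
    proof eventually_elim
      case (elim p)
      have f0: "0 \<le> f p" using elim c by (meson mult_nonneg_nonneg less_imp_le order_trans powr_ge_zero)
      have "0 \<le> n p" using elim c by (meson mult_nonneg_nonneg less_imp_le order_trans)
      then have "n p powr e \<le> x p powr e" using elim e by (intro powr_mono2) auto
      also have "\<dots> \<le> 1 / c * f p" using elim c by (simp add: field_simps)
      finally show ?case using f0 by simp
    qed
  qed
qed

text \<open>\<open>\<gamma> (p - 1)\<close> is a positive integer, hence at least \<open>1\<close>, which forces \<open>p ^ m < card H\<close>.\<close>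

lemma code_setting_evaluation_setting:
  assumes cs: "code_setting p m \<gamma> F G H \<alpha>" and adm: "p \<in> admissible_primes \<gamma>"
    and m: "2 \<le> m" and \<gamma>: "0 < \<gamma>"
  shows "\<exists>K. evaluation_setting F p m G K H \<alpha>"
proof -
  have p: "prime p" and int: "\<gamma> * (real p - 1) \<in> \<int>" using adm by (auto simp: admissible_primes_def)
  have p1: "1 < real p" using prime_gt_1_nat[OF p] by simp
  obtain z :: int where z: "\<gamma> * (real p - 1) = of_int z" using int by (elim Ints_cases)
  have "0 < \<gamma> * (real p - 1)" using \<gamma> p1 by simp
  then have ge1: "1 \<le> \<gamma> * (real p - 1)" unfolding z by simp
  \<comment> \<open>The sum is the cofactor of \<open>p - 1\<close> in
    \<open>p ^ (m + 1) - 1\<close>, and it exceeds its last term \<open>p ^ m\<close>.\<close>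
  have "real p ^ m < (\<Sum>i<m + 1. real p ^ i)"
    using p1 m sum_pos[of "{..<m}" "\<lambda>i. real p ^ i"] by (simp add: lessThan_empty_iff)
  also have "\<dots> \<le> (\<gamma> * (real p - 1)) * (\<Sum>i<m + 1. real p ^ i)"
    using ge1 p1 mult_right_mono[OF ge1, of "\<Sum>i<m + 1. real p ^ i"] by (simp add: sum_nonneg)
  also have "\<dots> = \<gamma> * (real p ^ (m + 1) - 1)"
    by (simp only: power_diff_1_eq mult.assoc)
  also have "\<dots> = real (card H)" using cs by (simp add: code_setting_def)
  finally have "p ^ m < card H" by (simp only: of_nat_power[symmetric] of_nat_less_iff)
  moreover obtain K where "subfield K F" "card K = p ^ (m + 1)" "subgroup H (mult_of (F\<lparr>carrier := K\<rparr>))"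
    using cs by (auto simp: code_setting_def)
  ultimately have "evaluation_setting F p m G K H \<alpha>"
    using cs p m
    by (intro evaluation_setting.intro expander_setting.intro finite_field.intro
        finite_field_axioms.intro expander_setting_axioms.intro evaluation_setting_axioms.intro)
      (simp_all add: code_setting_def)
  then show ?thesis by blast
qed

section \<open>Explicit bounds for a single prime\<close>

context evaluation_setting begin

text \<open>Orbits of both kinds have at least \<open>p ^ m\<close> points, so
  \<open>1 / p ^ m\<close> is a common error term for the rates; the distance bound holds without
  error.\<close>

lemma local_code_bounds:
  assumes r: "0 < r" "r < 1"
  shows "S \<in> left_orbits F G H \<alpha> \<Longrightarrow> code_rate F S (RS_code F S (r * real (card G))) \<le> r + 1 / real (p ^ m)"
    and "S \<in> left_orbits F G H \<alpha> \<Longrightarrow> 1 - r \<le> rel_min_dist S (RS_code F S (r * real (card G)))"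
    and "S \<in> right_orbits F G H \<alpha> \<Longrightarrow> code_rate F S (RS_code F S (r * real (card H))) \<le> r + 1 / real (p ^ m)"
    and "S \<in> right_orbits F G H \<alpha> \<Longrightarrow> 1 - r \<le> rel_min_dist S (RS_code F S (r * real (card H)))"
proof -
  have pm: "0 < p ^ m" using p_gt_1 by simp
  have *: "code_rate F S (RS_code F S (r * real (card S))) \<le> r + 1 / real (p ^ m) \<and>
      1 - r \<le> rel_min_dist S (RS_code F S (r * real (card S)))"
    if S: "S \<subseteq> \<Omega>" "p ^ m \<le> card S" for S
  proof -
    have SF: "S \<subseteq> carrier F" using S(1) \<Omega>_carrier by blast
    have c: "0 < card S" using S(2) pm by linarith
    have "code_rate F S (RS_code F S (r * real (card S))) \<le> (r * real (card S) + 1) / card S"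
      using r by (intro RS_code_rate SF c) simp
    also have "\<dots> = r + 1 / real (card S)" using c by (simp add: add_divide_distrib)
    also have "\<dots> \<le> r + 1 / real (p ^ m)"
      using S(2) pm by (intro add_left_mono divide_left_mono) (simp_all only: of_nat_le_iff of_nat_0_less_iff mult_pos_pos c zero_le_one)
    finally show ?thesis
      using RS_code_rel_min_dist[OF SF c, of "r * real (card S)"] r c by simp
  qed
  show "code_rate F S (RS_code F S (r * real (card G))) \<le> r + 1 / real (p ^ m)"
    "1 - r \<le> rel_min_dist S (RS_code F S (r * real (card G)))" if S: "S \<in> left_orbits F G H \<alpha>"
  proof -
    have "card S = card G" using S by (auto simp: left_orbits_eq card_left_orbit)
    then show "code_rate F S (RS_code F S (r * real (card G))) \<le> r + 1 / real (p ^ m)"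
      "1 - r \<le> rel_min_dist S (RS_code F S (r * real (card G)))"
      using *[OF orbits_subset(1)[OF S]] G(2) by auto
  qed
  show "code_rate F S (RS_code F S (r * real (card H))) \<le> r + 1 / real (p ^ m)"
    "1 - r \<le> rel_min_dist S (RS_code F S (r * real (card H)))" if S: "S \<in> right_orbits F G H \<alpha>"
  proof -
    have "card S = card H" using S by (auto simp: right_orbits_eq card_right_orbit)
    then show "code_rate F S (RS_code F S (r * real (card H))) \<le> r + 1 / real (p ^ m)"
      "1 - r \<le> rel_min_dist S (RS_code F S (r * real (card H)))"
      using *[OF orbits_subset(2)[OF S]] H(2) by auto
  qed
qed

lemma code_rate_ge_linear:
  fixes r \<gamma> :: real
  assumes r: "0 < r" "r < 1" and \<gamma>: "0 < \<gamma>" "\<gamma> < 1"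
    and cH: "real (card H) = \<gamma> * (real p ^ (m + 1) - 1)"
    and large: "real (m * m + 3) \<le> r * \<gamma> * real p"
  shows "r / (fact (2 * m + 1) * \<gamma>) * (r * \<gamma> - real (m * m + 3) / real p) ^ (2 * m + 1)
    \<le> code_rate F \<Omega> (eval_code F G H \<alpha> r (int (Coset.order A)))"
proof -
  \<comment> \<open>\<open>code_rate_ge\<close> asks for \<open>M + m * m + 1\<close>, times
    \<open>p ^ m\<close>, to be at most \<open>r * card H\<close>. One further unit pays for the
    \<open>- 1\<close> in \<open>card H\<close>, giving \<open>m * m + 2\<close>, and rounding down
    costs at most one more, giving \<open>m * m + 3\<close>.\<close>
  define M where "M = nat \<lfloor>r * \<gamma> * real p - real (m * m + 2)\<rfloor>"
  have M: "r * \<gamma> * real p - real (m * m + 3) \<le> real M" "real M \<le> r * \<gamma> * real p - real (m * m + 2)"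
    using large unfolding M_def by linarith+
  have p0: "0 < real p" using p_gt_1 by simp
  have r\<gamma>: "0 < r * \<gamma>" "r * \<gamma> < 1" using r \<gamma> mult_strict_mono[of r 1 \<gamma> 1] by auto
  have "r * \<gamma> * real p < 1 * real p" by (rule mult_strict_right_mono[OF r\<gamma>(2) p0])
  then have Mp: "M < p" using M(2) by linarith
  have pm1: "1 \<le> real p ^ m" using p_gt_1 by (intro one_le_power) simp
  have "real ((M + m * m + 1) * p ^ m) = (real M + real (m * m + 1)) * real p ^ m"
    by (simp add: algebra_simps)
  also have "\<dots> \<le> (r * \<gamma> * real p - 1) * real p ^ m" using M(2) by (intro mult_right_mono) auto
  also have "\<dots> = r * \<gamma> * real p ^ (m + 1) - real p ^ m" by (simp add: algebra_simps)
  also have "\<dots> \<le> r * \<gamma> * real p ^ (m + 1) - r * \<gamma>" using pm1 r\<gamma> by linarith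
  also have "\<dots> = r * card H" unfolding cH by (simp add: algebra_simps)
  finally have bound: "real ((M + m * m + 1) * p ^ m) \<le> r * card H" .
  have cH': "real (card H) \<le> \<gamma> * real p ^ (m + 1)" unfolding cH using \<gamma> by simp
  have "r / (fact (2 * m + 1) * \<gamma>) * (r * \<gamma> - real (m * m + 3) / real p) ^ (2 * m + 1)
      = r * (r * \<gamma> * real p - real (m * m + 3)) ^ (2 * m + 1) / (fact (2 * m + 1) * (\<gamma> * real p ^ (2 * m + 1)))"
  proof -
    have "r * \<gamma> - real (m * m + 3) / real p = (r * \<gamma> * real p - real (m * m + 3)) / real p"
      using p0 by (simp add: diff_divide_distrib)
    then show ?thesis by (simp only: power_divide times_divide_times_eq mult.assoc)
  qed
  also have "\<gamma> * real p ^ (2 * m + 1) = (\<gamma> * real p ^ (m + 1)) * real p ^ m"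
    by (simp add: power_add mult_2)
  also have "r * (r * \<gamma> * real p - real (m * m + 3)) ^ (2 * m + 1) / (fact (2 * m + 1) * \<dots>)
      \<le> r * real M ^ (2 * m + 1) / (fact (2 * m + 1) * (real (card H) * real p ^ m))"
    using r M(1) large cH' H_card_pos p0 by (intro frac_le mult_left_mono mult_right_mono power_mono) auto
  also have "\<dots> \<le> code_rate F \<Omega> (eval_code F G H \<alpha> r (int (Coset.order A)))"
    by (rule code_rate_ge[OF r Mp bound])
  finally show ?thesis .
qed

end

theorem theorem5p3:
  fixes m :: nat and r \<gamma> :: real
    and F :: "nat \<Rightarrow> ('a, 'b) ring_scheme"
    and G H :: "nat \<Rightarrow> 'a set"
    and \<alpha> :: "nat \<Rightarrow> 'a"
  defines "n \<equiv> \<lambda>p. Coset.order (gen_group (F p) (G p) (H p))"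
  defines "\<Omega> \<equiv> \<lambda>p. eval_set (F p) (G p) (H p) (\<alpha> p)"
  defines "C \<equiv> \<lambda>p. eval_code (F p) (G p) (H p) (\<alpha> p) r (int (n p))"
  assumes "2 \<le> m" and "0 < r" "r < 1" and "0 < \<gamma>" "\<gamma> < 1"
    and "\<exists>k::nat. 0 < k \<and> \<gamma> = 1 / real k"
    and "\<And>p. p \<in> admissible_primes \<gamma> \<Longrightarrow> code_setting p m \<gamma> (F p) (G p) (H p) (\<alpha> p)"
  shows
    "(\<forall>p \<in> admissible_primes \<gamma>. card (\<Omega> p) = n p) \<and>
     (\<forall>p \<in> admissible_primes \<gamma>. C p = tanner_code (F p) (G p) (H p) (\<alpha> p) r) \<and>
     (((\<lambda>p. second_singular_value (norm_biadjacency (F p) (G p) (H p))) \<longlongrightarrow> 0)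
       (at_top_admissible \<gamma>)) \<and>
     (\<forall>p \<in> admissible_primes \<gamma>. \<forall>S \<in> left_orbits (F p) (G p) (H p) (\<alpha> p).
       card S = card (G p) \<and> card S = p ^ m) \<and>
     (\<forall>p \<in> admissible_primes \<gamma>. \<forall>S \<in> right_orbits (F p) (G p) (H p) (\<alpha> p).
       card S = card (H p) \<and> real (card S) = \<gamma> * (real p ^ (m + 1) - 1)) \<and>
     ((\<lambda>p. real (card (G p)))
       \<in> \<Theta>[at_top_admissible \<gamma>](\<lambda>p. real (n p) powr (real m / real ((m + 1)\<^sup>2)))) \<and>
     ((\<lambda>p. real (card (H p)))
       \<in> \<Theta>[at_top_admissible \<gamma>](\<lambda>p. real (n p) powr (1 / real (m + 1)))) \<and>
     (\<exists>\<epsilon> :: nat \<Rightarrow> real. (\<epsilon> \<longlongrightarrow> 0) (at_top_admissible \<gamma>) \<and>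
       (\<forall>p \<in> admissible_primes \<gamma>.
         (\<forall>S \<in> left_orbits (F p) (G p) (H p) (\<alpha> p).
            code_rate (F p) S (RS_code (F p) S (r * real (card (G p)))) \<le> r + \<epsilon> p \<and>
            rel_min_dist S (RS_code (F p) S (r * real (card (G p)))) \<ge> 1 - r - \<epsilon> p) \<and>
         (\<forall>S \<in> right_orbits (F p) (G p) (H p) (\<alpha> p).
            code_rate (F p) S (RS_code (F p) S (r * real (card (H p)))) \<le> r + \<epsilon> p \<and>
            rel_min_dist S (RS_code (F p) S (r * real (card (H p)))) \<ge> 1 - r - \<epsilon> p))) \<and>
     (Liminf (at_top_admissible \<gamma>) (\<lambda>p. ereal (rel_min_dist (\<Omega> p) (C p)))
       \<ge> ereal ((1 - r)\<^sup>2)) \<and>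
     (Liminf (at_top_admissible \<gamma>) (\<lambda>p. ereal (code_rate (F p) (\<Omega> p) (C p)))
       \<ge> ereal (\<gamma> ^ (2 * m) * r ^ (2 * m + 2) / fact (2 * m + 1)))"
proof -
  note cs = assms(10)
  have c01: "0 < \<gamma> / 2" "\<gamma> / 2 < 1" using \<open>0 < \<gamma>\<close> \<open>\<gamma> < 1\<close> by auto
  have es: "\<exists>K. evaluation_setting (F p) p m (G p) K (H p) (\<alpha> p)" if "p \<in> admissible_primes \<gamma>" for p
    using code_setting_evaluation_setting[OF cs[OF that] that] assms by blast
  have cG: "card (G p) = p ^ m" and cH: "real (card (H p)) = \<gamma> * (real p ^ (m + 1) - 1)"
    if "p \<in> admissible_primes \<gamma>" for p
    using cs[OF that] by (simp_all add: code_setting_def)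
  have p2: "2 \<le> real p" if "p \<in> admissible_primes \<gamma>" for p
    using that prime_ge_2_nat by (auto simp: admissible_primes_def)
  \<comment> \<open>The lower constant \<open>\<gamma> / 2\<close> comes from
    \<open>p ^ (m + 1) - 1 \<ge> p ^ (m + 1) / 2\<close>.\<close>
  have cH_bounds: "\<gamma> / 2 * real p ^ (m + 1) \<le> card (H p)" "card (H p) \<le> real p ^ (m + 1)"
    if "p \<in> admissible_primes \<gamma>" for p
  proof -
    have "2 ^ 1 \<le> real p ^ 1" using p2[OF that] by simp
    also have "\<dots> \<le> real p ^ (m + 1)" using p2[OF that] by (intro power_increasing) auto
    finally have ge: "2 \<le> real p ^ (m + 1)" by simp
    then have "\<gamma> * (real p ^ (m + 1) / 2) \<le> \<gamma> * (real p ^ (m + 1) - 1)"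
      using \<open>0 < \<gamma>\<close> by (intro mult_left_mono) auto
    then show "\<gamma> / 2 * real p ^ (m + 1) \<le> card (H p)" using cH[OF that] by simp
    have "\<gamma> * (real p ^ (m + 1) - 1) \<le> 1 * (real p ^ (m + 1) - 1)"
      using \<open>\<gamma> < 1\<close> ge by (intro mult_right_mono) auto
    then show "card (H p) \<le> real p ^ (m + 1)" using cH[OF that] by simp
  qed
  have nH: "n p = card (H p) * p ^ (m * (m + 1))" if "p \<in> admissible_primes \<gamma>" for p
  proof -
    obtain K where "evaluation_setting (F p) p m (G p) K (H p) (\<alpha> p)" using es \<open>p \<in> _\<close> by blast
    then interpret evaluation_setting "F p" p m "G p" K "H p" "\<alpha> p" .
    show ?thesis unfolding n_def by (rule order_A)
  qed
  have len: "card (\<Omega> p) = n p" and tanner: "C p = tanner_code (F p) (G p) (H p) (\<alpha> p) r"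
    and sv: "0 \<le> second_singular_value (norm_biadjacency (F p) (G p) (H p)) \<and>
      second_singular_value (norm_biadjacency (F p) (G p) (H p)) \<le> sqrt (real (p ^ m) / real (card (H p)))"
    and left: "\<forall>S\<in>left_orbits (F p) (G p) (H p) (\<alpha> p). card S = card (G p) \<and> card S = p ^ m"
    and right: "\<forall>S\<in>right_orbits (F p) (G p) (H p) (\<alpha> p).
      card S = card (H p) \<and> real (card S) = \<gamma> * (real p ^ (m + 1) - 1)"
    and local_left: "\<forall>S\<in>left_orbits (F p) (G p) (H p) (\<alpha> p).
      code_rate (F p) S (RS_code (F p) S (r * real (card (G p)))) \<le> r + 1 / real (p ^ m) \<and>
      1 - r \<le> rel_min_dist S (RS_code (F p) S (r * real (card (G p))))"
    and local_right: "\<forall>S\<in>right_orbits (F p) (G p) (H p) (\<alpha> p).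
      code_rate (F p) S (RS_code (F p) S (r * real (card (H p)))) \<le> r + 1 / real (p ^ m) \<and>
      1 - r \<le> rel_min_dist S (RS_code (F p) S (r * real (card (H p))))"
    and dist: "(1 - r)\<^sup>2 - (1 - r) * sqrt (real (p ^ m) / real (card (H p))) \<le> rel_min_dist (\<Omega> p) (C p)"
    and rate: "real (m * m + 3) \<le> r * \<gamma> * real p \<Longrightarrow>
      r / (fact (2 * m + 1) * \<gamma>) * (r * \<gamma> - real (m * m + 3) / real p) ^ (2 * m + 1)
        \<le> code_rate (F p) (\<Omega> p) (C p)"
    if adm: "p \<in> admissible_primes \<gamma>" for p
  proof -
    obtain K where "evaluation_setting (F p) p m (G p) K (H p) (\<alpha> p)" using es adm by blast
    then interpret E: evaluation_setting "F p" p m "G p" K "H p" "\<alpha> p" .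
    note [simp] = n_def \<Omega>_def C_def
    show "card (\<Omega> p) = n p" using E.card_\<Omega> by simp
    show "C p = tanner_code (F p) (G p) (H p) (\<alpha> p) r" using E.eval_code_eq_tanner by simp
    show "0 \<le> second_singular_value (norm_biadjacency (F p) (G p) (H p)) \<and>
      second_singular_value (norm_biadjacency (F p) (G p) (H p)) \<le> sqrt (real (p ^ m) / real (card (H p)))"
      by (rule E.second_singular_value_norm_biadjacency)
    show "\<forall>S\<in>left_orbits (F p) (G p) (H p) (\<alpha> p). card S = card (G p) \<and> card S = p ^ m"
      using E.card_left_orbit cG[OF adm] by (auto simp: E.left_orbits_eq)
    show "\<forall>S\<in>right_orbits (F p) (G p) (H p) (\<alpha> p).
      card S = card (H p) \<and> real (card S) = \<gamma> * (real p ^ (m + 1) - 1)"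
      using E.card_right_orbit cH[OF adm] by (auto simp: E.right_orbits_eq)
    show "\<forall>S\<in>left_orbits (F p) (G p) (H p) (\<alpha> p).
      code_rate (F p) S (RS_code (F p) S (r * real (card (G p)))) \<le> r + 1 / real (p ^ m) \<and>
      1 - r \<le> rel_min_dist S (RS_code (F p) S (r * real (card (G p))))"
      using E.local_code_bounds(1,2)[OF \<open>0 < r\<close> \<open>r < 1\<close>] by blast
    show "\<forall>S\<in>right_orbits (F p) (G p) (H p) (\<alpha> p).
      code_rate (F p) S (RS_code (F p) S (r * real (card (H p)))) \<le> r + 1 / real (p ^ m) \<and>
      1 - r \<le> rel_min_dist S (RS_code (F p) S (r * real (card (H p))))"
      using E.local_code_bounds(3,4)[OF \<open>0 < r\<close> \<open>r < 1\<close>] by blast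
    show "(1 - r)\<^sup>2 - (1 - r) * sqrt (real (p ^ m) / real (card (H p))) \<le> rel_min_dist (\<Omega> p) (C p)"
      using E.rel_min_dist_ge[OF \<open>0 < r\<close> \<open>r < 1\<close>] by simp
    show "r / (fact (2 * m + 1) * \<gamma>) * (r * \<gamma> - real (m * m + 3) / real p) ^ (2 * m + 1)
        \<le> code_rate (F p) (\<Omega> p) (C p)" if "real (m * m + 3) \<le> r * \<gamma> * real p"
      unfolding \<Omega>_def C_def n_def
      by (rule E.code_rate_ge_linear[OF \<open>0 < r\<close> \<open>r < 1\<close> \<open>0 < \<gamma>\<close> \<open>\<gamma> < 1\<close> cH[OF adm] that])
  qed
  \<comment> \<open>The squared error is at most a constant times \<open>1 / p\<close>. This one
    estimate makes both the second singular value and the loss in the distance tend to zero.\<close>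
  have ratio: "sqrt (real (p ^ m) / real (card (H p))) \<le> sqrt (2 / \<gamma> * inverse (real p))"
    if "p \<in> admissible_primes \<gamma>" for p
  proof -
    have p0: "0 < real p" using p2[OF that] by simp
    have "real (p ^ m) / real (card (H p)) \<le> real p ^ m / (\<gamma> / 2 * real p ^ (m + 1))"
      using cH_bounds(1)[OF that] p0 \<open>0 < \<gamma>\<close> by (intro frac_le) auto
    also have "\<dots> = 2 / \<gamma> * inverse (real p)" using p0 \<open>0 < \<gamma>\<close> by (simp add: field_simps)
    finally show ?thesis by (rule real_sqrt_le_mono)
  qed
  have sqrt0: "((\<lambda>p. sqrt (2 / \<gamma> * inverse (real p))) \<longlongrightarrow> 0) (at_top_admissible \<gamma>)"
    using tendsto_real_sqrt[OF tendsto_mult_left[OF lim_inverse_n, of "2 / \<gamma>"]]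
    by (intro tendsto_at_top_admissible) simp
  have "((\<lambda>p. second_singular_value (norm_biadjacency (F p) (G p) (H p))) \<longlongrightarrow> 0) (at_top_admissible \<gamma>)"
    by (rule tendsto_sandwich[OF _ _ tendsto_const sqrt0])
      (rule eventually_at_top_admissible; use sv ratio order_trans in blast)+
  moreover have "(\<lambda>p. real (card (G p)))
      \<in> \<Theta>[at_top_admissible \<gamma>](\<lambda>p. real (n p) powr (real m / real ((m + 1)\<^sup>2)))"
    and "(\<lambda>p. real (card (H p))) \<in> \<Theta>[at_top_admissible \<gamma>](\<lambda>p. real (n p) powr (1 / real (m + 1)))"
  proof -
    \<comment> \<open>The exponent is \<open>(m + 1) + m * (m + 1)\<close>, the two parts coming
      from \<open>H\<close> and \<open>V\<close>. Relative to it, \<open>card G\<close> and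
      \<open>card H\<close> have the exponents \<open>m\<close> and \<open>m + 1\<close>.\<close>
    have x: "\<gamma> / 2 * real p ^ (m + 1)\<^sup>2 \<le> real (n p)" "real (n p) \<le> real p ^ (m + 1)\<^sup>2"
      if "p \<in> admissible_primes \<gamma>" for p
    proof -
      have "(m + 1)\<^sup>2 = (m + 1) + m * (m + 1)" by (simp add: power2_eq_square)
      then have e: "real p ^ (m + 1)\<^sup>2 = real p ^ (m + 1) * real p ^ (m * (m + 1))"
        by (simp only: power_add)
      have "(\<gamma> / 2 * real p ^ (m + 1)) * real p ^ (m * (m + 1)) \<le> real (n p)"
        "real (n p) \<le> real p ^ (m + 1) * real p ^ (m * (m + 1))"
        unfolding nH[OF that] of_nat_mult of_nat_power
        by (intro mult_right_mono cH_bounds that zero_le_power of_nat_0_le_iff)+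
      then show "\<gamma> / 2 * real p ^ (m + 1)\<^sup>2 \<le> real (n p)" "real (n p) \<le> real p ^ (m + 1)\<^sup>2"
        by (simp_all only: e mult.assoc)
    qed
    have pw: "(real p ^ k) powr (real j / real k) = real p ^ j"
      if "p \<in> admissible_primes \<gamma>" "0 < k" for p k j :: nat
    proof -
      have "0 < real p" using p2[OF that(1)] by simp
      then show ?thesis using that(2) by (simp add: powr_powr flip: powr_realpow)
    qed
    have pH: "(real p ^ (m + 1)\<^sup>2) powr (1 / real (m + 1)) = real p ^ (m + 1)"
      if "p \<in> admissible_primes \<gamma>" for p
    proof -
      have "1 / real (m + 1) = real (m + 1) / real ((m + 1)\<^sup>2)"
        by (simp only: power2_eq_square of_nat_mult) simp
      then show ?thesis using pw[OF that, of "(m + 1)\<^sup>2" "m + 1"] by simp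
    qed
    show "(\<lambda>p. real (card (G p))) \<in> \<Theta>[at_top_admissible \<gamma>](\<lambda>p. real (n p) powr (real m / real ((m + 1)\<^sup>2)))"
    proof (rule bigtheta_powr[OF c01(1), of _ "\<lambda>p. real p ^ (m + 1)\<^sup>2"])
      show "\<forall>\<^sub>F p in at_top_admissible \<gamma>. 0 \<le> real p ^ (m + 1)\<^sup>2 \<and> \<gamma> / 2 * real p ^ (m + 1)\<^sup>2 \<le> real (n p) \<and>
        real (n p) \<le> real p ^ (m + 1)\<^sup>2 \<and>
        \<gamma> / 2 * (real p ^ (m + 1)\<^sup>2) powr (real m / real ((m + 1)\<^sup>2)) \<le> real (card (G p)) \<and>
        real (card (G p)) \<le> (real p ^ (m + 1)\<^sup>2) powr (real m / real ((m + 1)\<^sup>2))"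
      proof (rule eventually_at_top_admissible[of _ 0])
        fix p assume adm: "p \<in> admissible_primes \<gamma>"
        have "\<gamma> / 2 * real p ^ m \<le> 1 * real p ^ m" using c01 by (intro mult_right_mono) auto
        then show "0 \<le> real p ^ (m + 1)\<^sup>2 \<and> \<gamma> / 2 * real p ^ (m + 1)\<^sup>2 \<le> real (n p) \<and>
          real (n p) \<le> real p ^ (m + 1)\<^sup>2 \<and>
          \<gamma> / 2 * (real p ^ (m + 1)\<^sup>2) powr (real m / real ((m + 1)\<^sup>2)) \<le> real (card (G p)) \<and>
          real (card (G p)) \<le> (real p ^ (m + 1)\<^sup>2) powr (real m / real ((m + 1)\<^sup>2))"
          using x[OF adm] cG[OF adm] pw[OF adm, of "(m + 1)\<^sup>2" m] by simp
      qed
    qed simp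
    show "(\<lambda>p. real (card (H p))) \<in> \<Theta>[at_top_admissible \<gamma>](\<lambda>p. real (n p) powr (1 / real (m + 1)))"
    proof (rule bigtheta_powr[OF c01(1), of _ "\<lambda>p. real p ^ (m + 1)\<^sup>2"])
      show "\<forall>\<^sub>F p in at_top_admissible \<gamma>. 0 \<le> real p ^ (m + 1)\<^sup>2 \<and> \<gamma> / 2 * real p ^ (m + 1)\<^sup>2 \<le> real (n p) \<and>
        real (n p) \<le> real p ^ (m + 1)\<^sup>2 \<and>
        \<gamma> / 2 * (real p ^ (m + 1)\<^sup>2) powr (1 / real (m + 1)) \<le> real (card (H p)) \<and>
        real (card (H p)) \<le> (real p ^ (m + 1)\<^sup>2) powr (1 / real (m + 1))"
        by (rule eventually_at_top_admissible[of _ 0])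
          (simp only: x pH cH_bounds zero_le_power of_nat_0_le_iff simp_thms)
    qed simp
  qed
  moreover have "\<exists>\<epsilon> :: nat \<Rightarrow> real. (\<epsilon> \<longlongrightarrow> 0) (at_top_admissible \<gamma>) \<and>
       (\<forall>p \<in> admissible_primes \<gamma>.
         (\<forall>S \<in> left_orbits (F p) (G p) (H p) (\<alpha> p).
            code_rate (F p) S (RS_code (F p) S (r * real (card (G p)))) \<le> r + \<epsilon> p \<and>
            rel_min_dist S (RS_code (F p) S (r * real (card (G p)))) \<ge> 1 - r - \<epsilon> p) \<and>
         (\<forall>S \<in> right_orbits (F p) (G p) (H p) (\<alpha> p).
            code_rate (F p) S (RS_code (F p) S (r * real (card (H p)))) \<le> r + \<epsilon> p \<and>
            rel_min_dist S (RS_code (F p) S (r * real (card (H p)))) \<ge> 1 - r - \<epsilon> p))"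
  proof (intro exI conjI ballI)
    have "((\<lambda>p. inverse (real p) ^ m) \<longlongrightarrow> 0 ^ m) (at_top_admissible \<gamma>)"
      by (intro tendsto_at_top_admissible tendsto_power lim_inverse_n)
    then show "((\<lambda>p. 1 / real (p ^ m)) \<longlongrightarrow> 0) (at_top_admissible \<gamma>)"
      using \<open>2 \<le> m\<close> by (simp add: power_0_left power_divide inverse_eq_divide)
  next
    fix p S assume adm: "p \<in> admissible_primes \<gamma>"
    have ge: "1 - r - 1 / real (p ^ m) \<le> x" if "1 - r \<le> x" for x :: real
    proof -
      have "0 \<le> 1 / real (p ^ m)" by simp
      then show ?thesis using that by linarith
    qed
    show "code_rate (F p) S (RS_code (F p) S (r * real (card (G p)))) \<le> r + 1 / real (p ^ m)"
      "rel_min_dist S (RS_code (F p) S (r * real (card (G p)))) \<ge> 1 - r - 1 / real (p ^ m)"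
      if "S \<in> left_orbits (F p) (G p) (H p) (\<alpha> p)"
      using bspec[OF local_left[OF adm] that] ge by blast+
    show "code_rate (F p) S (RS_code (F p) S (r * real (card (H p)))) \<le> r + 1 / real (p ^ m)"
      "rel_min_dist S (RS_code (F p) S (r * real (card (H p)))) \<ge> 1 - r - 1 / real (p ^ m)"
      if "S \<in> right_orbits (F p) (G p) (H p) (\<alpha> p)"
      using bspec[OF local_right[OF adm] that] ge by blast+
  qed
  moreover have "ereal ((1 - r)\<^sup>2) \<le> Liminf (at_top_admissible \<gamma>) (\<lambda>p. ereal (rel_min_dist (\<Omega> p) (C p)))"
  proof (rule tendsto_le_Liminf)
    show "((\<lambda>p. (1 - r)\<^sup>2 - (1 - r) * sqrt (2 / \<gamma> * inverse (real p))) \<longlongrightarrow> (1 - r)\<^sup>2) (at_top_admissible \<gamma>)"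
      using tendsto_diff[OF tendsto_const tendsto_mult_left[OF sqrt0], of "(1 - r)\<^sup>2" "1 - r"] by simp
    show "\<forall>\<^sub>F p in at_top_admissible \<gamma>.
        (1 - r)\<^sup>2 - (1 - r) * sqrt (2 / \<gamma> * inverse (real p)) \<le> rel_min_dist (\<Omega> p) (C p)"
    proof (rule eventually_at_top_admissible[of _ 0])
      fix p assume adm: "p \<in> admissible_primes \<gamma>"
      have "(1 - r) * sqrt (real (p ^ m) / real (card (H p))) \<le> (1 - r) * sqrt (2 / \<gamma> * inverse (real p))"
        using ratio[OF adm] \<open>r < 1\<close> by (intro mult_left_mono) auto
      then show "(1 - r)\<^sup>2 - (1 - r) * sqrt (2 / \<gamma> * inverse (real p)) \<le> rel_min_dist (\<Omega> p) (C p)"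
        using dist[OF adm] by linarith
    qed
  qed
  moreover have "ereal (\<gamma> ^ (2 * m) * r ^ (2 * m + 2) / fact (2 * m + 1))
      \<le> Liminf (at_top_admissible \<gamma>) (\<lambda>p. ereal (code_rate (F p) (\<Omega> p) (C p)))"
  proof (rule tendsto_le_Liminf)
    have "((\<lambda>p. r / (fact (2 * m + 1) * \<gamma>) * (r * \<gamma> - real (m * m + 3) * inverse (real p)) ^ (2 * m + 1))
        \<longlongrightarrow> r / (fact (2 * m + 1) * \<gamma>) * (r * \<gamma> - real (m * m + 3) * 0) ^ (2 * m + 1)) (at_top_admissible \<gamma>)"
      by (intro tendsto_at_top_admissible tendsto_intros lim_inverse_n)
    \<comment> \<open>Of the \<open>2 * m + 1\<close> factors \<open>\<gamma>\<close> from the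
      simplex one cancels against \<open>card H\<close>; the additional \<open>r\<close> is the
      share of free coefficients.\<close>
    moreover have "r / (fact (2 * m + 1) * \<gamma>) * (r * \<gamma> - real (m * m + 3) * 0) ^ (2 * m + 1)
        = \<gamma> ^ (2 * m) * r ^ (2 * m + 2) / fact (2 * m + 1)"
      using \<open>0 < \<gamma>\<close> by (simp add: power_mult_distrib del: fact_Suc)
    ultimately show "((\<lambda>p. r / (fact (2 * m + 1) * \<gamma>) * (r * \<gamma> - real (m * m + 3) / real p) ^ (2 * m + 1))
        \<longlongrightarrow> \<gamma> ^ (2 * m) * r ^ (2 * m + 2) / fact (2 * m + 1)) (at_top_admissible \<gamma>)"
      by (simp only: divide_inverse)
    show "\<forall>\<^sub>F p in at_top_admissible \<gamma>. r / (fact (2 * m + 1) * \<gamma>) * (r * \<gamma> - real (m * m + 3) / real p) ^ (2 * m + 1)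
        \<le> code_rate (F p) (\<Omega> p) (C p)"
    \<comment> \<open>From this threshold on the base of the power is nonnegative, which is the
      condition in \<open>rate\<close>.\<close>
    proof (rule eventually_at_top_admissible[of _ "nat \<lceil>real (m * m + 3) / (r * \<gamma>)\<rceil>"])
      fix p assume adm: "p \<in> admissible_primes \<gamma>" and "nat \<lceil>real (m * m + 3) / (r * \<gamma>)\<rceil> \<le> p"
      then have "real (m * m + 3) / (r * \<gamma>) \<le> real p" by (simp only: nat_le_iff ceiling_le_iff of_int_of_nat_eq)
      then have "real (m * m + 3) \<le> r * \<gamma> * real p"
        using \<open>0 < r\<close> \<open>0 < \<gamma>\<close> by (simp only: pos_divide_le_eq mult_pos_pos mult.commute)
      then show "r / (fact (2 * m + 1) * \<gamma>) * (r * \<gamma> - real (m * m + 3) / real p) ^ (2 * m + 1)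
        \<le> code_rate (F p) (\<Omega> p) (C p)" by (rule rate[OF adm])
    qed
  qed
  ultimately show ?thesis using len tanner left right by blast
qed

end
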